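(* Let $m,n\ge1$, $0\le\delta<1$, let $a$ be a symbol in the class $m$-$S^0_{1,\delta}$, and let $T_a$ be the associated $m$-linear pseudodifferential operator. Then $T_a$ has an associated kernel $K$ satisfying the following two conditions: (a) for every $N\ge mn$ there is $C>0$ such that $|K(y_0,y_1,\ldots,y_m)|\le C\big(\sum_{k,l=0}^m|y_k-y_l|\big)^{-N}$ for all $(y_0,\ldots,y_m)$ off the diagonal $y_0=\cdots=y_m$; (b) there is $\epsilon>0$ such that for every $N>0$ there is $C>0$ such that, for all $0\le j\le m$, $$|K(y_0,\ldots,y_j,\ldots,y_m)-K(y_0,\ldots,y_j',\ldots,y_m)|\le \frac{C|y_j-y_j'|^\epsilon}{(\sum_{k,l=0}^m|y_k-y_l|)^{mn+\epsilon}}\min\{1,h^{-N}\}$$ whenever $|y_j-y_j'|\le \frac12\max_{0\le k\le m}|y_j-y_k|=:h$.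
   Context: Symbols: $a:\mathbb R^{n(m+1)}\to\mathbb C$, $a=a(x,\xi)$ with $\xi=(\xi_1,\ldots,\xi_m)\in\mathbb R^{mn}$, smooth, belongs to $m$-$S^l_{\rho,\delta}$ ($l\in\mathbb R$, $\rho,\delta\in[0,1]$) if for all multi-indices $\alpha,\beta_1,\ldots,\beta_m$ there is $C$ with $$|\partial_x^\alpha\partial_{\xi_1}^{\beta_1}\cdots\partial_{\xi_m}^{\beta_m}a(x,\xi)|\le C(1+|\xi_1|+\cdots+|\xi_m|)^{l+\delta|\alpha|-\rho(|\beta_1|+\cdots+|\beta_m|)}.$$ For $f_1,\ldots,f_m\in\mathcal S(\mathbb R^n)$, $T_a(\vec f)(x)=\int_{\mathbb R^{mn}}a(x,\xi)\prod_{j=1}^m\hat f_j(\xi_j)e^{i\langle x,\xi_1+\cdots+\xi_m\rangle}d\xi$, with $\hat f(\xi)=\int f(x)e^{-i\langle x,\xi\rangle}dx$ (normalizing constants are immaterial). Associated kernel: a function $K$ defined off the diagonal $x=y_1=\cdots=y_m$ in $(\mathbb R^n)^{m+1}$ is the kernel associated to an $m$-linear operator $T$ on Schwartz functions if $T(f_1,\ldots,f_m)(x)=\int_{(\mathbb R^n)^m}K(x,y_1,\ldots,y_m)f_1(y_1)\cdots f_m(y_m)\,dy_1\cdots dy_m$ for all $x\notin\bigcap_{j=1}^m\mathrm{supp} f_j$. *)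

theory Defs
  imports "HOL-Analysis.Analysis"
begin

section \<open>Partial derivatives, smooth and Schwartz functions\<close>

definition partial_deriv ::
    "'b::euclidean_space \<Rightarrow> ('b \<Rightarrow> complex) \<Rightarrow> 'b \<Rightarrow> complex" where
  "partial_deriv b f p = vector_derivative (\<lambda>t::real. f (p + t *\<^sub>R b)) (at 0)"

definition iter_partial ::
    "'b::euclidean_space list \<Rightarrow> ('b \<Rightarrow> complex) \<Rightarrow> 'b \<Rightarrow> complex" where
  "iter_partial bs f = foldr partial_deriv bs f"

text \<open>All iterated coordinate partial derivatives are (totally) differentiable, hence continuous;
  this is the class of infinitely differentiable functions.\<close>

definition smooth :: "('b::euclidean_space \<Rightarrow> complex) \<Rightarrow> bool" where
  "smooth f \<longleftrightarrow> (\<forall>bs. set bs \<subseteq> Basis \<longrightarrow> iter_partial bs f differentiable_on UNIV)"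

definition schwartz :: "('b::euclidean_space \<Rightarrow> complex) \<Rightarrow> bool" where
  "schwartz f \<longleftrightarrow> smooth f \<and>
     (\<forall>(k::nat) bs. set bs \<subseteq> Basis \<longrightarrow>
        (\<exists>C. \<forall>x. (1 + norm x) ^ k * norm (iter_partial bs f x) \<le> C))"

definition supp :: "('b::euclidean_space \<Rightarrow> complex) \<Rightarrow> 'b set" where
  "supp f = closure {x. f x \<noteq> 0}"

definition fourier :: "(real^'n \<Rightarrow> complex) \<Rightarrow> real^'n \<Rightarrow> complex" where
  "fourier f \<xi> = (\<integral>x. f x * cis (- (x \<bullet> \<xi>)) \<partial>lborel)"


section \<open>Symbols\<close>

text \<open>\<open>n = CARD('n)\<close> and \<open>m = CARD('m)\<close>; a point of \<open>real^'n^'m\<close> is \<open>\<xi> = (\<xi>\<^sub>1, \<dots>, \<xi>\<^sub>m)\<close> with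
  \<open>\<xi>\<^sub>j = \<xi> $ j\<close>.\<close>

text \<open>The list \<open>bs\<close> of coordinate directions realises the multi-index
  \<open>(\<alpha>, \<beta>\<^sub>1, \<dots>, \<beta>\<^sub>m)\<close>: the direction of \<open>x\<^sub>i\<close> occurs \<open>\<alpha> i\<close> times and the direction of the
  \<open>i\<close>-th coordinate of \<open>\<xi>\<^sub>j\<close> occurs \<open>\<beta> j i\<close> times.  For a smooth function the iterated
  derivative along \<open>bs\<close> does not depend on the order of \<open>bs\<close>.\<close>

definition realises_multi_index ::
    "((real^'n) \<times> (real^'n^'m)) list \<Rightarrow> ('n \<Rightarrow> nat) \<Rightarrow> ('m \<Rightarrow> 'n \<Rightarrow> nat) \<Rightarrow> bool" where
  "realises_multi_index bs \<alpha> \<beta> \<longleftrightarrow> set bs \<subseteq> Basis \<and>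
     (\<forall>i. count_list bs (axis i 1, 0) = \<alpha> i) \<and>
     (\<forall>j i. count_list bs (0, axis j (axis i 1)) = \<beta> j i)"

definition symbol_class ::
    "real \<Rightarrow> real \<Rightarrow> real \<Rightarrow> ((real^'n) \<times> (real^'n^'m) \<Rightarrow> complex) set" where
  "symbol_class l \<rho> \<delta> = {a. smooth a \<and>
     (\<forall>\<alpha> \<beta>. \<exists>C. \<forall>bs. realises_multi_index bs \<alpha> \<beta> \<longrightarrow>
        (\<forall>x \<xi>. norm (iter_partial bs a (x, \<xi>)) \<le>
           C * (1 + (\<Sum>j\<in>UNIV. norm (\<xi> $ j))) powr
             (l + \<delta> * real (\<Sum>i\<in>UNIV. \<alpha> i)
                - \<rho> * real (\<Sum>j\<in>UNIV. \<Sum>i\<in>UNIV. \<beta> j i))))}"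

definition pseudo_op ::
    "((real^'n) \<times> (real^'n^'m) \<Rightarrow> complex) \<Rightarrow> ('m \<Rightarrow> real^'n \<Rightarrow> complex) \<Rightarrow> real^'n \<Rightarrow> complex" where
  "pseudo_op a f x =
     (\<integral>\<xi>. a (x, \<xi>) * (\<Prod>j\<in>UNIV. fourier (f j) (\<xi> $ j)) * cis (x \<bullet> (\<Sum>j\<in>UNIV. \<xi> $ j)) \<partial>lborel)"


section \<open>Kernels\<close>

text \<open>A point \<open>(y\<^sub>0, y\<^sub>1, \<dots>, y\<^sub>m)\<close> is a function on \<open>'m option\<close>, where \<open>None\<close> is the index \<open>0\<close>.
  A kernel is a total function, but its values on the diagonal are never used.\<close>

definition kernel_point :: "real^'n \<Rightarrow> real^'n^'m \<Rightarrow> 'm option \<Rightarrow> real^'n" where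
  "kernel_point x y = (\<lambda>k. case k of None \<Rightarrow> x | Some j \<Rightarrow> y $ j)"

definition off_diagonal :: "('m option \<Rightarrow> real^'n) \<Rightarrow> bool" where
  "off_diagonal y \<longleftrightarrow> (\<exists>k l. y k \<noteq> y l)"

definition total_dist :: "('m::finite option \<Rightarrow> real^'n) \<Rightarrow> real" where
  "total_dist y = (\<Sum>k\<in>UNIV. \<Sum>l\<in>UNIV. norm (y k - y l))"

text \<open>Integrability is stated explicitly, because the library integral of a non-integrable
  function is \<open>0\<close>.\<close>

definition associated_kernel ::
    "(('m::finite \<Rightarrow> real^'n \<Rightarrow> complex) \<Rightarrow> real^'n \<Rightarrow> complex) \<Rightarrow>
     (('m option \<Rightarrow> real^'n) \<Rightarrow> complex) \<Rightarrow> bool" where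
  "associated_kernel T K \<longleftrightarrow>
     (\<forall>f x. (\<forall>j. schwartz (f j)) \<longrightarrow> x \<notin> (\<Inter>j. supp (f j)) \<longrightarrow>
        integrable lborel (\<lambda>y. K (kernel_point x y) * (\<Prod>j\<in>UNIV. f j (y $ j))) \<and>
        T f x = (\<integral>y. K (kernel_point x y) * (\<Prod>j\<in>UNIV. f j (y $ j)) \<partial>lborel))"

end

theory Submission
  imports Defs "HOL-Probability.Probability"
begin

text \<open>
  Write \<open>z = (x - y\<^sub>1, \<dots>, x - y\<^sub>m)\<close> and \<open>D = m n\<close>.  Formally the kernel is the integral of
  \<open>a (x, \<xi>) * cis (z \<bullet> \<xi>)\<close> over \<open>\<xi>\<close>, which does not converge absolutely.  The classical remedies are
  integration by parts and smooth cut-offs in \<open>\<xi>\<close>.  Finite differences do both jobs: for the half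
  period \<open>h = (pi / (norm z)\<^sup>2) *\<^sub>R z\<close>, replacing a symbol by its difference with step \<open>h\<close> multiplies
  the integral by \<open>- 2\<close>, and after \<open>M\<close> differences the integrand is bounded by a constant times
  \<open>norm h ^ M * (max 1 (norm h) + norm \<xi>) ^ (- M)\<close> (\<open>shift_diff_symbol_bound\<close>).  For large \<open>M\<close> this
  is integrable; it defines the kernel (\<open>osc_kernel\<close>), and the value does not depend on \<open>M\<close>.  The
  integral of the bound is of the order of \<open>norm h ^ D\<close> for large \<open>h\<close> and \<open>norm h ^ M\<close> for small
  \<open>h\<close>.  As \<open>norm h = pi / norm z\<close>, this is the singularity at the diagonal together with the rapid
  decay away from it (\<open>osc_kernel_size\<close>).

  For the regularity with \<open>\<epsilon> = 1\<close>, the same step \<open>h\<close> is used at two neighbouring points.  A change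
  of \<open>z\<close> costs a factor \<open>norm \<xi>\<close>, and a change of \<open>x\<close> inside the symbol raises its order by
  \<open>\<delta>\<close>; both orders are at most one, so the loss is at most one power of \<open>max 1 (norm h)\<close>
  (\<open>osc_kernel_difference\<close>).

  The kernel represents the operator because the pairing of the symbol with the transform \<open>\<Phi>\<close> of
  \<open>f\<^sub>1 \<otimes> \<dots> \<otimes> f\<^sub>m\<close> equals that of the kernel with the function itself
  (\<open>fourier_pairing_eq_osc_kernel\<close>).  As functions of a translation \<open>\<eta>\<close> of \<open>\<Phi>\<close>, the two sides have
  equal \<open>M\<close>-th differences, so that they differ by a bounded polynomial, a constant.  Letting \<open>\<eta>\<close>
  tend to infinity shows that the constant is zero: the symbol is slowly varying, and the integral
  of \<open>\<Phi>\<close> vanishes by Fourier inversion, since \<open>f\<^sub>1 \<otimes> \<dots> \<otimes> f\<^sub>m\<close> is zero near \<open>(x, \<dots>, x)\<close>.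
\<close>

definition shift_diff :: "'v::ab_group_add \<Rightarrow> ('v \<Rightarrow> complex) \<Rightarrow> 'v \<Rightarrow> complex" where
  "shift_diff h g \<xi> = g (\<xi> + h) - g \<xi>"

section \<open>Finite differences of smooth functions\<close>

lemma shift_diff_pow_Suc:
  "(shift_diff h ^^ Suc M) g \<xi> = (shift_diff h ^^ M) g (\<xi> + h) - (shift_diff h ^^ M) g \<xi>"
  by (simp add: shift_diff_def)

lemma iter_partial_Nil [simp]: "iter_partial [] f = f"
  by (simp add: iter_partial_def)

lemma iter_partial_Cons: "iter_partial (b # bs) f = partial_deriv b (iter_partial bs f)"
  by (simp add: iter_partial_def)

lemma iter_partial_snoc: "iter_partial (bs @ [b]) f = iter_partial bs (partial_deriv b f)"
  by (simp add: iter_partial_def)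

lemma smooth_partial_deriv:
  assumes "smooth f" "b \<in> Basis"
  shows "smooth (partial_deriv b f)"
  unfolding smooth_def
proof (intro allI impI)
  fix bs :: "'a list" assume "set bs \<subseteq> Basis"
  then have "set (bs @ [b]) \<subseteq> Basis" using assms by simp
  then show "iter_partial bs (partial_deriv b f) differentiable_on UNIV"
    using assms unfolding smooth_def iter_partial_snoc[symmetric] by blast
qed

lemma smooth_iter_partial:
  assumes "smooth f" "set bs \<subseteq> Basis"
  shows "smooth (iter_partial bs f)"
  unfolding smooth_def
proof (intro allI impI)
  fix cs :: "'a list" assume "set cs \<subseteq> Basis"
  then have "set (cs @ bs) \<subseteq> Basis" using assms by simp
  then have "iter_partial (cs @ bs) f differentiable_on UNIV"
    using assms unfolding smooth_def by blast
  then show "iter_partial cs (iter_partial bs f) differentiable_on UNIV"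
    by (simp add: iter_partial_def)
qed

lemma smooth_differentiable:
  assumes "smooth f" shows "f differentiable (at p)"
proof -
  have "f differentiable_on UNIV"
    using assms unfolding smooth_def by (metis empty_subsetI iter_partial_Nil list.set(1))
  then show ?thesis by (simp add: differentiable_on_def)
qed

lemma smooth_continuous_on: "smooth f \<Longrightarrow> continuous_on A f"
  by (meson continuous_at_imp_continuous_on differentiable_imp_continuous_within smooth_differentiable)

lemma smooth_borel_measurable: "smooth f \<Longrightarrow> f \<in> borel_measurable borel"
  by (intro borel_measurable_continuous_onI smooth_continuous_on)

text \<open>Partial derivatives are defined one coordinate at a time; total differentiability is what turns
  the derivative along an arbitrary direction into their linear combination.\<close>

lemma differentiable_line_derivative:
  fixes f :: "'b::euclidean_space \<Rightarrow> complex"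
  assumes "f differentiable (at (p + t *\<^sub>R h))"
  shows "((\<lambda>t. f (p + t *\<^sub>R h)) has_vector_derivative
           (\<Sum>b\<in>Basis. (h \<bullet> b) *\<^sub>R partial_deriv b f (p + t *\<^sub>R h))) (at t)"
proof -
  let ?q = "p + t *\<^sub>R h"
  obtain f' where f': "(f has_derivative f') (at ?q)"
    using assms unfolding differentiable_def by blast
  have line: "((\<lambda>s. f (q + s *\<^sub>R v)) has_vector_derivative f' v) (at s0)"
    if "q + s0 *\<^sub>R v = ?q" for q v s0
  proof -
    have "((\<lambda>s. q + s *\<^sub>R v) has_derivative (\<lambda>s. s *\<^sub>R v)) (at s0)"
      by (auto intro!: derivative_eq_intros)
    moreover have "(f has_derivative f') (at (q + s0 *\<^sub>R v))" using f' that by simp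
    ultimately have "((\<lambda>s. f (q + s *\<^sub>R v)) has_derivative (\<lambda>s. f' (s *\<^sub>R v))) (at s0)"
      using diff_chain_at[of "\<lambda>s. q + s *\<^sub>R v" "\<lambda>s. s *\<^sub>R v" s0 f f'] by (simp add: o_def)
    moreover have "f' (s *\<^sub>R v) = s *\<^sub>R f' v" for s
      using f' has_derivative_bounded_linear linear_cmul bounded_linear.linear by blast
    ultimately show ?thesis by (simp add: has_vector_derivative_def)
  qed
  have pd: "partial_deriv b f ?q = f' b" for b
    unfolding partial_deriv_def by (rule vector_derivative_at) (rule line, simp)
  have "f' h = f' (\<Sum>b\<in>Basis. (h \<bullet> b) *\<^sub>R b)" by (simp add: euclidean_representation)
  also have "\<dots> = (\<Sum>b\<in>Basis. (h \<bullet> b) *\<^sub>R f' b)"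
    using f' by (simp add: has_derivative_bounded_linear bounded_linear.linear linear_sum linear_cmul)
  finally show ?thesis using line[of p t h] pd by simp
qed

lemma shift_diff_pow_sum:
  "(shift_diff h ^^ M) (\<lambda>\<xi>. \<Sum>i\<in>I. c i *\<^sub>R g i \<xi>) = (\<lambda>\<xi>. \<Sum>i\<in>I. c i *\<^sub>R (shift_diff h ^^ M) (g i) \<xi>)"
  by (induction M) (auto simp: shift_diff_def sum_subtractf scaleR_diff_right)

lemma shift_diff_pow_diff:
  "(shift_diff h ^^ M) (\<lambda>\<xi>. f \<xi> - g \<xi>) \<xi> = (shift_diff h ^^ M) f \<xi> - (shift_diff h ^^ M) g \<xi>"
  by (induction M arbitrary: \<xi>) (auto simp: shift_diff_def)

lemma shift_diff_pow_has_vector_derivative: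
  fixes g g' :: "'v::real_normed_vector \<Rightarrow> complex"
  assumes "\<And>p t. ((\<lambda>t. g (p + t *\<^sub>R h)) has_vector_derivative g' (p + t *\<^sub>R h)) (at t)"
  shows "((\<lambda>t. (shift_diff h ^^ M) g (p + t *\<^sub>R h)) has_vector_derivative
           (shift_diff h ^^ M) g' (p + t *\<^sub>R h)) (at t)"
proof (induction M arbitrary: p t)
  case 0
  then show ?case using assms by simp
next
  case (Suc M)
  have "((\<lambda>t. (shift_diff h ^^ M) g ((p + h) + t *\<^sub>R h) - (shift_diff h ^^ M) g (p + t *\<^sub>R h))
     has_vector_derivative
       ((shift_diff h ^^ M) g' ((p + h) + t *\<^sub>R h) - (shift_diff h ^^ M) g' (p + t *\<^sub>R h))) (at t)"
    by (intro has_vector_derivative_diff Suc.IH)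
  moreover have "shift_diff h F (p + t *\<^sub>R h) = F ((p + h) + t *\<^sub>R h) - F (p + t *\<^sub>R h)" for F p t
    by (simp add: shift_diff_def algebra_simps)
  ultimately show ?case by simp
qed

text \<open>The mean value theorem, once per difference.  The new partial derivative is taken first and the
  induction hypothesis is applied to it, so each step extends the list of directions at its
  innermost end, and the order of the partial derivatives never has to be changed.\<close>

lemma norm_shift_diff_pow_le_derivs:
  fixes f :: "'v::euclidean_space \<Rightarrow> complex"
  assumes "smooth f"
    and "\<And>bs t. set bs \<subseteq> Basis \<Longrightarrow> length bs = M \<Longrightarrow> 0 \<le> t \<Longrightarrow> t \<le> real M
        \<Longrightarrow> norm (iter_partial bs f (\<xi> + t *\<^sub>R h)) \<le> B"
  shows "norm ((shift_diff h ^^ M) f \<xi>) \<le> B * (real DIM('v) * norm h) ^ M"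
  using assms
proof (induction M arbitrary: f \<xi>)
  case 0
  from "0.prems"(2)[of "[]" 0] show ?case by simp
next
  case (Suc M)
  let ?D = "\<lambda>b. partial_deriv b f"
  let ?g = "\<lambda>t. (shift_diff h ^^ M) f (\<xi> + t *\<^sub>R h)"
  let ?g' = "\<lambda>t. (\<Sum>b\<in>Basis. (h \<bullet> b) *\<^sub>R (shift_diff h ^^ M) (?D b) (\<xi> + t *\<^sub>R h))"
  have B0: "0 \<le> B"
  proof -
    obtain b :: 'v where "b \<in> Basis" using nonempty_Basis by blast
    then have "norm (iter_partial (replicate (Suc M) b) f (\<xi> + 0 *\<^sub>R h)) \<le> B"
      by (intro Suc.prems(2)) auto
    then show ?thesis using norm_ge_zero order_trans by blast
  qed
  have der: "(?g has_vector_derivative ?g' t) (at t)" for t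
  proof -
    have "((\<lambda>t. (shift_diff h ^^ M) f (\<xi> + t *\<^sub>R h)) has_vector_derivative
       (shift_diff h ^^ M) (\<lambda>q. \<Sum>b\<in>Basis. (h \<bullet> b) *\<^sub>R ?D b q) (\<xi> + t *\<^sub>R h)) (at t)"
      by (rule shift_diff_pow_has_vector_derivative)
         (intro differentiable_line_derivative smooth_differentiable Suc.prems(1))
    then show ?thesis by (simp add: shift_diff_pow_sum)
  qed
  have IH: "norm ((shift_diff h ^^ M) (?D b) (\<xi> + t *\<^sub>R h)) \<le> B * (real DIM('v) * norm h) ^ M"
    if "b \<in> Basis" "0 \<le> t" "t \<le> 1" for b t
  proof (rule Suc.IH)
    show "smooth (?D b)" using Suc.prems(1) that(1) by (rule smooth_partial_deriv)
    fix bs :: "'v list" and s :: real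
    assume "set bs \<subseteq> Basis" "length bs = M" "0 \<le> s" "s \<le> real M"
    then have "norm (iter_partial (bs @ [b]) f (\<xi> + (t + s) *\<^sub>R h)) \<le> B"
      using that by (intro Suc.prems(2)) auto
    then show "norm (iter_partial bs (?D b) (\<xi> + t *\<^sub>R h + s *\<^sub>R h)) \<le> B"
      by (simp add: iter_partial_snoc algebra_simps)
  qed
  have bnd: "norm (?g' t) \<le> B * (real DIM('v) * norm h) ^ Suc M" if "0 \<le> t" "t \<le> 1" for t
  proof -
    have "norm (?g' t) \<le> (\<Sum>b\<in>(Basis::'v set). norm h * (B * (real DIM('v) * norm h) ^ M))"
      by (rule sum_norm_le) (auto intro!: mult_mono IH that Basis_le_norm)
    then show ?thesis by (simp add: algebra_simps)
  qed
  have "\<exists>t\<in>{0<..<1}. norm (?g 1 - ?g 0) \<le> norm ((\<lambda>s. s *\<^sub>R ?g' t) (1 - 0))"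
  proof (rule mvt_general)
    show "continuous_on {0..1} ?g"
      by (intro continuous_at_imp_continuous_on ballI has_vector_derivative_continuous[OF der])
    show "\<And>t. \<lbrakk>0 < t; t < 1\<rbrakk> \<Longrightarrow> (?g has_derivative (\<lambda>s. s *\<^sub>R ?g' t)) (at t)"
      using der unfolding has_vector_derivative_def by blast
  qed simp
  then obtain t where "t \<in> {0<..<1}" "norm (?g 1 - ?g 0) \<le> norm (?g' t)" by auto
  then have "norm (?g 1 - ?g 0) \<le> B * (real DIM('v) * norm h) ^ Suc M"
    using bnd[of t] by auto
  then show ?case by (simp only: shift_diff_pow_Suc scaleR_one scaleR_zero_left add_0_right)
qed

text \<open>The crude bound by the size of the function, for points whose distance from the origin is at most
  comparable with \<open>norm h\<close>, where the derivatives give nothing better.\<close>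

lemma norm_shift_diff_pow_le_sup:
  fixes f :: "'v::real_vector \<Rightarrow> complex"
  assumes "\<And>k. k \<le> M \<Longrightarrow> norm (f (\<xi> + real k *\<^sub>R h)) \<le> B"
  shows "norm ((shift_diff h ^^ M) f \<xi>) \<le> 2 ^ M * B"
  using assms
proof (induction M arbitrary: f \<xi>)
  case 0
  from "0.prems"[of 0] show ?case by simp
next
  case (Suc M)
  have "norm ((shift_diff h ^^ M) f (\<xi> + h)) \<le> 2 ^ M * B"
  proof (rule Suc.IH)
    fix k assume "k \<le> M"
    with Suc.prems[of "Suc k"] show "norm (f (\<xi> + h + real k *\<^sub>R h)) \<le> B"
      by (simp add: algebra_simps)
  qed
  moreover have "norm ((shift_diff h ^^ M) f \<xi>) \<le> 2 ^ M * B"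
    using Suc.prems by (intro Suc.IH) auto
  ultimately show ?case
    using norm_triangle_ineq4[of "(shift_diff h ^^ M) f (\<xi> + h)" "(shift_diff h ^^ M) f \<xi>"]
    unfolding shift_diff_pow_Suc by simp
qed

section \<open>Integrals of finite differences\<close>

lemma integrable_shift:
  fixes g :: "'v::euclidean_space \<Rightarrow> complex"
  assumes "integrable lborel g"
  shows "integrable lborel (\<lambda>\<xi>. g (\<xi> + h))"
proof -
  have "integrable (distr lborel borel ((+) h)) g" using assms by (simp add: lborel_distr_plus)
  then have "integrable lborel (\<lambda>\<xi>. g (h + \<xi>))"
    by (subst (asm) integrable_distr_eq) (use assms in auto)
  then show ?thesis by (simp add: add.commute)
qed

lemma integral_shift:
  fixes g :: "'v::euclidean_space \<Rightarrow> complex"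
  assumes "g \<in> borel_measurable borel"
  shows "(\<integral>\<xi>. g (\<xi> + h) \<partial>lborel) = (\<integral>\<xi>. g \<xi> \<partial>lborel)"
proof -
  have "(\<integral>\<xi>. g \<xi> \<partial>lborel) = (\<integral>\<xi>. g \<xi> \<partial>(distr lborel borel ((+) h)))"
    by (simp add: lborel_distr_plus)
  also have "\<dots> = (\<integral>\<xi>. g (h + \<xi>) \<partial>lborel)"
    by (rule integral_distr) (use assms in auto)
  finally show ?thesis by (simp add: add.commute)
qed

lemma shift_diff_pow_borel_measurable:
  fixes g :: "'v::euclidean_space \<Rightarrow> complex"
  assumes g [measurable]: "g \<in> borel_measurable borel"
  shows "(\<lambda>(h, \<xi>). (shift_diff h ^^ M) g \<xi>) \<in> borel_measurable (borel \<Otimes>\<^sub>M borel)"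
proof (induction M)
  case 0
  show ?case by simp
next
  case (Suc M)
  note Suc.IH [measurable]
  have "(\<lambda>p. (\<lambda>(h, \<xi>). (shift_diff h ^^ M) g \<xi>) (fst p, snd p + fst p)
          - (\<lambda>(h, \<xi>). (shift_diff h ^^ M) g \<xi>) (fst p, snd p)) \<in> borel_measurable (borel \<Otimes>\<^sub>M borel)"
    by measurable
  then show ?case unfolding shift_diff_pow_Suc by (simp add: case_prod_beta)
qed

lemma shift_diff_pow_borel_measurable1:
  fixes g :: "'v::euclidean_space \<Rightarrow> complex"
  assumes [measurable]: "g \<in> borel_measurable borel"
  shows "(shift_diff h ^^ M) g \<in> borel_measurable borel"
proof -
  note shift_diff_pow_borel_measurable[OF assms, of M, measurable]
  have "(\<lambda>\<xi>. (\<lambda>(h, \<xi>). (shift_diff h ^^ M) g \<xi>) (h, \<xi>)) \<in> borel_measurable borel"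
    by measurable
  then show ?thesis by simp
qed

lemma integrable_shift_diff_pow:
  fixes g :: "'v::euclidean_space \<Rightarrow> complex"
  assumes "integrable lborel g"
  shows "integrable lborel ((shift_diff h ^^ k) g)"
proof (induction k)
  case 0
  then show ?case using assms by simp
next
  case (Suc k)
  show ?case
    using Bochner_Integration.integrable_diff[OF integrable_shift[OF Suc, of h] Suc]
    unfolding shift_diff_pow_Suc[symmetric] .
qed

lemma integrable_mult_cis:
  fixes g :: "'v::euclidean_space \<Rightarrow> complex"
  assumes g: "integrable lborel g" and [measurable]: "\<theta> \<in> borel_measurable borel"
  shows "integrable lborel (\<lambda>\<xi>. g \<xi> * cis (\<theta> \<xi>))"
proof (rule Bochner_Integration.integrable_bound[OF g])
  have [measurable]: "g \<in> borel_measurable borel" using g by auto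
  have "(\<lambda>\<xi>. g \<xi> * cis (\<theta> \<xi>)) \<in> borel_measurable borel"
    unfolding cis_conv_exp by measurable
  then show "(\<lambda>\<xi>. g \<xi> * cis (\<theta> \<xi>)) \<in> borel_measurable lborel" by simp
qed (simp add: norm_mult)

text \<open>The substitute for integration by parts: translating \<open>g\<close> by \<open>h\<close> multiplies its Fourier integral
  at \<open>z\<close> by a phase.\<close>

lemma integral_shift_diff_pow_cis:
  fixes g :: "'v::euclidean_space \<Rightarrow> complex"
  assumes "integrable lborel g"
  shows "(\<integral>\<xi>. (shift_diff h ^^ k) g \<xi> * cis (z \<bullet> \<xi>) \<partial>lborel)
           = (cis (- (z \<bullet> h)) - 1) ^ k * (\<integral>\<xi>. g \<xi> * cis (z \<bullet> \<xi>) \<partial>lborel)"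
proof (induction k)
  case 0
  show ?case by simp
next
  case (Suc k)
  let ?G = "(shift_diff h ^^ k) g"
  let ?I = "\<integral>\<xi>. ?G \<xi> * cis (z \<bullet> \<xi>) \<partial>lborel"
  have G: "integrable lborel ?G" by (rule integrable_shift_diff_pow[OF assms])
  have Gc: "integrable lborel (\<lambda>\<xi>. ?G \<xi> * cis (z \<bullet> \<xi>))"
    by (rule integrable_mult_cis[OF G]) simp
  have Gs: "integrable lborel (\<lambda>\<xi>. ?G (\<xi> + h) * cis (z \<bullet> \<xi>))"
    by (rule integrable_mult_cis[OF integrable_shift[OF G]]) simp
  have "(\<integral>\<xi>. ?G (\<xi> + h) * cis (z \<bullet> \<xi>) \<partial>lborel)
      = (\<integral>\<xi>. cis (- (z \<bullet> h)) * (?G (\<xi> + h) * cis (z \<bullet> (\<xi> + h))) \<partial>lborel)"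
    by (rule Bochner_Integration.integral_cong) (simp_all add: inner_add_right cis_mult mult.left_commute)
  also have "\<dots> = cis (- (z \<bullet> h)) * (\<integral>\<xi>. ?G (\<xi> + h) * cis (z \<bullet> (\<xi> + h)) \<partial>lborel)"
    by simp
  also have "(\<integral>\<xi>. ?G (\<xi> + h) * cis (z \<bullet> (\<xi> + h)) \<partial>lborel) = ?I"
    using Gc by (intro integral_shift) auto
  finally have s: "(\<integral>\<xi>. ?G (\<xi> + h) * cis (z \<bullet> \<xi>) \<partial>lborel) = cis (- (z \<bullet> h)) * ?I" .
  have "(\<integral>\<xi>. (shift_diff h ^^ Suc k) g \<xi> * cis (z \<bullet> \<xi>) \<partial>lborel)
      = (\<integral>\<xi>. ?G (\<xi> + h) * cis (z \<bullet> \<xi>) - ?G \<xi> * cis (z \<bullet> \<xi>) \<partial>lborel)"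
    unfolding shift_diff_pow_Suc left_diff_distrib ..
  also have "\<dots> = cis (- (z \<bullet> h)) * ?I - ?I"
    by (subst Bochner_Integration.integral_diff[OF Gs Gc]) (simp add: s)
  also have "\<dots> = (cis (- (z \<bullet> h)) - 1) * ?I" by (simp add: algebra_simps)
  finally show ?case by (simp add: Suc.IH)
qed

lemma shift_diff_commute: "shift_diff h (shift_diff k g) = shift_diff k (shift_diff h g)"
  by (auto simp: shift_diff_def fun_eq_iff algebra_simps)

lemma shift_diff_pow_commute:
  "(shift_diff h ^^ M) ((shift_diff k ^^ N) g) = (shift_diff k ^^ N) ((shift_diff h ^^ M) g)"
proof -
  have "(shift_diff h ^^ M) (shift_diff k g) = shift_diff k ((shift_diff h ^^ M) g)" for g
    by (induction M arbitrary: g) (simp_all add: shift_diff_commute)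
  then show ?thesis by (induction N arbitrary: g) simp_all
qed

section \<open>Product integrals and weights\<close>

text \<open>Tensor products over coordinates factorise; this supplies integrable weights and the Fourier
  transform of the Gaussian in every dimension.\<close>

lemma
  fixes f :: "'v::euclidean_space \<Rightarrow> real \<Rightarrow> 'c::{real_normed_field,banach,second_countable_topology}"
  assumes f: "\<And>b. b \<in> Basis \<Longrightarrow> integrable lborel (f b)"
  shows integrable_prod_coordinates: "integrable lborel (\<lambda>x. \<Prod>b\<in>Basis. f b (x \<bullet> b))"
    and integral_prod_coordinates:
      "(\<integral>x. (\<Prod>b\<in>Basis. f b (x \<bullet> b)) \<partial>lborel) = (\<Prod>b\<in>Basis. (\<integral>t. f b t \<partial>lborel))"
proof -
  interpret P: product_sigma_finite "\<lambda>_::'v. lborel :: real measure" ..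
  have [measurable]: "f b \<in> borel_measurable borel" if "b \<in> Basis" for b using f[OF that] by auto
  have m: "(\<lambda>g. \<Sum>b\<in>Basis. g b *\<^sub>R b) \<in> measurable (\<Pi>\<^sub>M b\<in>(Basis::'v set). lborel) borel"
    by measurable
  have F: "(\<lambda>x. \<Prod>b\<in>Basis. f b (x \<bullet> b)) \<in> borel_measurable borel" by measurable
  have c: "(\<Prod>b\<in>Basis. f b ((\<Sum>b\<in>Basis. g b *\<^sub>R b) \<bullet> b)) = (\<Prod>b\<in>Basis. f b (g b))" for g
    by (intro prod.cong) auto
  show "integrable lborel (\<lambda>x. \<Prod>b\<in>Basis. f b (x \<bullet> b))"
    by (subst lborel_eq, subst integrable_distr_eq[OF m F], subst c)
       (intro P.product_integrable_prod f, auto)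
  show "(\<integral>x. (\<Prod>b\<in>Basis. f b (x \<bullet> b)) \<partial>lborel) = (\<Prod>b\<in>Basis. (\<integral>t. f b t \<partial>lborel))"
    by (subst lborel_eq, subst integral_distr[OF m F], subst c)
       (intro P.product_integral_prod f, auto)
qed

text \<open>Lebesgue measure on vectors of vectors is a product over the outer index, so that the Fourier
  transform of \<open>f\<^sub>1 \<otimes> \<dots> \<otimes> f\<^sub>m\<close> is the product of the transforms.\<close>

lemma lborel_vec: "distr (\<Pi>\<^sub>M j\<in>UNIV. lborel) borel (\<lambda>g. \<chi> j. g j)
    = (lborel :: (('e::euclidean_space)^'m) measure)"
proof (rule lborel_eqI[symmetric])
  interpret P: finite_product_sigma_finite "\<lambda>_::'m. lborel :: 'e measure" UNIV
    by standard simp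
  have m [measurable]: "(\<lambda>g. \<chi> j. g j) \<in> measurable (\<Pi>\<^sub>M j\<in>(UNIV::'m set). (lborel::'e measure)) borel"
    by (subst borel_measurable_euclidean_space) (auto simp: Basis_vec_def inner_axis)
  fix l u :: "'e^'m"
  assume le: "\<And>b. b \<in> Basis \<Longrightarrow> l \<bullet> b \<le> u \<bullet> b"
  have leq: "(l $ j) \<bullet> b \<le> (u $ j) \<bullet> b" if "b \<in> Basis" for j b
    using le[of "axis j b"] that by (auto simp: inner_axis Basis_vec_def)
  have box: "(\<lambda>g. \<chi> j. g j) -` box l u \<inter> space (\<Pi>\<^sub>M j\<in>(UNIV::'m set). (lborel::'e measure))
     = (\<Pi>\<^sub>E j\<in>UNIV. box (l $ j) (u $ j))"
    by (auto simp: box_def Basis_vec_def inner_axis space_PiM PiE_def Pi_def)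
  have "emeasure (distr (\<Pi>\<^sub>M j\<in>(UNIV::'m set). (lborel::'e measure)) borel (\<lambda>g. \<chi> j. g j)) (box l u)
     = (\<Prod>j\<in>UNIV. emeasure lborel (box (l $ j) (u $ j)))"
    by (subst emeasure_distr[OF m]) (auto simp: box P.measure_times)
  also have "\<dots> = (\<Prod>j\<in>UNIV. ennreal (\<Prod>b\<in>Basis. (u $ j - l $ j) \<bullet> b))"
    by (intro prod.cong refl) (simp add: leq)
  also have "\<dots> = ennreal (\<Prod>j\<in>UNIV. \<Prod>b\<in>Basis. (u $ j - l $ j) \<bullet> b)"
    by (intro prod_ennreal prod_nonneg) (simp add: leq inner_diff_left)
  also have "(\<Prod>j\<in>UNIV. \<Prod>b\<in>Basis. (u $ j - l $ j) \<bullet> b) = (\<Prod>(j,b)\<in>UNIV \<times> Basis. (u - l) \<bullet> axis j b)"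
    by (simp add: prod.cartesian_product inner_axis)
  also have "\<dots> = (\<Prod>b\<in>Basis. (u - l) \<bullet> b)"
  proof -
    have "bij_betw (\<lambda>(j::'m, b::'e). axis j b) (UNIV \<times> Basis) Basis"
      by (auto simp: bij_betw_def inj_on_def axis_eq_axis Basis_vec_def image_def nonzero_Basis)
    from prod.reindex_bij_betw[OF this, of "\<lambda>b. (u - l) \<bullet> b"] show ?thesis
      by (simp add: case_prod_beta)
  qed
  finally show "emeasure (distr (\<Pi>\<^sub>M j\<in>(UNIV::'m set). (lborel::'e measure)) borel (\<lambda>g. \<chi> j. g j)) (box l u)
     = (\<Prod>b\<in>Basis. (u - l) \<bullet> b)" .
qed simp

lemma
  fixes f :: "'m::finite \<Rightarrow> 'e::euclidean_space \<Rightarrow> 'c::{real_normed_field,banach,second_countable_topology}"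
  assumes f: "\<And>j. integrable lborel (f j)"
  shows integrable_prod_components: "integrable lborel (\<lambda>y::'e^'m. \<Prod>j\<in>UNIV. f j (y $ j))"
    and integral_prod_components:
      "(\<integral>y. (\<Prod>j\<in>UNIV. f j (y $ j)) \<partial>(lborel :: ('e^'m) measure)) = (\<Prod>j\<in>UNIV. (\<integral>t. f j t \<partial>lborel))"
proof -
  interpret P: product_sigma_finite "\<lambda>_::'m. lborel :: 'e measure" ..
  have [measurable]: "f j \<in> borel_measurable borel" for j using f[of j] by auto
  have m: "(\<lambda>g. \<chi> j. g j) \<in> measurable (\<Pi>\<^sub>M j\<in>(UNIV::'m set). (lborel::'e measure)) borel"
    by (subst borel_measurable_euclidean_space) (auto simp: Basis_vec_def inner_axis)
  have [measurable]: "(\<lambda>y::'e^'m. y $ j) \<in> borel_measurable borel" for j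
    by (intro borel_measurable_continuous_onI continuous_intros)
  have F: "(\<lambda>y::'e^'m. \<Prod>j\<in>UNIV. f j (y $ j)) \<in> borel_measurable borel" by measurable
  show "integrable lborel (\<lambda>y::'e^'m. \<Prod>j\<in>UNIV. f j (y $ j))"
    by (subst lborel_vec[symmetric], subst integrable_distr_eq[OF m F], unfold vec_lambda_beta)
       (intro P.product_integrable_prod f, auto)
  show "(\<integral>y. (\<Prod>j\<in>UNIV. f j (y $ j)) \<partial>(lborel :: ('e^'m) measure)) = (\<Prod>j\<in>UNIV. (\<integral>t. f j t \<partial>lborel))"
    by (subst lborel_vec[symmetric], subst integral_distr[OF m F], unfold vec_lambda_beta)
       (intro P.product_integral_prod f, auto)
qed

lemma inverse_square_weight_integral:
  fixes r :: real
  assumes "r > 0"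
  shows "has_bochner_integral lborel (\<lambda>t. 1 / (r + \<bar>t\<bar>)\<^sup>2) (2 / r)"
proof -
  have "has_bochner_integral lborel (\<lambda>t. indicator {0..} t *\<^sub>R (1 / (r + \<bar>t\<bar>)\<^sup>2)) (1 / r)"
  proof (rule has_bochner_integral_nn_integral)
    have "(\<integral>\<^sup>+t. ennreal (1 / (r + t)\<^sup>2) * indicator {0..} t \<partial>lborel) = 0 - (- 1 / (r + 0))"
    proof (rule nn_integral_FTC_atLeast)
      show "((\<lambda>t. - 1 / (r + t)) \<longlongrightarrow> 0) at_top" by real_asymp
      show "\<And>t. 0 \<le> t \<Longrightarrow> ((\<lambda>t. - 1 / (r + t)) has_real_derivative 1 / (r + t)\<^sup>2) (at t)"
        using assms by (auto intro!: derivative_eq_intros simp: power2_eq_square)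
    qed (use assms in auto)
    moreover have "ennreal (indicator {0..} t *\<^sub>R (1 / (r + \<bar>t\<bar>)\<^sup>2)) = ennreal (1 / (r + t)\<^sup>2) * indicator {0..} t" for t
      by (auto split: split_indicator)
    ultimately show "(\<integral>\<^sup>+t. ennreal (indicator {0..} t *\<^sub>R (1 / (r + \<bar>t\<bar>)\<^sup>2)) \<partial>lborel) = ennreal (1 / r)"
      by simp
  qed (use assms in auto)
  from has_bochner_integral_even_function[OF this] show ?thesis by simp
qed

text \<open>The weight is dominated by a product of one-dimensional weights \<open>(r + \<bar>t\<bar>)\<^sup>-\<^sup>2\<close>.  The power of
  \<open>r\<close> in the bound is the one that scaling predicts, and it produces the exact order of the
  singularity of the kernel.\<close>

lemma
  fixes r :: real
  assumes r: "r > 0" and q: "2 * DIM('v::euclidean_space) \<le> q"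
  shows integrable_weight: "integrable lborel (\<lambda>\<xi>::'v. 1 / (r + norm \<xi>) ^ q)"
    and integral_weight_le: "(\<integral>\<xi>. 1 / (r + norm (\<xi>::'v)) ^ q \<partial>lborel) \<le> 2 ^ DIM('v) * r ^ DIM('v) / r ^ q"
proof -
  let ?D = "DIM('v)"
  let ?P = "\<lambda>\<xi>::'v. 1 / r ^ (q - 2 * ?D) * (\<Prod>b\<in>Basis. 1 / (r + \<bar>\<xi> \<bullet> b\<bar>)\<^sup>2)"
  have i1: "integrable lborel (\<lambda>t::real. 1 / (r + \<bar>t\<bar>)\<^sup>2)" "(\<integral>t. 1 / (r + \<bar>t\<bar>)\<^sup>2 \<partial>lborel) = 2 / r"
    using inverse_square_weight_integral[OF r] by (auto simp: has_bochner_integral_iff)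
  have P: "integrable lborel ?P"
    using integrable_prod_coordinates[where 'v='v, of "\<lambda>_ t. 1 / (r + \<bar>t\<bar>)\<^sup>2"] i1 by auto
  have "integral\<^sup>L lborel ?P = 1 / r ^ (q - 2 * ?D) * (2 / r) ^ ?D"
    using integral_prod_coordinates[where 'v='v, of "\<lambda>_ t. 1 / (r + \<bar>t\<bar>)\<^sup>2"] i1 by simp
  also have "\<dots> = 2 ^ ?D * r ^ ?D / r ^ q"
  proof -
    have "r ^ q = r ^ (q - 2 * ?D) * (r ^ ?D * r ^ ?D)"
      using q by (simp flip: power_add mult_2)
    then show ?thesis using r by (simp add: field_simps)
  qed
  finally have Pi: "integral\<^sup>L lborel ?P = 2 ^ ?D * r ^ ?D / r ^ q" .
  have le: "1 / (r + norm \<xi>) ^ q \<le> ?P \<xi>" for \<xi> :: 'v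
  proof -
    have "r ^ (q - 2 * ?D) * (\<Prod>b\<in>Basis. (r + \<bar>\<xi> \<bullet> b\<bar>)\<^sup>2)
        \<le> (r + norm \<xi>) ^ (q - 2 * ?D) * (\<Prod>b\<in>(Basis::'v set). (r + norm \<xi>)\<^sup>2)"
      using r by (intro mult_mono power_mono prod_mono) (auto simp: Basis_le_norm prod_nonneg)
    also have "\<dots> = (r + norm \<xi>) ^ q"
      using q by (simp flip: power_mult power_add)
    finally have le: "r ^ (q - 2 * ?D) * (\<Prod>b\<in>Basis. (r + \<bar>\<xi> \<bullet> b\<bar>)\<^sup>2) \<le> (r + norm \<xi>) ^ q" .
    have "0 < r ^ (q - 2 * ?D) * (\<Prod>b\<in>Basis. (r + \<bar>\<xi> \<bullet> b\<bar>)\<^sup>2)"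
      using r by (intro mult_pos_pos prod_pos) (auto intro!: zero_less_power add_pos_nonneg)
    then have "1 / (r + norm \<xi>) ^ q \<le> 1 / (r ^ (q - 2 * ?D) * (\<Prod>b\<in>Basis. (r + \<bar>\<xi> \<bullet> b\<bar>)\<^sup>2))"
      using le by (intro divide_left_mono) (auto intro!: mult_pos_pos zero_less_power add_pos_nonneg r)
    then show ?thesis by (simp add: prod_dividef)
  qed
  have m: "(\<lambda>\<xi>::'v. 1 / (r + norm \<xi>) ^ q) \<in> borel_measurable lborel" by measurable
  have n: "0 \<le> 1 / (r + norm \<xi>) ^ q" for \<xi> :: 'v using r by simp
  show i: "integrable lborel (\<lambda>\<xi>::'v. 1 / (r + norm \<xi>) ^ q)"
  proof (rule Bochner_Integration.integrable_bound[OF P m], rule AE_I2)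
    fix \<xi> :: 'v
    show "norm (1 / (r + norm \<xi>) ^ q) \<le> norm (?P \<xi>)"
      using le[of \<xi>] n[of \<xi>] unfolding real_norm_def by linarith
  qed
  show "(\<integral>\<xi>. 1 / (r + norm (\<xi>::'v)) ^ q \<partial>lborel) \<le> 2 ^ DIM('v) * r ^ DIM('v) / r ^ q"
    unfolding Pi[symmetric] by (rule integral_mono[OF i P]) (rule le)
qed

section \<open>The Gaussian\<close>

text \<open>The Gaussian serves only to average over frequencies; that it reproduces itself under the Fourier
  transform makes these averages explicit.\<close>

definition gauss :: "'v::euclidean_space \<Rightarrow> real" where
  "gauss \<eta> = exp (- (norm \<eta>)\<^sup>2 / 2)"

lemma integral_gauss_1d:
  "integrable lborel (\<lambda>t::real. exp (- t\<^sup>2 / 2))"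
  "(\<integral>t. complex_of_real (exp (- t\<^sup>2 / 2)) * cis (s * t) \<partial>lborel) = sqrt (2 * pi) * exp (- s\<^sup>2 / 2)"
proof -
  have e: "exp (- t\<^sup>2 / 2) = sqrt (2 * pi) * std_normal_density t" for t :: real
    by (simp add: std_normal_density_def)
  show "integrable lborel (\<lambda>t::real. exp (- t\<^sup>2 / 2))"
    unfolding e by (intro integrable_mult_right integrable_normal_density) simp
  have "complex_of_real (exp (- s\<^sup>2 / 2)) = char std_normal_distribution s"
    by (simp add: char_std_normal_distribution)
  also have "\<dots> = (\<integral>t. std_normal_density t *\<^sub>R iexp (s * t) \<partial>lborel)"
    unfolding char_def by (subst integral_density) auto
  finally have c: "(\<integral>t. std_normal_density t *\<^sub>R iexp (s * t) \<partial>lborel) = complex_of_real (exp (- s\<^sup>2 / 2))" ..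
  have "(\<integral>t. complex_of_real (exp (- t\<^sup>2 / 2)) * cis (s * t) \<partial>lborel)
      = (\<integral>t. complex_of_real (sqrt (2 * pi)) * (std_normal_density t *\<^sub>R iexp (s * t)) \<partial>lborel)"
    by (rule Bochner_Integration.integral_cong)
       (simp_all only: e cis_conv_exp scaleR_conv_of_real of_real_mult mult.assoc)
  also have "\<dots> = sqrt (2 * pi) * exp (- s\<^sup>2 / 2)" unfolding integral_mult_right_zero c by simp
  finally show "(\<integral>t. complex_of_real (exp (- t\<^sup>2 / 2)) * cis (s * t) \<partial>lborel) = sqrt (2 * pi) * exp (- s\<^sup>2 / 2)" .
qed

lemma norm_sq_eq_sum: "(norm \<eta>)\<^sup>2 = (\<Sum>b\<in>Basis. (\<eta> \<bullet> b)\<^sup>2)" for \<eta> :: "'v::euclidean_space"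
  by (subst power2_norm_eq_inner, subst euclidean_inner) (simp add: power2_eq_square)

lemma gauss_eq_prod: "gauss \<eta> = (\<Prod>b\<in>Basis. exp (- (\<eta> \<bullet> b)\<^sup>2 / 2))"
  by (simp add: gauss_def norm_sq_eq_sum exp_sum[symmetric] sum_negf sum_divide_distrib[symmetric])

lemma cis_sum: "finite I \<Longrightarrow> cis (\<Sum>i\<in>I. f i) = (\<Prod>i\<in>I. cis (f i))"
  by (induction I rule: finite_induct) (auto simp: cis_mult[symmetric])

lemma integrable_gauss: "integrable lborel (gauss :: 'v::euclidean_space \<Rightarrow> real)"
  using integrable_prod_coordinates[where 'v='v, of "\<lambda>_ t. exp (- t\<^sup>2 / 2)"] integral_gauss_1d(1)
  by (simp add: gauss_eq_prod[abs_def])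

lemma integral_gauss_cis:
  fixes z :: "'v::euclidean_space"
  shows "(\<integral>\<eta>. complex_of_real (gauss \<eta>) * cis (z \<bullet> \<eta>) \<partial>lborel) = sqrt (2 * pi) ^ DIM('v) * gauss z"
proof -
  have i: "integrable lborel (\<lambda>t. complex_of_real (exp (- t\<^sup>2 / 2)) * cis (s * t))" for s
    using integral_gauss_1d(1) by (intro integrable_mult_cis) (auto simp: integrable_of_real)
  have "(\<integral>\<eta>. complex_of_real (gauss \<eta>) * cis (z \<bullet> \<eta>) \<partial>lborel)
     = (\<integral>\<eta>. (\<Prod>b\<in>Basis. complex_of_real (exp (- (\<eta> \<bullet> b)\<^sup>2 / 2)) * cis ((z \<bullet> b) * (\<eta> \<bullet> b))) \<partial>lborel)"
    by (subst euclidean_inner) (simp add: gauss_eq_prod prod.distrib cis_sum)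
  also have "\<dots> = (\<Prod>b\<in>Basis. complex_of_real (sqrt (2 * pi) * exp (- (z \<bullet> b)\<^sup>2 / 2)))"
    by (subst integral_prod_coordinates) (use i integral_gauss_1d(2) in \<open>auto intro!: prod.cong\<close>)
  also have "\<dots> = sqrt (2 * pi) ^ DIM('v) * gauss z"
    by (simp add: prod.distrib gauss_eq_prod)
  finally show ?thesis .
qed

section \<open>Finite differences of symbols\<close>

text \<open>A symbol of order \<open>l\<close> in one variable, with a single constant for its size and for its
  derivatives of the one order \<open>q + l\<close> at which the differences are taken; these derivatives are
  then of order \<open>- q\<close>.\<close>

definition symbol_bound :: "real \<Rightarrow> nat \<Rightarrow> nat \<Rightarrow> ('v::euclidean_space \<Rightarrow> complex) \<Rightarrow> bool" where
  "symbol_bound A l q b \<longleftrightarrow> smooth b \<and> (\<forall>\<xi>. norm (b \<xi>) \<le> A * (1 + norm \<xi>) ^ l) \<and>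
     (\<forall>bs \<xi>. set bs \<subseteq> Basis \<longrightarrow> length bs = q + l \<longrightarrow> norm (iter_partial bs b \<xi>) \<le> A / (1 + norm \<xi>) ^ q)"

lemma symbol_bound_nonneg: "symbol_bound A l q b \<Longrightarrow> 0 \<le> A"
  unfolding symbol_bound_def using norm_ge_zero[of "b 0"] order_trans
  by (metis add.right_neutral mult.right_neutral norm_zero power_one)

text \<open>A difference of order \<open>q + l\<close> gains \<open>(norm h / norm \<xi>) ^ (q + l)\<close> over the symbol as long as the
  segment from \<open>\<xi>\<close> along \<open>h\<close> stays away from the origin.  The remaining points satisfy
  \<open>norm \<xi> < 2 * (q + l) * norm h\<close> with \<open>norm h > 1\<close>, and there the size of the symbol already gives
  the claim.  For \<open>norm h \<le> 1\<close> the derivative bound is good everywhere, which is why the weight has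
  \<open>max 1 (norm h)\<close>.\<close>

lemma shift_diff_symbol_bound:
  assumes "q > 0"
  obtains C where "C \<ge> 0" and
    "\<And>A (b :: 'v::euclidean_space \<Rightarrow> complex) h \<xi>. symbol_bound A l q b \<Longrightarrow>
       norm ((shift_diff h ^^ (q + l)) b \<xi>) \<le> C * A * norm h ^ (q + l) / (max 1 (norm h) + norm \<xi>) ^ q"
proof
  let ?M = "q + l"
  let ?D = "real DIM('v)"
  define C1 where "C1 = ?D ^ ?M * (4 * (1 + real ?M)) ^ q"
  define C2 where "C2 = 2 ^ ?M * (1 + 3 * real ?M) ^ l * (1 + 2 * real ?M) ^ q"
  have C1: "0 \<le> C1" and C2: "0 \<le> C2" by (simp_all add: C1_def C2_def)
  show "C1 + C2 \<ge> 0" using C1 C2 by simp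
  fix A and b :: "'v \<Rightarrow> complex" and h \<xi> :: 'v
  assume b: "symbol_bound A l q b"
  have A: "0 \<le> A" by (rule symbol_bound_nonneg[OF b])
  have sm: "smooth b" and b0: "\<And>\<xi>. norm (b \<xi>) \<le> A * (1 + norm \<xi>) ^ l"
    and bM: "\<And>bs \<xi>. set bs \<subseteq> Basis \<Longrightarrow> length bs = ?M \<Longrightarrow> norm (iter_partial bs b \<xi>) \<le> A / (1 + norm \<xi>) ^ q"
    using b by (auto simp: symbol_bound_def)
  let ?r = "max 1 (norm h)"
  let ?R = "norm h ^ ?M / (?r + norm \<xi>) ^ q"
  have rpos: "0 < ?r + norm \<xi>" by (simp add: add_pos_nonneg)
  have R0: "0 \<le> ?R" using rpos by simp
  have "norm ((shift_diff h ^^ ?M) b \<xi>) \<le> C1 * A * ?R \<or> norm ((shift_diff h ^^ ?M) b \<xi>) \<le> C2 * A * ?R"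
  proof (cases "norm h \<le> 1 \<or> 2 * real ?M * norm h \<le> norm \<xi>")
    case True
    have far: "(?r + norm \<xi>) / (4 * (1 + real ?M)) \<le> 1 + norm (\<xi> + t *\<^sub>R h)" if t: "0 \<le> t" "t \<le> real ?M" for t
    proof -
      have "norm \<xi> \<le> norm (\<xi> + t *\<^sub>R h) + norm (t *\<^sub>R h)"
        by (metis add_diff_cancel_right' norm_triangle_ineq4)
      also have "norm (t *\<^sub>R h) \<le> real ?M * norm h" using t by (simp add: mult_right_mono)
      finally have n: "norm \<xi> \<le> norm (\<xi> + t *\<^sub>R h) + real ?M * norm h" by simp
      have M1: "1 \<le> real ?M" using assms by simp
      have comb: "?r + norm \<xi> \<le> (4 * (1 + real ?M)) * (1 + norm (\<xi> + t *\<^sub>R h))"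
        if "?r + norm \<xi> \<le> 1 + real ?M + 3 * norm (\<xi> + t *\<^sub>R h)"
      proof -
        have "u \<le> 4 * (1 + R) * (1 + N)" if "u \<le> 1 + R + 3 * N" "0 \<le> R" "0 \<le> N" for u R N :: real
        proof -
          have "4 * (1 + R) * (1 + N) = 4 + 4 * R + 4 * N + 4 * (R * N)" by algebra
          then show ?thesis using that mult_nonneg_nonneg[of R N] by linarith
        qed
        from this[OF that] show ?thesis by simp
      qed
      show ?thesis
      proof (cases "norm h \<le> 1")
        case True
        then have m: "real ?M * norm h \<le> real ?M" by (simp add: mult_left_le)
        have r1: "?r = 1" using True by simp
        have "?r + norm \<xi> \<le> 1 + real ?M + 3 * norm (\<xi> + t *\<^sub>R h)"
          unfolding r1 using n m norm_ge_zero[of "\<xi> + t *\<^sub>R h"] by linarith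
        from comb[OF this]
        show ?thesis by (subst pos_divide_le_eq) (auto simp: mult.commute)
      next
        case False
        with True have e: "2 * (real ?M * norm h) \<le> norm \<xi>" unfolding mult.assoc by blast
        have m: "norm h \<le> real ?M * norm h" using mult_right_mono[OF M1 norm_ge_zero[of h]] by simp
        have r1: "?r = norm h" using False by simp
        have "?r + norm \<xi> \<le> 1 + real ?M + 3 * norm (\<xi> + t *\<^sub>R h)"
          unfolding r1 using n m e M1 by linarith
        from comb[OF this]
        show ?thesis by (subst pos_divide_le_eq) (auto simp: mult.commute)
      qed
    qed
    have "norm ((shift_diff h ^^ ?M) b \<xi>)
        \<le> A / ((?r + norm \<xi>) / (4 * (1 + real ?M))) ^ q * (?D * norm h) ^ ?M"
    proof (rule norm_shift_diff_pow_le_derivs[OF sm])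
      fix bs :: "'v list" and t :: real
      assume bs: "set bs \<subseteq> Basis" "length bs = ?M" and t: "0 \<le> t" "t \<le> real ?M"
      have "norm (iter_partial bs b (\<xi> + t *\<^sub>R h)) \<le> A / (1 + norm (\<xi> + t *\<^sub>R h)) ^ q"
        by (rule bM[OF bs])
      also have "\<dots> \<le> A / ((?r + norm \<xi>) / (4 * (1 + real ?M))) ^ q"
        using rpos A by (intro divide_left_mono power_mono far t mult_pos_pos zero_less_power divide_pos_pos)
          (auto intro!: add_pos_nonneg)
      finally show "norm (iter_partial bs b (\<xi> + t *\<^sub>R h)) \<le> A / ((?r + norm \<xi>) / (4 * (1 + real ?M))) ^ q" .
    qed
    also have "\<dots> = C1 * A * ?R"
      by (simp add: C1_def power_divide power_mult_distrib)
    finally show ?thesis ..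
  next
    case False
    then have h: "1 < norm h" "norm \<xi> < 2 * real ?M * norm h" and r: "?r = norm h" by auto
    have "norm ((shift_diff h ^^ ?M) b \<xi>) \<le> 2 ^ ?M * (A * ((1 + 3 * real ?M) * norm h) ^ l)"
    proof (rule norm_shift_diff_pow_le_sup)
      fix k assume k: "k \<le> ?M"
      have "norm (\<xi> + real k *\<^sub>R h) \<le> norm \<xi> + real k * norm h"
        by (metis abs_of_nat norm_scaleR norm_triangle_ineq)
      also have "real k * norm h \<le> real ?M * norm h" using k by (intro mult_right_mono) auto
      finally have "1 + norm (\<xi> + real k *\<^sub>R h) \<le> (1 + 3 * real ?M) * norm h"
        using h by (simp add: distrib_right)
      then have "A * (1 + norm (\<xi> + real k *\<^sub>R h)) ^ l \<le> A * ((1 + 3 * real ?M) * norm h) ^ l"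
        using A by (intro mult_left_mono power_mono) auto
      then show "norm (b (\<xi> + real k *\<^sub>R h)) \<le> A * ((1 + 3 * real ?M) * norm h) ^ l"
        using b0 order_trans by blast
    qed
    also have "\<dots> = 2 ^ ?M * (1 + 3 * real ?M) ^ l * A * norm h ^ l"
      by (simp add: power_mult_distrib)
    also have "\<dots> \<le> 2 ^ ?M * (1 + 3 * real ?M) ^ l * A * ((1 + 2 * real ?M) ^ q * ?R)"
    proof (intro mult_left_mono)
      have "(norm h + norm \<xi>) ^ q \<le> ((1 + 2 * real ?M) * norm h) ^ q"
        using h by (intro power_mono) (auto simp: algebra_simps)
      then have "norm h ^ l * (norm h + norm \<xi>) ^ q \<le> norm h ^ l * ((1 + 2 * real ?M) * norm h) ^ q"
        by (intro mult_left_mono) auto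
      also have "\<dots> = (1 + 2 * real ?M) ^ q * norm h ^ ?M"
        by (simp add: power_mult_distrib power_add)
      finally show "norm h ^ l \<le> (1 + 2 * real ?M) ^ q * ?R"
        using rpos r by (simp add: pos_le_divide_eq)
    qed (use A in auto)
    also have "\<dots> = C2 * A * ?R" by (simp add: C2_def)
    finally show ?thesis ..
  qed
  moreover have "C1 * A * ?R \<le> (C1 + C2) * A * ?R" "C2 * A * ?R \<le> (C1 + C2) * A * ?R"
    by (rule mult_right_mono[OF mult_right_mono R0]; use A C1 C2 in simp)+
  ultimately show "norm ((shift_diff h ^^ ?M) b \<xi>) \<le> (C1 + C2) * A * norm h ^ ?M / (?r + norm \<xi>) ^ q"
    by auto
qed

section \<open>Oscillatory integrals\<close>

text \<open>The shortest shift along which \<open>\<xi> \<mapsto> cis (z \<bullet> \<xi>)\<close> changes its sign.\<close>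

definition half_period :: "'v::euclidean_space \<Rightarrow> 'v" where
  "half_period z = (pi / (norm z)\<^sup>2) *\<^sub>R z"

lemma inner_half_period: "z \<noteq> 0 \<Longrightarrow> z \<bullet> half_period z = pi"
  by (simp add: half_period_def power2_norm_eq_inner)

lemma norm_half_period: "norm (half_period z) = pi / norm z"
  by (simp add: half_period_def power2_eq_square)

text \<open>The oscillatory integral of \<open>b \<xi> * cis (z \<bullet> \<xi>)\<close>, which need not converge for a symbol \<open>b\<close> of
  order \<open>0\<close>.  If it converged, a difference by the half period would multiply it by \<open>- 2\<close>; for
  large \<open>M\<close> the integral of the differences converges absolutely and defines it.\<close>

definition osc_kernel :: "nat \<Rightarrow> ('v::euclidean_space \<Rightarrow> complex) \<Rightarrow> 'v \<Rightarrow> complex" where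
  "osc_kernel M b z =
     (\<integral>\<xi>. (shift_diff (half_period z) ^^ M) b \<xi> * cis (z \<bullet> \<xi>) \<partial>lborel) / (-2) ^ M"

lemma osc_kernel_borel_measurable:
  fixes b :: "'v::euclidean_space \<Rightarrow> complex"
  assumes b: "b \<in> borel_measurable borel"
  shows "osc_kernel M b \<in> borel_measurable borel"
proof -
  note shift_diff_pow_borel_measurable[OF b, of M, measurable]
  have [measurable]: "half_period \<in> borel_measurable (borel :: 'v measure)"
    unfolding half_period_def[abs_def] by measurable
  have "(\<lambda>p. (\<lambda>(h, \<xi>). (shift_diff h ^^ M) b \<xi>) (half_period (fst p), snd p) * cis (fst p \<bullet> snd p))
      \<in> borel_measurable (borel \<Otimes>\<^sub>M (lborel :: 'v measure))"
    unfolding cis_conv_exp by measurable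
  then have "(\<lambda>(z, \<xi>). (shift_diff (half_period z) ^^ M) b \<xi> * cis (z \<bullet> \<xi>))
      \<in> borel_measurable (borel \<Otimes>\<^sub>M (lborel :: 'v measure))"
    by (simp add: case_prod_beta)
  then have "(\<lambda>z. \<integral>\<xi>. (shift_diff (half_period z) ^^ M) b \<xi> * cis (z \<bullet> \<xi>) \<partial>lborel) \<in> borel_measurable borel"
    by (rule lborel.borel_measurable_lebesgue_integral)
  then show ?thesis unfolding osc_kernel_def[abs_def] by measurable
qed

lemma cis_half_period:
  assumes "z \<noteq> 0"
  shows "cis (- (z \<bullet> half_period z)) - 1 = - 2"
  using assms by (simp add: inner_half_period complex_eq_iff)

text \<open>Differences by \<open>h\<close> and by the half period commute, so applying both to \<open>b\<close> compares the two
  integrals.  The freedom in \<open>h\<close> allows one shift to serve two nearby points \<open>z\<close>.\<close>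

lemma osc_kernel_any_shift:
  fixes b :: "'v::euclidean_space \<Rightarrow> complex"
  assumes int: "\<And>h. integrable lborel ((shift_diff h ^^ M) b)" and z: "z \<noteq> 0"
  shows "(\<integral>\<xi>. (shift_diff h ^^ M) b \<xi> * cis (z \<bullet> \<xi>) \<partial>lborel)
           = (cis (- (z \<bullet> h)) - 1) ^ M * osc_kernel M b z"
proof -
  let ?k = "half_period z"
  have "(- 2) ^ M * (\<integral>\<xi>. (shift_diff h ^^ M) b \<xi> * cis (z \<bullet> \<xi>) \<partial>lborel)
      = (\<integral>\<xi>. (shift_diff ?k ^^ M) ((shift_diff h ^^ M) b) \<xi> * cis (z \<bullet> \<xi>) \<partial>lborel)"
    by (subst integral_shift_diff_pow_cis[OF int]) (simp only: cis_half_period[OF z])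
  also have "\<dots> = (\<integral>\<xi>. (shift_diff h ^^ M) ((shift_diff ?k ^^ M) b) \<xi> * cis (z \<bullet> \<xi>) \<partial>lborel)"
    by (simp only: shift_diff_pow_commute)
  also have "\<dots> = (cis (- (z \<bullet> h)) - 1) ^ M * ((- 2) ^ M * osc_kernel M b z)"
    by (subst integral_shift_diff_pow_cis[OF int]) (simp add: osc_kernel_def)
  finally show ?thesis by (simp add: mult.left_commute)
qed

text \<open>Every further difference by the half period multiplies the integral by \<open>- 2\<close>.  Hence one
  kernel satisfies the estimates for all orders.\<close>

lemma osc_kernel_order_independent:
  fixes b :: "'v::euclidean_space \<Rightarrow> complex"
  assumes int: "\<And>h. integrable lborel ((shift_diff h ^^ M) b)" and z: "z \<noteq> 0" and "M \<le> N"
  shows "osc_kernel N b z = osc_kernel M b z"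
proof -
  obtain k where N: "N = k + M" using \<open>M \<le> N\<close> le_iff_add add.commute by metis
  let ?k = "half_period z"
  have "(\<integral>\<xi>. (shift_diff ?k ^^ N) b \<xi> * cis (z \<bullet> \<xi>) \<partial>lborel)
     = (- 2) ^ k * (\<integral>\<xi>. (shift_diff ?k ^^ M) b \<xi> * cis (z \<bullet> \<xi>) \<partial>lborel)"
    unfolding N funpow_add o_def
    by (subst integral_shift_diff_pow_cis[OF int]) (simp only: cis_half_period[OF z])
  then show ?thesis by (simp add: osc_kernel_def N power_add)
qed

lemma shift_diff_integral_bounds:
  assumes q: "2 * DIM('v::euclidean_space) + 1 \<le> q" and M: "M = q + l"
  shows "\<exists>C\<ge>0. \<forall>A (b :: 'v \<Rightarrow> complex) h. symbol_bound A l q b \<longrightarrow>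
       integrable lborel ((shift_diff h ^^ M) b) \<and>
       (\<integral>\<xi>. norm ((shift_diff h ^^ M) b \<xi>) \<partial>lborel)
          \<le> C * A * norm h ^ M * max 1 (norm h) ^ DIM('v) / max 1 (norm h) ^ q \<and>
       integrable lborel (\<lambda>\<xi>. norm \<xi> * norm ((shift_diff h ^^ M) b \<xi>)) \<and>
       (\<integral>\<xi>. norm \<xi> * norm ((shift_diff h ^^ M) b \<xi>) \<partial>lborel)
          \<le> C * A * norm h ^ M * max 1 (norm h) ^ DIM('v) / max 1 (norm h) ^ (q - 1)"
proof -
  obtain C0 where C0: "C0 \<ge> 0" and est:
    "\<And>A (b :: 'v \<Rightarrow> complex) h \<xi>. symbol_bound A l q b \<Longrightarrow>
       norm ((shift_diff h ^^ (q + l)) b \<xi>) \<le> C0 * A * norm h ^ (q + l) / (max 1 (norm h) + norm \<xi>) ^ q"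
    using shift_diff_symbol_bound[of q l, where 'v='v] q by auto
  let ?D = "DIM('v)"
  show ?thesis unfolding M
  proof (intro exI[of _ "C0 * 2 ^ ?D"] conjI[of "_ \<le> _"] allI impI)
    show "C0 * 2 ^ ?D \<ge> 0" using C0 by simp
    fix A and b :: "'v \<Rightarrow> complex" and h :: 'v
    assume b: "symbol_bound A l q b"
    let ?r = "max 1 (norm h)"
    let ?g = "(shift_diff h ^^ (q + l)) b"
    let ?B = "C0 * A * norm h ^ (q + l)"
    have r: "?r > 0" by simp
    have B: "0 \<le> ?B" using C0 symbol_bound_nonneg[OF b] by simp
    have [measurable]: "?g \<in> borel_measurable borel"
      using b by (intro shift_diff_pow_borel_measurable1 smooth_borel_measurable) (simp add: symbol_bound_def)
    have le1: "norm (?g \<xi>) \<le> ?B * (1 / (?r + norm \<xi>) ^ q)" for \<xi>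
      using est[OF b, of h \<xi>] by simp
    have le2: "norm \<xi> * norm (?g \<xi>) \<le> ?B * (1 / (?r + norm \<xi>) ^ (q - 1))" for \<xi>
    proof -
      have "norm \<xi> * norm (?g \<xi>) \<le> (?r + norm \<xi>) * (?B * (1 / (?r + norm \<xi>) ^ q))"
        by (intro mult_mono le1) auto
      also have "(?r + norm \<xi>) ^ q = (?r + norm \<xi>) * (?r + norm \<xi>) ^ (q - 1)"
        using q by (simp flip: power_Suc)
      also have "(?r + norm \<xi>) * (?B * (1 / ((?r + norm \<xi>) * (?r + norm \<xi>) ^ (q - 1))))
          = ?B * (1 / (?r + norm \<xi>) ^ (q - 1))"
      proof -
        have "s * (B * (1 / (s * t))) = B * (1 / t)" if "s \<noteq> 0" for s B t :: real
          using that by simp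
        moreover have "?r + norm \<xi> \<noteq> 0" using r norm_ge_zero[of \<xi>] by linarith
        ultimately show ?thesis by blast
      qed
      finally show ?thesis .
    qed
    have w1: "integrable lborel (\<lambda>\<xi>::'v. ?B * (1 / (?r + norm \<xi>) ^ q))"
      using q by (intro integrable_mult_right integrable_weight r) simp
    have w2: "integrable lborel (\<lambda>\<xi>::'v. ?B * (1 / (?r + norm \<xi>) ^ (q - 1)))"
      using q by (intro integrable_mult_right integrable_weight r) simp
    have n1: "norm (?g \<xi>) \<le> norm (?B * (1 / (?r + norm \<xi>) ^ q))" for \<xi>
      using le1[of \<xi>] unfolding real_norm_def by linarith
    have n2: "norm (norm \<xi> * norm (?g \<xi>)) \<le> norm (?B * (1 / (?r + norm \<xi>) ^ (q - 1)))" for \<xi>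
    proof -
      have "norm (norm \<xi> * norm (?g \<xi>)) = norm \<xi> * norm (?g \<xi>)" by simp
      then show ?thesis using le2[of \<xi>] unfolding real_norm_def by linarith
    qed
    have i1: "integrable lborel ?g"
      by (rule Bochner_Integration.integrable_bound[OF w1]) (simp, intro AE_I2 n1)
    have i2: "integrable lborel (\<lambda>\<xi>. norm \<xi> * norm (?g \<xi>))"
      by (rule Bochner_Integration.integrable_bound[OF w2]) (simp, intro AE_I2 n2)
    have "(\<integral>\<xi>. norm (?g \<xi>) \<partial>lborel) \<le> (\<integral>\<xi>. ?B * (1 / (?r + norm (\<xi>::'v)) ^ q) \<partial>lborel)"
      by (rule integral_mono[OF integrable_norm[OF i1] w1]) (rule le1)
    also have "\<dots> \<le> ?B * (2 ^ ?D * ?r ^ ?D / ?r ^ q)"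
      unfolding integral_mult_right_zero using q by (intro mult_left_mono integral_weight_le r B) simp
    finally have e1: "(\<integral>\<xi>. norm (?g \<xi>) \<partial>lborel) \<le> C0 * 2 ^ ?D * A * norm h ^ (q + l) * ?r ^ ?D / ?r ^ q"
      by (simp add: mult_ac)
    have "(\<integral>\<xi>. norm \<xi> * norm (?g \<xi>) \<partial>lborel) \<le> (\<integral>\<xi>. ?B * (1 / (?r + norm (\<xi>::'v)) ^ (q - 1)) \<partial>lborel)"
      by (rule integral_mono[OF i2 w2]) (rule le2)
    also have "\<dots> \<le> ?B * (2 ^ ?D * ?r ^ ?D / ?r ^ (q - 1))"
      unfolding integral_mult_right_zero using q by (intro mult_left_mono integral_weight_le r B) simp
    finally have e2: "(\<integral>\<xi>. norm \<xi> * norm (?g \<xi>) \<partial>lborel)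
        \<le> C0 * 2 ^ ?D * A * norm h ^ (q + l) * ?r ^ ?D / ?r ^ (q - 1)"
      by (simp add: mult_ac)
    show "integrable lborel ?g \<and>
       (\<integral>\<xi>. norm (?g \<xi>) \<partial>lborel) \<le> C0 * 2 ^ ?D * A * norm h ^ (q + l) * ?r ^ ?D / ?r ^ q \<and>
       integrable lborel (\<lambda>\<xi>. norm \<xi> * norm (?g \<xi>)) \<and>
       (\<integral>\<xi>. norm \<xi> * norm (?g \<xi>) \<partial>lborel) \<le> C0 * 2 ^ ?D * A * norm h ^ (q + l) * ?r ^ ?D / ?r ^ (q - 1)"
      using i1 e1 i2 e2 by blast
  qed
qed

lemma symbol_bound_integrable_shift_diff:
  fixes b :: "'v::euclidean_space \<Rightarrow> complex"
  assumes "2 * DIM('v) + 1 \<le> q" "symbol_bound A l q b"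
  shows "integrable lborel ((shift_diff h ^^ (q + l)) b)"
  using shift_diff_integral_bounds[OF assms(1) refl, of l] assms(2) by blast

lemma norm_osc_kernel_le_L1:
  "norm (osc_kernel M b z) \<le> (\<integral>\<xi>. norm ((shift_diff (half_period z) ^^ M) b \<xi>) \<partial>lborel)"
proof -
  have "norm (osc_kernel M b z) = norm (\<integral>\<xi>. (shift_diff (half_period z) ^^ M) b \<xi> * cis (z \<bullet> \<xi>) \<partial>lborel) / 2 ^ M"
    by (simp add: osc_kernel_def norm_divide norm_power)
  also have "\<dots> \<le> norm (\<integral>\<xi>. (shift_diff (half_period z) ^^ M) b \<xi> * cis (z \<bullet> \<xi>) \<partial>lborel) / 1"
    by (intro divide_left_mono) auto
  also have "\<dots> \<le> (\<integral>\<xi>. norm ((shift_diff (half_period z) ^^ M) b \<xi> * cis (z \<bullet> \<xi>)) \<partial>lborel)"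
    by simp
  finally show ?thesis by (simp add: norm_mult)
qed

lemma osc_kernel_size:
  assumes q: "2 * DIM('v::euclidean_space) + 1 \<le> q"
  shows "\<exists>C\<ge>0. \<forall>A (b :: 'v \<Rightarrow> complex) z. symbol_bound A 0 q b \<longrightarrow>
       norm (osc_kernel q b z) \<le> C * A * (pi / norm z) ^ q * max 1 (pi / norm z) ^ DIM('v) / max 1 (pi / norm z) ^ q"
proof -
  have q0: "q = q + 0" by simp
  obtain C where C: "C \<ge> 0" and E:
    "\<And>A (b :: 'v \<Rightarrow> complex) h. symbol_bound A 0 q b \<Longrightarrow>
       (\<integral>\<xi>. norm ((shift_diff h ^^ q) b \<xi>) \<partial>lborel)
          \<le> C * A * norm h ^ q * max 1 (norm h) ^ DIM('v) / max 1 (norm h) ^ q"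
    using shift_diff_integral_bounds[OF q q0] by blast
  show ?thesis
  proof (intro exI[of _ C] conjI C allI impI)
    fix A and b :: "'v \<Rightarrow> complex" and z :: 'v
    assume "symbol_bound A 0 q b"
    from order_trans[OF norm_osc_kernel_le_L1 E[OF this, of "half_period z"]]
    show "norm (osc_kernel q b z) \<le> C * A * (pi / norm z) ^ q * max 1 (pi / norm z) ^ DIM('v) / max 1 (pi / norm z) ^ q"
      by (simp only: norm_half_period)
  qed
qed

lemma norm_cis_diff_le: "norm (cis s - cis t) \<le> \<bar>s - t\<bar>"
proof -
  have "cis s - cis t = cis t * (exp (\<i> * of_real (s - t)) - 1)"
    unfolding cis_conv_exp[symmetric] right_diff_distrib cis_mult by simp
  then have "norm (cis s - cis t) = 2 * \<bar>sin ((s - t) / 2)\<bar>"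
    by (simp only: norm_mult norm_cis dist_exp_i_1)
  also have "\<dots> \<le> 2 * \<bar>(s - t) / 2\<bar>" by (intro mult_left_mono abs_sin_x_le_abs_x) simp
  finally show ?thesis by simp
qed

text \<open>Both kernels are computed with the half period \<open>h\<close> of \<open>z\<close>.  The hypothesis that \<open>z'\<close> is close
  to \<open>z\<close> keeps the factor \<open>cis (- (z' \<bullet> h)) - 1\<close> near \<open>- 2\<close>.  Three changes contribute: that of this
  factor, that of the exponential, which costs one power of \<open>norm \<xi>\<close>, and that of the symbol, which
  is measured by a symbol of order \<open>1\<close>.\<close>

lemma osc_kernel_difference:
  assumes q: "2 * DIM('v::euclidean_space) + 2 \<le> q"
  shows "\<exists>C\<ge>0. \<forall>A A' (b :: 'v \<Rightarrow> complex) b' z z'.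
       symbol_bound A 0 q b \<longrightarrow> symbol_bound A 0 q b' \<longrightarrow> symbol_bound A' 1 (q - 1) (\<lambda>\<xi>. b \<xi> - b' \<xi>) \<longrightarrow>
       z \<noteq> 0 \<longrightarrow> norm (z - z') * (pi / norm z) \<le> 1 \<longrightarrow>
       norm (osc_kernel q b z - osc_kernel q b' z')
         \<le> C * (A * norm (z - z') + A') * (pi / norm z) ^ q * max 1 (pi / norm z) ^ (DIM('v) + 1) / max 1 (pi / norm z) ^ q"
proof -
  let ?D = "DIM('v)"
  have q0: "2 * ?D + 1 \<le> q" and q1: "2 * ?D + 1 \<le> q - 1" and q00: "q = q + 0" and q11: "q = q - 1 + 1" using q by auto
  obtain C0 where C0: "C0 \<ge> 0" and E0:
    "\<And>A (b :: 'v \<Rightarrow> complex) h. symbol_bound A 0 q b \<Longrightarrow>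
       integrable lborel ((shift_diff h ^^ q) b) \<and>
       (\<integral>\<xi>. norm ((shift_diff h ^^ q) b \<xi>) \<partial>lborel)
          \<le> C0 * A * norm h ^ q * max 1 (norm h) ^ ?D / max 1 (norm h) ^ q \<and>
       integrable lborel (\<lambda>\<xi>. norm \<xi> * norm ((shift_diff h ^^ q) b \<xi>)) \<and>
       (\<integral>\<xi>. norm \<xi> * norm ((shift_diff h ^^ q) b \<xi>) \<partial>lborel)
          \<le> C0 * A * norm h ^ q * max 1 (norm h) ^ ?D / max 1 (norm h) ^ (q - 1)"
    using shift_diff_integral_bounds[OF q0 q00] by blast
  obtain C1 where C1: "C1 \<ge> 0" and E1:
    "\<And>A (b :: 'v \<Rightarrow> complex) h. symbol_bound A 1 (q - 1) b \<Longrightarrow>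
       (\<integral>\<xi>. norm ((shift_diff h ^^ q) b \<xi>) \<partial>lborel)
          \<le> C1 * A * norm h ^ q * max 1 (norm h) ^ ?D / max 1 (norm h) ^ (q - 1)"
    using shift_diff_integral_bounds[OF q1 q11] by blast
  show ?thesis
  proof (intro exI[of _ "C0 * (1 + real q) + C1"] conjI[of "_ \<le> _"] allI impI)
    show "0 \<le> C0 * (1 + real q) + C1" using C0 C1 by simp
    fix A A' and b b' :: "'v \<Rightarrow> complex" and z z' :: 'v
    assume b: "symbol_bound A 0 q b" and b': "symbol_bound A 0 q b'"
      and d: "symbol_bound A' 1 (q - 1) (\<lambda>\<xi>. b \<xi> - b' \<xi>)"
      and z: "z \<noteq> 0" and close: "norm (z - z') * (pi / norm z) \<le> 1"
    define h where "h = half_period z"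
    have nh: "norm h = pi / norm z" by (simp add: h_def norm_half_period)
    have zh: "z \<bullet> h = pi" using z by (simp add: h_def inner_half_period)
    let ?r = "max 1 (norm h)"
    have A: "0 \<le> A" "0 \<le> A'" using b d symbol_bound_nonneg by blast+
    define T where "T = norm h ^ q * ?r ^ (?D + 1) / ?r ^ q"
    have T0: "0 \<le> T" by (simp add: T_def)
    have Teq: "norm h ^ q * ?r ^ ?D / ?r ^ (q - 1) = T"
    proof -
      have "?r ^ q = ?r * ?r ^ (q - 1)" using q by (simp flip: power_Suc)
      then show ?thesis by (simp add: T_def)
    qed
    have Tc: "C * norm h ^ q * ?r ^ ?D / ?r ^ (q - 1) = C * T" for C
      unfolding Teq[symmetric] by simp
    define G where "G = (\<integral>\<xi>. (shift_diff h ^^ q) b \<xi> * cis (z \<bullet> \<xi>) \<partial>lborel)"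
    define G' where "G' = (\<integral>\<xi>. (shift_diff h ^^ q) b' \<xi> * cis (z' \<bullet> \<xi>) \<partial>lborel)"
    define \<tau> where "\<tau> = (z' - z) \<bullet> h"
    have \<tau>: "\<bar>\<tau>\<bar> \<le> norm (z - z') * norm h"
      unfolding \<tau>_def by (metis Cauchy_Schwarz_ineq2 norm_minus_commute)
    then have \<tau>1: "\<bar>\<tau>\<bar> \<le> 1" using close nh by simp
    have z'h: "z' \<bullet> h = pi + \<tau>" by (simp add: \<tau>_def inner_diff_left zh)
    have z': "z' \<noteq> 0" using z'h \<tau>1 pi_gt3 by auto
    define p' where "p' = cis (- (z' \<bullet> h)) - 1"
    \<comment> \<open>the half period of \<open>z\<close> turns the phase at \<open>z'\<close> into \<open>pi + \<tau>\<close> with \<open>\<bar>\<tau>\<bar> \<le> 1\<close>\<close>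
    have p'eq: "p' = - cis (- \<tau>) - 1"
      by (simp add: p'_def z'h complex_eq_iff cos_diff sin_diff)
    have p'd: "norm (p' - (- 2)) \<le> norm (z - z') * norm h"
    proof -
      have "p' - (- 2) = cis 0 - cis (- \<tau>)" by (simp add: p'eq)
      also have "norm \<dots> \<le> \<bar>\<tau>\<bar>" using norm_cis_diff_le[of 0 "- \<tau>"] by simp
      finally show ?thesis using \<tau> by linarith
    qed
    have p'1: "1 \<le> norm p'"
    proof -
      have "norm (- 2 :: complex) \<le> norm p' + norm (p' - (- 2))"
        by (metis norm_minus_commute norm_triangle_sub add.commute)
      then show ?thesis using p'd close nh by simp
    qed
    have intb: "integrable lborel ((shift_diff k ^^ q) b)" "integrable lborel ((shift_diff k ^^ q) b')" for k
      using E0[OF b, of k] E0[OF b', of k] by auto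
    have K: "osc_kernel q b z = (1 / (- 2)) ^ q * G"
      unfolding osc_kernel_def G_def h_def power_divide by simp
    have K': "osc_kernel q b' z' = (1 / p') ^ q * G'"
    proof -
      have "G' = p' ^ q * osc_kernel q b' z'"
        unfolding G'_def p'_def by (rule osc_kernel_any_shift[OF intb(2) z'])
      then show ?thesis using p'1 by (auto simp: power_divide)
    qed
    have GG': "norm (G - G') \<le> (C0 * A * norm (z - z') + C1 * A') * T"
    proof -
      let ?f = "\<lambda>\<xi>. (shift_diff h ^^ q) b \<xi> * (cis (z \<bullet> \<xi>) - cis (z' \<bullet> \<xi>))"
      let ?g = "\<lambda>\<xi>. (shift_diff h ^^ q) (\<lambda>\<xi>. b \<xi> - b' \<xi>) \<xi> * cis (z' \<bullet> \<xi>)"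
      have i1: "integrable lborel (\<lambda>\<xi>. (shift_diff h ^^ q) b \<xi> * cis (z \<bullet> \<xi>))"
        "integrable lborel (\<lambda>\<xi>. (shift_diff h ^^ q) b' \<xi> * cis (z' \<bullet> \<xi>))"
        "integrable lborel (\<lambda>\<xi>. (shift_diff h ^^ q) b \<xi> * cis (z' \<bullet> \<xi>))"
        by (intro integrable_mult_cis intb; simp)+
      have i2: "integrable lborel ?f" "integrable lborel ?g"
        using Bochner_Integration.integrable_diff[OF i1(1) i1(3)] Bochner_Integration.integrable_diff[OF i1(3) i1(2)]
        by (simp_all add: algebra_simps shift_diff_pow_diff)
      have "G - G' = (\<integral>\<xi>. ?f \<xi> + ?g \<xi> \<partial>lborel)"
        unfolding G_def G'_def
        by (subst Bochner_Integration.integral_diff[OF i1(1,2), symmetric])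
           (simp add: algebra_simps shift_diff_pow_diff)
      also have "\<dots> = (\<integral>\<xi>. ?f \<xi> \<partial>lborel) + (\<integral>\<xi>. ?g \<xi> \<partial>lborel)"
        by (rule Bochner_Integration.integral_add[OF i2])
      finally have e: "G - G' = (\<integral>\<xi>. ?f \<xi> \<partial>lborel) + (\<integral>\<xi>. ?g \<xi> \<partial>lborel)" .
      have "norm (G - G') \<le> (\<integral>\<xi>. norm (?f \<xi>) \<partial>lborel) + (\<integral>\<xi>. norm (?g \<xi>) \<partial>lborel)"
        unfolding e by (rule order_trans[OF norm_triangle_ineq add_mono[OF integral_norm_bound integral_norm_bound]])
      also have "(\<integral>\<xi>. norm (?g \<xi>) \<partial>lborel) \<le> C1 * A' * T"
        using E1[OF d, of h] unfolding Tc norm_mult norm_cis mult_1_right .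
      also have "(\<integral>\<xi>. norm (?f \<xi>) \<partial>lborel) \<le> (\<integral>\<xi>. norm (z - z') * (norm \<xi> * norm ((shift_diff h ^^ q) b \<xi>)) \<partial>lborel)"
      proof (rule integral_mono[OF integrable_norm[OF i2(1)]])
        show "integrable lborel (\<lambda>\<xi>. norm (z - z') * (norm \<xi> * norm ((shift_diff h ^^ q) b \<xi>)))"
          using E0[OF b, of h] by (intro integrable_mult_right) auto
        fix \<xi> :: 'v
        have "norm (cis (z \<bullet> \<xi>) - cis (z' \<bullet> \<xi>)) \<le> \<bar>(z - z') \<bullet> \<xi>\<bar>"
          using norm_cis_diff_le[of "z \<bullet> \<xi>" "z' \<bullet> \<xi>"] by (simp add: inner_diff_left)
        also have "\<dots> \<le> norm (z - z') * norm \<xi>" by (rule Cauchy_Schwarz_ineq2)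
        finally have "norm ((shift_diff h ^^ q) b \<xi>) * norm (cis (z \<bullet> \<xi>) - cis (z' \<bullet> \<xi>))
            \<le> norm ((shift_diff h ^^ q) b \<xi>) * (norm (z - z') * norm \<xi>)"
          by (intro mult_left_mono) auto
        then show "norm (?f \<xi>) \<le> norm (z - z') * (norm \<xi> * norm ((shift_diff h ^^ q) b \<xi>))"
          by (simp add: norm_mult mult_ac)
      qed
      also have "\<dots> \<le> norm (z - z') * (C0 * A * T)"
        unfolding integral_mult_right_zero
        using E0[OF b, of h] unfolding Tc by (intro mult_left_mono) auto
      finally show ?thesis by (simp add: algebra_simps)
    qed
    have p'i: "norm (1 / p') \<le> 1"
    proof -
      have "1 / norm p' \<le> 1 / 1" using p'1 by (intro divide_left_mono) auto
      then show ?thesis by (simp add: norm_divide)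
    qed
    have pp: "norm ((1 / (- 2)) ^ q - (1 / p') ^ q) \<le> real q * (norm (z - z') * norm h)"
    proof -
      have p'0: "p' \<noteq> 0" using p'1 by auto
      have "norm ((1 / (- 2)) ^ q - (1 / p') ^ q) \<le> real q * norm (1 / (- 2) - 1 / p')"
        by (rule norm_power_diff) (use p'i in auto)
      also have "1 / (- 2) - 1 / p' = (p' - (- 2)) / ((- 2) * p')"
        using p'0 by (simp add: field_simps)
      also have "norm \<dots> = norm (p' - (- 2)) / (2 * norm p')" by (simp add: norm_divide norm_mult)
      also have "\<dots> \<le> norm (p' - (- 2)) / 1" using p'1 by (intro divide_left_mono) auto
      also have "\<dots> \<le> norm (z - z') * norm h" using p'd by simp
      finally show ?thesis by (simp add: mult_left_mono)
    qed
    have Gb: "norm h * norm G \<le> C0 * A * T"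
    proof -
      have "norm G \<le> (\<integral>\<xi>. norm ((shift_diff h ^^ q) b \<xi> * cis (z \<bullet> \<xi>)) \<partial>lborel)"
        unfolding G_def by (rule integral_norm_bound)
      also have "\<dots> \<le> C0 * A * norm h ^ q * ?r ^ ?D / ?r ^ q"
        using E0[OF b, of h] by (simp add: norm_mult)
      finally have "norm h * norm G \<le> ?r * (C0 * A * norm h ^ q * ?r ^ ?D / ?r ^ q)"
        by (intro mult_mono) auto
      also have "\<dots> = C0 * A * T" by (simp add: T_def)
      finally show ?thesis .
    qed
    have "osc_kernel q b z - osc_kernel q b' z' = (1 / p') ^ q * (G - G') + ((1 / (- 2)) ^ q - (1 / p') ^ q) * G"
      unfolding K K' by (simp add: algebra_simps)
    then have "norm (osc_kernel q b z - osc_kernel q b' z')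
       \<le> norm ((1 / p') ^ q * (G - G')) + norm (((1 / (- 2)) ^ q - (1 / p') ^ q) * G)"
      by (metis norm_triangle_ineq)
    also have "norm ((1 / p') ^ q * (G - G')) \<le> 1 * norm (G - G')"
      unfolding norm_mult norm_power using p'i by (intro mult_right_mono power_le_one) auto
    also have "1 * norm (G - G') \<le> (C0 * A * norm (z - z') + C1 * A') * T" using GG' by simp
    also have "norm (((1 / (- 2)) ^ q - (1 / p') ^ q) * G) \<le> real q * (norm (z - z') * norm h) * norm G"
      unfolding norm_mult by (intro mult_right_mono pp) auto
    also have "\<dots> = real q * norm (z - z') * (norm h * norm G)" by simp
    also have "\<dots> \<le> real q * norm (z - z') * (C0 * A * T)" by (intro mult_left_mono Gb) auto
    also have "(C0 * A * norm (z - z') + C1 * A') * T + real q * norm (z - z') * (C0 * A * T)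
        = (C0 * (1 + real q) * (A * norm (z - z')) + C1 * A') * T" by (simp add: algebra_simps)
    also have "\<dots> \<le> (C0 * (1 + real q) + C1) * (A * norm (z - z') + A') * T"
    proof (intro mult_right_mono T0)
      have "0 \<le> C0 * (1 + real q) * A'" "0 \<le> C1 * (A * norm (z - z'))" using C0 C1 A by auto
      then show "C0 * (1 + real q) * (A * norm (z - z')) + C1 * A' \<le> (C0 * (1 + real q) + C1) * (A * norm (z - z') + A')"
        by (simp add: distrib_left distrib_right)
    qed
    finally show "norm (osc_kernel q b z - osc_kernel q b' z')
         \<le> (C0 * (1 + real q) + C1) * (A * norm (z - z') + A') * (pi / norm z) ^ q * max 1 (pi / norm z) ^ (?D + 1) / max 1 (pi / norm z) ^ q"
      by (simp add: T_def nh mult.assoc)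
  qed
qed

lemma integral_fourier_swap:
  fixes g F :: "'v::euclidean_space \<Rightarrow> complex"
  assumes g: "integrable lborel g" and F: "integrable lborel F"
    and [measurable]: "\<phi> \<in> borel_measurable borel"
  shows "(\<integral>\<xi>. g \<xi> * (\<integral>y. F y * cis (\<phi> y \<bullet> \<xi>) \<partial>lborel) \<partial>lborel)
       = (\<integral>y. F y * (\<integral>\<xi>. g \<xi> * cis (\<phi> y \<bullet> \<xi>) \<partial>lborel) \<partial>lborel)"
proof -
  have [measurable]: "g \<in> borel_measurable borel" "F \<in> borel_measurable borel"
    using g F by auto
  let ?H = "\<lambda>\<xi> y. g \<xi> * F y * cis (\<phi> y \<bullet> \<xi>)"
  have m: "(\<lambda>(\<xi>, y). ?H \<xi> y) \<in> borel_measurable (lborel \<Otimes>\<^sub>M lborel)"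
    unfolding cis_conv_exp by measurable
  have i: "integrable (lborel \<Otimes>\<^sub>M lborel) (\<lambda>(\<xi>, y). ?H \<xi> y)"
  proof (rule lborel_pair.Fubini_integrable[OF m])
    have "(\<lambda>\<xi>. \<integral>y. norm (case (\<xi>, y) of (\<xi>, y) \<Rightarrow> ?H \<xi> y) \<partial>lborel) = (\<lambda>\<xi>. norm (g \<xi>) * (\<integral>y. norm (F y) \<partial>lborel))"
      by (simp add: norm_mult mult.assoc)
    then show "integrable lborel (\<lambda>\<xi>. \<integral>y. norm (case (\<xi>, y) of (\<xi>, y) \<Rightarrow> ?H \<xi> y) \<partial>lborel)"
      using g by simp
    have "integrable lborel (\<lambda>y. g \<xi> * (F y * cis (\<phi> y \<bullet> \<xi>)))" for \<xi>
      by (intro integrable_mult_right integrable_mult_cis F) measurable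
    then show "AE \<xi> in lborel. integrable lborel (\<lambda>y. case (\<xi>, y) of (\<xi>, y) \<Rightarrow> ?H \<xi> y)"
      by (simp add: mult.assoc)
  qed
  have "(\<integral>\<xi>. g \<xi> * (\<integral>y. F y * cis (\<phi> y \<bullet> \<xi>) \<partial>lborel) \<partial>lborel) = (\<integral>\<xi>. (\<integral>y. ?H \<xi> y \<partial>lborel) \<partial>lborel)"
    by (simp add: mult.assoc)
  also have "\<dots> = (\<integral>y. (\<integral>\<xi>. ?H \<xi> y \<partial>lborel) \<partial>lborel)"
    by (rule lborel_pair.Fubini_integral[OF i, symmetric])
  also have "\<dots> = (\<integral>y. (\<integral>\<xi>. F y * (g \<xi> * cis (\<phi> y \<bullet> \<xi>)) \<partial>lborel) \<partial>lborel)"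
    by (simp add: mult_ac)
  also have "\<dots> = (\<integral>y. F y * (\<integral>\<xi>. g \<xi> * cis (\<phi> y \<bullet> \<xi>) \<partial>lborel) \<partial>lborel)"
    by simp
  finally show ?thesis .
qed

lemma integral_dilation:
  fixes f :: "'v::euclidean_space \<Rightarrow> complex"
  assumes "R > 0" and [measurable]: "f \<in> borel_measurable borel"
  shows "(\<integral>\<xi>. f \<xi> \<partial>lborel) = R ^ DIM('v) * (\<integral>\<xi>. f (R *\<^sub>R \<xi>) \<partial>lborel)"
proof -
  have "(\<integral>\<xi>. f \<xi> \<partial>lborel) = (\<integral>\<xi>. f \<xi> \<partial>density (distr lborel borel (\<lambda>x. 0 + R *\<^sub>R x)) (\<lambda>_. \<bar>R\<bar> ^ DIM('v)))"
    using lborel_affine[of R "0::'v"] assms(1) by simp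
  also have "\<dots> = (\<integral>\<xi>. R ^ DIM('v) *\<^sub>R f \<xi> \<partial>distr lborel borel (\<lambda>x. 0 + R *\<^sub>R x))"
    using assms(1) by (subst integral_density) (auto simp: ennreal_power[symmetric])
  also have "\<dots> = (\<integral>\<xi>. R ^ DIM('v) *\<^sub>R f (0 + R *\<^sub>R \<xi>) \<partial>lborel)"
    by (rule integral_distr) auto
  also have "\<dots> = R ^ DIM('v) * (\<integral>\<xi>. f (R *\<^sub>R \<xi>) \<partial>lborel)"
    by (simp add: scaleR_conv_of_real)
  finally show ?thesis by simp
qed

lemma gauss_pos: "0 < gauss \<eta>" and gauss_le_1: "gauss \<eta> \<le> 1"
  by (simp_all add: gauss_def)

lemma gauss_borel_measurable [measurable]: "gauss \<in> borel_measurable borel"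
  unfolding gauss_def[abs_def] by measurable

lemma integrable_gauss_complex: "integrable lborel (\<lambda>\<eta>::'v::euclidean_space. complex_of_real (gauss \<eta>))"
  using integrable_gauss by (rule integrable_of_real)

section \<open>Fourier transforms of functions vanishing near a point\<close>

text \<open>Up to an exponentially small error, a wide Gaussian average of a Fourier transform depends only on
  the values of \<open>G\<close> near \<open>c\<close>, and these are zero.\<close>

lemma gauss_average_fourier:
  fixes G :: "'v::euclidean_space \<Rightarrow> complex"
  assumes G: "integrable lborel G" and van: "\<And>y. norm (c - y) < r \<Longrightarrow> G y = 0"
    and r: "r > 0" and R: "R > 0"
  shows "norm (\<integral>\<eta>. gauss \<eta> * (\<integral>y. G y * cis ((c - y) \<bullet> (R *\<^sub>R \<eta>)) \<partial>lborel) \<partial>lborel)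
     \<le> sqrt (2 * pi) ^ DIM('v) * exp (- (R * r)\<^sup>2 / 2) * (\<integral>y. norm (G y) \<partial>lborel)"
proof -
  let ?C = "sqrt (2 * pi) ^ DIM('v)"
  let ?e = "exp (- (R * r)\<^sup>2 / 2)"
  have [measurable]: "G \<in> borel_measurable borel" using G by auto
  have "(\<integral>\<eta>. gauss \<eta> * (\<integral>y. G y * cis ((c - y) \<bullet> (R *\<^sub>R \<eta>)) \<partial>lborel) \<partial>lborel)
     = (\<integral>\<eta>. gauss \<eta> * (\<integral>y. G y * cis ((R *\<^sub>R (c - y)) \<bullet> \<eta>) \<partial>lborel) \<partial>lborel)"
    by simp
  also have "\<dots> = (\<integral>y. G y * (\<integral>\<eta>. gauss \<eta> * cis ((R *\<^sub>R (c - y)) \<bullet> \<eta>) \<partial>lborel) \<partial>lborel)"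
    by (rule integral_fourier_swap[OF integrable_gauss_complex G]) measurable
  also have "\<dots> = (\<integral>y. G y * of_real (?C * gauss (R *\<^sub>R (c - y))) \<partial>lborel)"
    by (simp only: integral_gauss_cis of_real_mult of_real_power)
  finally have eq: "(\<integral>\<eta>. gauss \<eta> * (\<integral>y. G y * cis ((c - y) \<bullet> (R *\<^sub>R \<eta>)) \<partial>lborel) \<partial>lborel)
     = (\<integral>y. G y * of_real (?C * gauss (R *\<^sub>R (c - y))) \<partial>lborel)" .
  have le: "norm (G y * of_real (?C * gauss (R *\<^sub>R (c - y)))) \<le> ?C * ?e * norm (G y)" for y
  proof (cases "norm (c - y) < r")
    case False
    then have "(R * r)\<^sup>2 \<le> (norm (R *\<^sub>R (c - y)))\<^sup>2"
      using r R by (intro power_mono) (auto intro!: mult_left_mono)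
    then have "gauss (R *\<^sub>R (c - y)) \<le> ?e" unfolding gauss_def by simp
    then have "norm (G y) * (?C * gauss (R *\<^sub>R (c - y))) \<le> norm (G y) * (?C * ?e)"
      by (intro mult_left_mono) auto
    moreover have "norm (of_real (?C * gauss (R *\<^sub>R (c - y))) :: complex) = ?C * gauss (R *\<^sub>R (c - y))"
      unfolding norm_of_real using gauss_pos[of "R *\<^sub>R (c - y)"] by simp
    ultimately show ?thesis by (simp add: norm_mult mult_ac)
  qed (use van in auto)
  have i2: "integrable lborel (\<lambda>y. ?C * ?e * norm (G y))"
    using G by (intro integrable_mult_right integrable_norm)
  have i1: "integrable lborel (\<lambda>y. G y * of_real (?C * gauss (R *\<^sub>R (c - y))))"
    by (rule Bochner_Integration.integrable_bound[OF i2]) (measurable, use le in \<open>auto intro!: AE_I2 simp: abs_mult\<close>)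
  have "norm (\<integral>y. G y * of_real (?C * gauss (R *\<^sub>R (c - y))) \<partial>lborel)
      \<le> (\<integral>y. norm (G y * of_real (?C * gauss (R *\<^sub>R (c - y)))) \<partial>lborel)"
    by (rule integral_norm_bound)
  also have "\<dots> \<le> (\<integral>y. ?C * ?e * norm (G y) \<partial>lborel)"
    by (rule integral_mono[OF integrable_norm[OF i1] i2]) (rule le)
  finally show ?thesis unfolding eq by simp
qed

text \<open>Fourier inversion at the point \<open>c\<close>, near which \<open>F\<close> vanishes: the integral is the limit of
  integrals against Gaussians of width \<open>R\<close>.  Rescaling makes these Gaussian averages times a power
  of \<open>R\<close>, and the averages are exponentially small.\<close>

lemma integral_fourier_eq_0:
  fixes F :: "'v::euclidean_space \<Rightarrow> complex"
  assumes F: "integrable lborel F" and van: "\<And>y. norm (c - y) < r \<Longrightarrow> F y = 0" and r: "r > 0"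
    and \<Phi>: "\<And>\<xi>. \<Phi> \<xi> = (\<integral>y. F y * cis ((c - y) \<bullet> \<xi>) \<partial>lborel)" and \<Phi>i: "integrable lborel \<Phi>"
  shows "(\<integral>\<xi>. \<Phi> \<xi> \<partial>lborel) = 0"
proof -
  let ?D = "DIM('v)"
  define R where "R n = real (Suc n)" for n
  have R: "R n > 0" for n by (simp add: R_def)
  have Rtop: "filterlim R at_top sequentially"
    unfolding R_def[abs_def] using filterlim_real_sequentially filterlim_Suc filterlim_compose by blast
  have [measurable]: "\<Phi> \<in> borel_measurable borel" using \<Phi>i by auto
  define X where "X n = (\<integral>\<xi>. gauss (\<xi> /\<^sub>R R n) * \<Phi> \<xi> \<partial>lborel)" for n
  have "X \<longlonglongrightarrow> (\<integral>\<xi>. \<Phi> \<xi> \<partial>lborel)"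
    unfolding X_def
  proof (rule integral_dominated_convergence[where w = "\<lambda>\<xi>. norm (\<Phi> \<xi>)"])
    show "AE \<xi> in lborel. (\<lambda>n. complex_of_real (gauss (\<xi> /\<^sub>R R n)) * \<Phi> \<xi>) \<longlonglongrightarrow> \<Phi> \<xi>"
    proof (rule AE_I2)
      fix \<xi> :: 'v
      have "(\<lambda>n. inverse (R n)) \<longlonglongrightarrow> 0" using Rtop tendsto_inverse_0_at_top by blast
      then have "(\<lambda>n. complex_of_real (gauss (\<xi> /\<^sub>R R n)) * \<Phi> \<xi>)
          \<longlonglongrightarrow> complex_of_real (exp (- (norm (0 *\<^sub>R \<xi>))\<^sup>2 / 2)) * \<Phi> \<xi>"
        unfolding gauss_def by (intro tendsto_intros) auto
      then show "(\<lambda>n. complex_of_real (gauss (\<xi> /\<^sub>R R n)) * \<Phi> \<xi>) \<longlonglongrightarrow> \<Phi> \<xi>" by simp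
    qed
    show "AE \<xi> in lborel. norm (complex_of_real (gauss (\<xi> /\<^sub>R R n)) * \<Phi> \<xi>) \<le> norm (\<Phi> \<xi>)" for n
      by (rule AE_I2, simp add: norm_mult abs_of_pos gauss_pos mult_left_le_one_le[OF norm_ge_zero less_imp_le[OF gauss_pos] gauss_le_1])
  qed (use \<Phi>i in auto)
  moreover have "X \<longlonglongrightarrow> 0"
  proof (rule Lim_null_comparison)
    let ?C = "sqrt (2 * pi) ^ ?D"
    let ?I = "\<integral>y. norm (F y) \<partial>lborel"
    show "\<forall>\<^sub>F n in sequentially. norm (X n) \<le> R n ^ ?D * (?C * exp (- (R n * r)\<^sup>2 / 2) * ?I)"
    proof (rule always_eventually, rule allI)
      fix n
      have "X n = of_real (R n) ^ ?D * (\<integral>\<xi>. gauss ((R n *\<^sub>R \<xi>) /\<^sub>R R n) * \<Phi> (R n *\<^sub>R \<xi>) \<partial>lborel)"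
        unfolding X_def
        by (rule integral_dilation[OF R, where f = "\<lambda>\<xi>. gauss (\<xi> /\<^sub>R R n) * \<Phi> \<xi>"]) measurable
      also have "\<dots> = of_real (R n) ^ ?D * (\<integral>\<xi>. gauss \<xi> * (\<integral>y. F y * cis ((c - y) \<bullet> (R n *\<^sub>R \<xi>)) \<partial>lborel) \<partial>lborel)"
      proof -
        have "(R n *\<^sub>R \<xi>) /\<^sub>R R n = \<xi>" for \<xi> :: 'v using R[of n] by simp
        then show ?thesis by (simp only: \<Phi>)
      qed
      finally have e: "X n = of_real (R n) ^ ?D * (\<integral>\<xi>. gauss \<xi> * (\<integral>y. F y * cis ((c - y) \<bullet> (R n *\<^sub>R \<xi>)) \<partial>lborel) \<partial>lborel)" .
      have "norm (X n) = R n ^ ?D * norm (\<integral>\<xi>. gauss \<xi> * (\<integral>y. F y * cis ((c - y) \<bullet> (R n *\<^sub>R \<xi>)) \<partial>lborel) \<partial>lborel)"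
        unfolding e norm_mult norm_power norm_of_real using R[of n] by (simp only: abs_of_pos)
      also have "\<dots> \<le> R n ^ ?D * (?C * exp (- (R n * r)\<^sup>2 / 2) * ?I)"
        using R[of n] by (intro mult_left_mono gauss_average_fourier[OF F van r R]) auto
      finally show "norm (X n) \<le> R n ^ ?D * (?C * exp (- (R n * r)\<^sup>2 / 2) * ?I)" .
    qed
    \<comment> \<open>since \<open>x ^ D \<le> (x\<^sup>2) ^ D\<close> for \<open>x \<ge> 1\<close>, this reduces to the limit of \<open>s ^ D / exp s\<close>\<close>
    have "((\<lambda>x::real. x ^ ?D * exp (- (x * r)\<^sup>2 / 2)) \<longlongrightarrow> 0) at_top"
    proof (rule Lim_null_comparison)
      let ?x = "\<lambda>x. (x * r)\<^sup>2 / 2"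
      have "filterlim ?x at_top at_top" using r by real_asymp
      then have "((\<lambda>x. ?x x ^ ?D / exp (?x x)) \<longlongrightarrow> 0) at_top"
        using tendsto_power_div_exp_0 filterlim_compose by blast
      then show "((\<lambda>x. (2 / r\<^sup>2) ^ ?D * (?x x ^ ?D / exp (?x x))) \<longlongrightarrow> 0) at_top"
        using tendsto_mult_right_zero by blast
      show "\<forall>\<^sub>F x in at_top. norm (x ^ ?D * exp (- (x * r)\<^sup>2 / 2)) \<le> (2 / r\<^sup>2) ^ ?D * (?x x ^ ?D / exp (?x x))"
      proof (rule eventually_at_top_linorderI[of 1])
        fix x :: real assume x: "1 \<le> x"
        have "x ^ ?D \<le> (x\<^sup>2) ^ ?D" using x by (intro power_mono) (auto simp: power2_eq_square)
        also have "\<dots> = ((2 / r\<^sup>2) * ?x x) ^ ?D" using r by (simp add: power_mult_distrib)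
        also have "\<dots> = (2 / r\<^sup>2) ^ ?D * ?x x ^ ?D" by (rule power_mult_distrib)
        finally have le: "x ^ ?D * exp (- ?x x) \<le> (2 / r\<^sup>2) ^ ?D * ?x x ^ ?D * exp (- ?x x)"
          by (intro mult_right_mono) auto
        then show "norm (x ^ ?D * exp (- (x * r)\<^sup>2 / 2)) \<le> (2 / r\<^sup>2) ^ ?D * (?x x ^ ?D / exp (?x x))"
        proof -
          have "norm (x ^ ?D * exp (- (x * r)\<^sup>2 / 2)) = x ^ ?D * exp (- ?x x)"
            using x by (simp only: real_norm_def abs_mult abs_exp_cancel power_abs minus_divide_left)
          moreover have "(2 / r\<^sup>2) ^ ?D * (?x x ^ ?D / exp (?x x)) = (2 / r\<^sup>2) ^ ?D * ?x x ^ ?D * exp (- ?x x)"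
            by (simp only: exp_minus divide_inverse mult.assoc)
          ultimately show ?thesis using le by (simp only:)
        qed
      qed
    qed
    from filterlim_compose[OF this Rtop]
    have "(\<lambda>n. (?C * ?I) * (R n ^ ?D * exp (- (R n * r)\<^sup>2 / 2))) \<longlonglongrightarrow> 0"
      by (rule tendsto_mult_right_zero)
    then show "(\<lambda>n. R n ^ ?D * (?C * exp (- (R n * r)\<^sup>2 / 2) * ?I)) \<longlonglongrightarrow> 0"
      by (simp add: mult_ac)
  qed
  ultimately show ?thesis by (rule LIMSEQ_unique)
qed

text \<open>A bounded polynomial is constant: along \<open>h\<close>, vanishing second differences make \<open>u\<close> affine, and
  boundedness removes the slope.\<close>

lemma bounded_shift_diff_pow_eq_0:
  fixes u :: "'v::real_vector \<Rightarrow> complex"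
  assumes "\<And>\<eta>. norm (u \<eta>) \<le> B" and "\<And>\<eta>. (shift_diff h ^^ M) u \<eta> = 0"
  shows "shift_diff h u \<eta> = 0"
  using assms
proof (induction M arbitrary: u B \<eta>)
  case 0
  then show ?case by (simp add: shift_diff_def)
next
  case (Suc M)
  let ?u = "shift_diff h u"
  have zero: "shift_diff h ?u \<zeta> = 0" for \<zeta>
  proof (rule Suc.IH[of _ "B + B"])
    show "norm (?u \<eta>) \<le> B + B" for \<eta>
      using norm_triangle_ineq4[of "u (\<eta> + h)" "u \<eta>"] Suc.prems(1)[of "\<eta> + h"] Suc.prems(1)[of \<eta>]
      by (simp add: shift_diff_def)
    show "(shift_diff h ^^ M) ?u \<eta> = 0" for \<eta>
      using Suc.prems(2)[of \<eta>] by (simp only: funpow_Suc_right o_apply)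
  qed
  have per: "?u (\<zeta> + h) = ?u \<zeta>" for \<zeta>
    using zero[of \<zeta>] unfolding shift_diff_def[of h ?u] right_minus_eq .
  have per': "?u (\<eta> + real n *\<^sub>R h) = ?u \<eta>" for n
  proof (induction n)
    case (Suc n)
    then show ?case using per[of "\<eta> + real n *\<^sub>R h"] by (simp add: algebra_simps)
  qed simp
  have lin: "u (\<eta> + real n *\<^sub>R h) = u \<eta> + of_nat n * ?u \<eta>" for n
  proof (induction n)
    case (Suc n)
    have "u (\<eta> + real (Suc n) *\<^sub>R h) = u (\<eta> + real n *\<^sub>R h) + ?u (\<eta> + real n *\<^sub>R h)"
      by (simp add: shift_diff_def algebra_simps)
    then show ?case using Suc per'[of n] by (simp add: algebra_simps)
  qed simp
  show ?case
  proof (rule ccontr)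
    assume "?u \<eta> \<noteq> 0"
    then obtain n where n: "B + B < real n * norm (?u \<eta>)"
      using ex_less_of_nat_mult[of "norm (?u \<eta>)" "B + B"] by auto
    have "real n * norm (?u \<eta>) = norm (u (\<eta> + real n *\<^sub>R h) - u \<eta>)"
      by (simp add: lin norm_mult)
    also have "\<dots> \<le> B + B"
      using norm_triangle_ineq4[of "u (\<eta> + real n *\<^sub>R h)" "u \<eta>"] Suc.prems(1)[of \<eta>]
        Suc.prems(1)[of "\<eta> + real n *\<^sub>R h"] by linarith
    finally show False using n by simp
  qed
qed

text \<open>A shift of the correlation can be moved onto the bounded factor \<open>b\<close>, where the differences
  produce decay.\<close>

lemma shift_diff_pow_correlation:
  fixes b \<Phi> :: "'v::euclidean_space \<Rightarrow> complex"
  assumes "b \<in> borel_measurable borel" and "\<And>\<xi>. norm (b \<xi>) \<le> B" and \<Phi>: "integrable lborel \<Phi>"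
  shows "(shift_diff h ^^ k) (\<lambda>\<eta>. \<integral>\<xi>. b \<xi> * \<Phi> (\<xi> + \<eta>) \<partial>lborel) \<eta>
       = (\<integral>\<xi>. (shift_diff (- h) ^^ k) b \<xi> * \<Phi> (\<xi> + \<eta>) \<partial>lborel)"
  using assms(1,2)
proof (induction k arbitrary: b B)
  case 0
  show ?case by simp
next
  case (Suc k)
  note [measurable] = Suc.prems(1)
  have [measurable]: "\<Phi> \<in> borel_measurable borel" using \<Phi> by auto
  have i: "integrable lborel (\<lambda>\<xi>. b (\<xi> + s) * \<Phi> (\<xi> + \<eta>))" for s \<eta>
  proof (rule Bochner_Integration.integrable_bound)
    show "integrable lborel (\<lambda>\<xi>. of_real B * \<Phi> (\<xi> + \<eta>))"
      by (intro integrable_mult_right integrable_shift \<Phi>)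
    have "norm (b (\<xi> + s)) \<le> \<bar>B\<bar>" for \<xi>
      using Suc.prems(2)[of "\<xi> + s"] by linarith
    then show "AE \<xi> in lborel. norm (b (\<xi> + s) * \<Phi> (\<xi> + \<eta>)) \<le> norm (of_real B * \<Phi> (\<xi> + \<eta>))"
      by (intro AE_I2) (simp add: norm_mult mult_right_mono)
  qed measurable
  have 1: "shift_diff h (\<lambda>\<eta>. \<integral>\<xi>. b \<xi> * \<Phi> (\<xi> + \<eta>) \<partial>lborel)
      = (\<lambda>\<eta>. \<integral>\<xi>. shift_diff (- h) b \<xi> * \<Phi> (\<xi> + \<eta>) \<partial>lborel)"
  proof (rule ext)
    fix \<eta>
    have "(\<integral>\<xi>. b \<xi> * \<Phi> (\<xi> + (\<eta> + h)) \<partial>lborel) = (\<integral>\<xi>. b (\<xi> + - h) * \<Phi> ((\<xi> + - h) + (\<eta> + h)) \<partial>lborel)"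
      by (rule integral_shift[symmetric]) measurable
    also have "\<dots> = (\<integral>\<xi>. b (\<xi> + - h) * \<Phi> (\<xi> + \<eta>) \<partial>lborel)" by (simp add: algebra_simps)
    finally show "shift_diff h (\<lambda>\<eta>. \<integral>\<xi>. b \<xi> * \<Phi> (\<xi> + \<eta>) \<partial>lborel) \<eta>
      = (\<integral>\<xi>. shift_diff (- h) b \<xi> * \<Phi> (\<xi> + \<eta>) \<partial>lborel)"
      using Bochner_Integration.integral_diff[OF i[of "- h" \<eta>] i[of 0 \<eta>]]
      by (simp add: shift_diff_def left_diff_distrib)
  qed
  have "(shift_diff h ^^ k) (\<lambda>\<eta>. \<integral>\<xi>. shift_diff (- h) b \<xi> * \<Phi> (\<xi> + \<eta>) \<partial>lborel) \<eta>
     = (\<integral>\<xi>. (shift_diff (- h) ^^ k) (shift_diff (- h) b) \<xi> * \<Phi> (\<xi> + \<eta>) \<partial>lborel)"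
  proof (rule Suc.IH[of _ "B + B"])
    show "shift_diff (- h) b \<in> borel_measurable borel"
      using shift_diff_pow_borel_measurable1[OF Suc.prems(1), of "Suc 0" "- h"] by simp
    show "norm (shift_diff (- h) b \<xi>) \<le> B + B" for \<xi>
      using norm_triangle_ineq4[of "b (\<xi> + - h)" "b \<xi>"] Suc.prems(2)[of "\<xi> + - h"] Suc.prems(2)[of \<xi>]
      by (simp add: shift_diff_def)
  qed
  then show ?case by (simp only: funpow_Suc_right o_apply 1)
qed

lemma shift_diff_pow_fourier:
  fixes G :: "'v::euclidean_space \<Rightarrow> complex"
  assumes "integrable lborel G"
  shows "(shift_diff h ^^ k) (\<lambda>\<eta>. \<integral>y. G y * cis ((c - y) \<bullet> \<eta>) \<partial>lborel) \<eta>
       = (\<integral>y. G y * (cis ((c - y) \<bullet> h) - 1) ^ k * cis ((c - y) \<bullet> \<eta>) \<partial>lborel)"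
  using assms
proof (induction k arbitrary: G)
  case 0
  show ?case by simp
next
  case (Suc k)
  have G1: "integrable lborel (\<lambda>y. G y * cis ((c - y) \<bullet> h))"
    by (rule integrable_mult_cis[OF Suc.prems]) measurable
  have G2: "integrable lborel (\<lambda>y. G y * (cis ((c - y) \<bullet> h) - 1))"
    using Bochner_Integration.integrable_diff[OF G1 Suc.prems] by (simp add: algebra_simps)
  have i: "integrable lborel (\<lambda>y. G y * cis ((c - y) \<bullet> \<eta>))" for \<eta>
    by (rule integrable_mult_cis[OF Suc.prems]) measurable
  have 1: "shift_diff h (\<lambda>\<eta>. \<integral>y. G y * cis ((c - y) \<bullet> \<eta>) \<partial>lborel)
      = (\<lambda>\<eta>. \<integral>y. G y * (cis ((c - y) \<bullet> h) - 1) * cis ((c - y) \<bullet> \<eta>) \<partial>lborel)"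
    unfolding shift_diff_def
    by (rule ext, subst Bochner_Integration.integral_diff[OF i i, symmetric])
       (simp add: inner_add_right algebra_simps cis_mult)
  show ?case
    unfolding funpow_Suc_right o_apply 1 Suc.IH[OF G2] by (simp add: mult.assoc)
qed

text \<open>The identity is first known only after \<open>M\<close> differences.  Modulate \<open>F\<close> by a frequency \<open>\<eta>\<close>, and let
  \<open>v \<eta>\<close> and \<open>w \<eta>\<close> be the two sides.  Their \<open>M\<close>-th differences agree by Fubini, because the
  differences of \<open>b\<close> are integrable.  So \<open>v - w\<close> is bounded with vanishing differences, hence
  constant.  Since \<open>b\<close> varies slowly and \<open>\<Phi>\<close> has integral zero, \<open>v\<close> tends to zero at infinity.
  The Gaussian averages of \<open>w\<close> at scale \<open>n\<close> tend to zero because \<open>F\<close> vanishes near \<open>c\<close>.  The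
  constant is therefore zero, and \<open>\<eta> = 0\<close> is the claim.\<close>

proposition fourier_pairing_eq_osc_kernel:
  fixes b F \<Phi> :: "'v::euclidean_space \<Rightarrow> complex"
  assumes b: "b \<in> borel_measurable borel" and bB: "\<And>\<xi>. norm (b \<xi>) \<le> B"
    and slow: "\<And>\<xi>. ((\<lambda>\<eta>. b (\<eta> + \<xi>) - b \<eta>) \<longlongrightarrow> 0) at_infinity"
    and int: "\<And>h. integrable lborel ((shift_diff h ^^ M) b)"
    and F: "integrable lborel F" and van: "\<And>y. norm (c - y) < r \<Longrightarrow> F y = 0" and r: "r > 0"
    and \<Phi>: "\<And>\<xi>. \<Phi> \<xi> = (\<integral>y. F y * cis ((c - y) \<bullet> \<xi>) \<partial>lborel)" and \<Phi>i: "integrable lborel \<Phi>"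
    and KF: "integrable lborel (\<lambda>y. osc_kernel M b (c - y) * F y)"
  shows "(\<integral>\<xi>. b \<xi> * \<Phi> \<xi> \<partial>lborel) = (\<integral>y. osc_kernel M b (c - y) * F y \<partial>lborel)"
proof -
  let ?C = "sqrt (2 * pi) ^ DIM('v)"
  let ?KF = "\<lambda>y. osc_kernel M b (c - y) * F y"
  note [measurable] = b
  have [measurable]: "\<Phi> \<in> borel_measurable borel" "F \<in> borel_measurable borel" "?KF \<in> borel_measurable borel"
    using \<Phi>i F KF by auto
  have B0: "0 \<le> B" using bB[of 0] norm_ge_zero order_trans by blast
  define v where "v \<eta> = (\<integral>\<xi>. b \<xi> * \<Phi> (\<xi> + \<eta>) \<partial>lborel)" for \<eta>
  define w where "w \<eta> = (\<integral>y. ?KF y * cis ((c - y) \<bullet> \<eta>) \<partial>lborel)" for \<eta>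
  define V where "V = B * (\<integral>\<xi>. norm (\<Phi> \<xi>) \<partial>lborel)"
  define W where "W = (\<integral>y. norm (?KF y) \<partial>lborel)"
  have bPhi_i: "integrable lborel (\<lambda>\<xi>. b (\<xi> + s) * \<Phi> \<xi>)" for s
  proof (rule Bochner_Integration.integrable_bound)
    show "integrable lborel (\<lambda>\<xi>. of_real B * \<Phi> \<xi>)" using \<Phi>i by (intro integrable_mult_right)
    show "AE \<xi> in lborel. norm (b (\<xi> + s) * \<Phi> \<xi>) \<le> norm (of_real B * \<Phi> \<xi>)"
      using bB B0 by (intro AE_I2) (simp add: norm_mult mult_right_mono)
  qed measurable
  have v_alt: "v \<eta> = (\<integral>\<xi>. b (\<xi> + - \<eta>) * \<Phi> \<xi> \<partial>lborel)" for \<eta>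
  proof -
    have "v \<eta> = (\<integral>\<xi>. b (\<xi> + - \<eta>) * \<Phi> ((\<xi> + - \<eta>) + \<eta>) \<partial>lborel)"
      unfolding v_def by (rule integral_shift[symmetric]) measurable
    then show ?thesis by simp
  qed
  have v_bound: "norm (v \<eta>) \<le> V" for \<eta>
  proof -
    have "norm (v \<eta>) \<le> (\<integral>\<xi>. norm (b (\<xi> + - \<eta>) * \<Phi> \<xi>) \<partial>lborel)"
      unfolding v_alt by (rule integral_norm_bound)
    also have "\<dots> \<le> (\<integral>\<xi>. B * norm (\<Phi> \<xi>) \<partial>lborel)"
      using bB by (intro integral_mono integrable_norm bPhi_i integrable_mult_right \<Phi>i)
        (auto simp: norm_mult mult_right_mono)
    finally show ?thesis by (simp add: V_def)
  qed
  have w_bound: "norm (w \<eta>) \<le> W" for \<eta>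
  proof -
    have "norm (w \<eta>) \<le> (\<integral>y. norm (?KF y * cis ((c - y) \<bullet> \<eta>)) \<partial>lborel)"
      unfolding w_def by (rule integral_norm_bound)
    then show ?thesis by (simp add: W_def norm_mult)
  qed
  have v_meas [measurable]: "v \<in> borel_measurable borel"
    unfolding v_def[abs_def] by (rule lborel.borel_measurable_lebesgue_integral) measurable
  have w_meas [measurable]: "w \<in> borel_measurable borel"
    unfolding w_def[abs_def] cis_conv_exp
    by (rule lborel.borel_measurable_lebesgue_integral) measurable
  \<comment> \<open>only the differences of \<open>b\<close> are integrable, so Fubini applies after differencing\<close>
  have diff0: "(shift_diff h ^^ M) v \<eta> = (shift_diff h ^^ M) w \<eta>" for h \<eta>
  proof -
    have "(shift_diff h ^^ M) v \<eta> = (\<integral>\<xi>. (shift_diff (- h) ^^ M) b \<xi> * \<Phi> (\<xi> + \<eta>) \<partial>lborel)"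
      unfolding v_def[abs_def] by (rule shift_diff_pow_correlation[OF b bB \<Phi>i])
    also have "\<dots> = (\<integral>\<xi>. (shift_diff (- h) ^^ M) b \<xi> *
        (\<integral>y. (F y * cis ((c - y) \<bullet> \<eta>)) * cis ((c - y) \<bullet> \<xi>) \<partial>lborel) \<partial>lborel)"
      by (simp add: \<Phi> inner_add_right cis_mult[symmetric] mult_ac)
    also have "\<dots> = (\<integral>y. (F y * cis ((c - y) \<bullet> \<eta>)) *
        (\<integral>\<xi>. (shift_diff (- h) ^^ M) b \<xi> * cis ((c - y) \<bullet> \<xi>) \<partial>lborel) \<partial>lborel)"
      by (rule integral_fourier_swap[OF int integrable_mult_cis[OF F]]) measurable
    also have "\<dots> = (\<integral>y. ?KF y * (cis ((c - y) \<bullet> h) - 1) ^ M * cis ((c - y) \<bullet> \<eta>) \<partial>lborel)"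
    proof (rule Bochner_Integration.integral_cong[OF refl])
      fix y
      show "(F y * cis ((c - y) \<bullet> \<eta>)) * (\<integral>\<xi>. (shift_diff (- h) ^^ M) b \<xi> * cis ((c - y) \<bullet> \<xi>) \<partial>lborel)
         = ?KF y * (cis ((c - y) \<bullet> h) - 1) ^ M * cis ((c - y) \<bullet> \<eta>)"
      proof (cases "c - y = 0")
        case True
        then have "F y = 0" using van r by simp
        then show ?thesis by simp
      next
        case False
        show ?thesis by (subst osc_kernel_any_shift[OF int False]) simp
      qed
    qed
    also have "\<dots> = (shift_diff h ^^ M) w \<eta>"
      unfolding w_def[abs_def] by (rule shift_diff_pow_fourier[OF KF, symmetric])
    finally show ?thesis .
  qed
  define u where "u \<eta> = v \<eta> - w \<eta>" for \<eta>
  have u_const: "u \<eta> = u 0" for \<eta>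
  proof -
    have "shift_diff \<eta> u 0 = 0"
    proof (rule bounded_shift_diff_pow_eq_0)
      show "norm (u \<zeta>) \<le> V + W" for \<zeta>
        unfolding u_def using norm_triangle_ineq4[of "v \<zeta>" "w \<zeta>"] v_bound[of \<zeta>] w_bound[of \<zeta>] by linarith
      show "(shift_diff \<eta> ^^ M) u \<zeta> = 0" for \<zeta>
        unfolding u_def[abs_def] by (simp only: shift_diff_pow_diff diff0 diff_self)
    qed
    then show ?thesis by (simp add: shift_diff_def)
  qed
  have v_lim: "(\<lambda>n. v (real (Suc n) *\<^sub>R \<eta>)) \<longlonglongrightarrow> 0" if "\<eta> \<noteq> 0" for \<eta>
  proof -
    have inf: "filterlim (\<lambda>n. - (real (Suc n) *\<^sub>R \<eta>)) at_infinity sequentially"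
    proof -
      have "filterlim (\<lambda>n. norm \<eta> * real (Suc n)) at_top sequentially"
        using that by real_asymp
      then show ?thesis
        by (subst filterlim_at_infinity_conv_norm_at_top) (simp add: mult.commute)
    qed
    have e: "v (real (Suc n) *\<^sub>R \<eta>) = (\<integral>\<xi>. (b (- (real (Suc n) *\<^sub>R \<eta>) + \<xi>) - b (- (real (Suc n) *\<^sub>R \<eta>))) * \<Phi> \<xi> \<partial>lborel)" for n
    proof -
      let ?s = "- (real (Suc n) *\<^sub>R \<eta>)"
      have "(\<integral>\<xi>. (b (?s + \<xi>) - b ?s) * \<Phi> \<xi> \<partial>lborel) = (\<integral>\<xi>. b (\<xi> + ?s) * \<Phi> \<xi> - b ?s * \<Phi> \<xi> \<partial>lborel)"
        by (simp only: left_diff_distrib add.commute)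
      also have "\<dots> = (\<integral>\<xi>. b (\<xi> + ?s) * \<Phi> \<xi> \<partial>lborel) - (\<integral>\<xi>. b ?s * \<Phi> \<xi> \<partial>lborel)"
        by (rule Bochner_Integration.integral_diff[OF bPhi_i]) (intro integrable_mult_right \<Phi>i)
      also have "(\<integral>\<xi>. b ?s * \<Phi> \<xi> \<partial>lborel) = 0"
        using integral_fourier_eq_0[OF F van r \<Phi> \<Phi>i] by simp
      finally show ?thesis by (simp only: v_alt diff_zero)
    qed
    have "(\<lambda>n. \<integral>\<xi>. (b (- (real (Suc n) *\<^sub>R \<eta>) + \<xi>) - b (- (real (Suc n) *\<^sub>R \<eta>))) * \<Phi> \<xi> \<partial>lborel)
        \<longlonglongrightarrow> (\<integral>\<xi>. 0 \<partial>(lborel :: 'v measure))"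
    proof (rule integral_dominated_convergence[where w = "\<lambda>\<xi>. (B + B) * norm (\<Phi> \<xi>)"])
      show "AE \<xi> in lborel. (\<lambda>n. (b (- (real (Suc n) *\<^sub>R \<eta>) + \<xi>) - b (- (real (Suc n) *\<^sub>R \<eta>))) * \<Phi> \<xi>) \<longlonglongrightarrow> 0"
        by (intro AE_I2 tendsto_mult_left_zero filterlim_compose[OF slow inf])
      show "AE \<xi> in lborel. norm ((b (- (real (Suc n) *\<^sub>R \<eta>) + \<xi>) - b (- (real (Suc n) *\<^sub>R \<eta>))) * \<Phi> \<xi>)
          \<le> (B + B) * norm (\<Phi> \<xi>)" for n
        unfolding norm_mult
        by (intro AE_I2 mult_right_mono order_trans[OF norm_triangle_ineq4] add_mono bB) auto
      show "integrable lborel (\<lambda>\<xi>. (B + B) * norm (\<Phi> \<xi>))"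
        using \<Phi>i by (intro integrable_mult_right integrable_norm)
    qed measurable
    then show ?thesis by (simp only: e integral_zero)
  qed
  have gv: "(\<lambda>n. \<integral>\<eta>. gauss \<eta> * v (real (Suc n) *\<^sub>R \<eta>) \<partial>lborel) \<longlonglongrightarrow> (\<integral>\<eta>. 0 \<partial>(lborel :: 'v measure))"
  proof (rule integral_dominated_convergence[where w = "\<lambda>\<eta>. V * gauss \<eta>"])
    show "AE \<eta> in lborel. (\<lambda>n. complex_of_real (gauss \<eta>) * v (real (Suc n) *\<^sub>R \<eta>)) \<longlonglongrightarrow> 0"
      using AE_lborel_singleton[of "0::'v"] by eventually_elim (intro tendsto_mult_right_zero v_lim)
    show "integrable lborel (\<lambda>\<eta>::'v. V * gauss \<eta>)" using integrable_gauss by (intro integrable_mult_right)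
    show "AE \<eta> in lborel. norm (complex_of_real (gauss \<eta>) * v (real (Suc n) *\<^sub>R \<eta>)) \<le> V * gauss \<eta>" for n
      using v_bound by (intro AE_I2) (auto simp: norm_mult abs_of_pos gauss_pos less_imp_le mult.commute[of V] intro!: mult_left_mono)
  qed measurable
  have gw: "(\<lambda>n. \<integral>\<eta>. gauss \<eta> * w (real (Suc n) *\<^sub>R \<eta>) \<partial>lborel) \<longlonglongrightarrow> 0"
  proof (rule Lim_null_comparison)
    have vanK: "\<And>y. norm (c - y) < r \<Longrightarrow> ?KF y = 0" using van by simp
    show "\<forall>\<^sub>F n in sequentially. norm (\<integral>\<eta>. gauss \<eta> * w (real (Suc n) *\<^sub>R \<eta>) \<partial>lborel)
        \<le> ?C * exp (- (real (Suc n) * r)\<^sup>2 / 2) * W"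
      unfolding w_def W_def
      by (intro always_eventually allI gauss_average_fourier[OF KF vanK r]) auto
    have "(\<lambda>n. exp (- (real (Suc n) * r)\<^sup>2 / 2)) \<longlonglongrightarrow> 0" using r by real_asymp
    then have "(\<lambda>n. (?C * W) * exp (- (real (Suc n) * r)\<^sup>2 / 2)) \<longlonglongrightarrow> 0"
      by (rule tendsto_mult_right_zero)
    then show "(\<lambda>n. ?C * exp (- (real (Suc n) * r)\<^sup>2 / 2) * W) \<longlonglongrightarrow> 0" by (simp only: mult_ac)
  qed
  have gi: "integrable lborel (\<lambda>\<eta>. gauss \<eta> * f (real (Suc n) *\<^sub>R \<eta>))"
    if [measurable]: "f \<in> borel_measurable borel" and "\<And>\<eta>. norm (f \<eta>) \<le> A" for f :: "'v \<Rightarrow> complex" and A n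
  proof (rule Bochner_Integration.integrable_bound)
    show "integrable lborel (\<lambda>\<eta>::'v. A * gauss \<eta>)" using integrable_gauss by (intro integrable_mult_right)
    have A: "0 \<le> A" using that(2)[of 0] norm_ge_zero order_trans by blast
    show "AE \<eta> in lborel. norm (complex_of_real (gauss \<eta>) * f (real (Suc n) *\<^sub>R \<eta>)) \<le> norm (A * gauss \<eta>)"
      using that(2) A by (intro AE_I2) (auto simp: norm_mult abs_mult mult.commute[of A] intro!: mult_left_mono)
  qed measurable
  have "(\<lambda>n. u 0 * ?C) \<longlonglongrightarrow> (\<integral>\<eta>. 0 \<partial>(lborel :: 'v measure)) - 0"
  proof (rule Lim_transform_eventually[OF tendsto_diff[OF gv gw]])
    have "(\<integral>\<eta>. gauss \<eta> * v (real (Suc n) *\<^sub>R \<eta>) \<partial>lborel) - (\<integral>\<eta>. gauss \<eta> * w (real (Suc n) *\<^sub>R \<eta>) \<partial>lborel) = u 0 * ?C" for n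
    proof -
      have "(\<integral>\<eta>. gauss \<eta> * v (real (Suc n) *\<^sub>R \<eta>) \<partial>lborel) - (\<integral>\<eta>. gauss \<eta> * w (real (Suc n) *\<^sub>R \<eta>) \<partial>lborel)
         = (\<integral>\<eta>. gauss \<eta> * v (real (Suc n) *\<^sub>R \<eta>) - gauss \<eta> * w (real (Suc n) *\<^sub>R \<eta>) \<partial>lborel)"
        by (rule Bochner_Integration.integral_diff[symmetric, OF gi[OF v_meas v_bound] gi[OF w_meas w_bound]])
      also have "\<dots> = (\<integral>\<eta>. u 0 * (gauss (\<eta>::'v) * cis (0 \<bullet> \<eta>)) \<partial>lborel)"
      proof (rule Bochner_Integration.integral_cong[OF refl])
        fix \<eta> :: 'v
        have "gauss \<eta> * v (real (Suc n) *\<^sub>R \<eta>) - gauss \<eta> * w (real (Suc n) *\<^sub>R \<eta>) = gauss \<eta> * u (real (Suc n) *\<^sub>R \<eta>)"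
          unfolding u_def by (rule right_diff_distrib[symmetric])
        then show "gauss \<eta> * v (real (Suc n) *\<^sub>R \<eta>) - gauss \<eta> * w (real (Suc n) *\<^sub>R \<eta>) = u 0 * (gauss \<eta> * cis (0 \<bullet> \<eta>))"
          by (simp only: u_const[of "real (Suc n) *\<^sub>R \<eta>"]) simp
      qed
      also have "\<dots> = u 0 * ?C"
        unfolding integral_mult_right_zero integral_gauss_cis by (simp add: gauss_def)
      finally show ?thesis .
    qed
    then show "\<forall>\<^sub>F n in sequentially. (\<integral>\<eta>. gauss \<eta> * v (real (Suc n) *\<^sub>R \<eta>) \<partial>lborel)
        - (\<integral>\<eta>. gauss \<eta> * w (real (Suc n) *\<^sub>R \<eta>) \<partial>lborel) = u 0 * ?C"
      by (simp only: eventually_sequentially) blast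
  qed
  then have "u 0 * ?C = 0" by (simp add: LIMSEQ_const_iff)
  then have "v 0 = w 0" by (simp add: u_def)
  then show ?thesis by (simp add: v_def w_def)
qed

section \<open>Symbols with frozen space variable\<close>

lemma iter_partial_slice:
  fixes a :: "'a::euclidean_space \<times> 'b::euclidean_space \<Rightarrow> complex"
  shows "iter_partial bs (\<lambda>\<xi>. a (x, \<xi>)) \<xi> = iter_partial (map (Pair 0) bs) a (x, \<xi>)"
proof (induction bs arbitrary: \<xi>)
  case (Cons b bs)
  have "iter_partial bs (\<lambda>\<xi>. a (x, \<xi>)) = (\<lambda>\<xi>. iter_partial (map (Pair 0) bs) a (x, \<xi>))"
    using Cons.IH by (intro ext)
  then show ?case by (simp add: iter_partial_Cons partial_deriv_def)
qed simp

lemma set_map_Pair_Basis: "set bs \<subseteq> Basis \<Longrightarrow> set (map (Pair 0) bs) \<subseteq> Basis"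
  by (auto simp: Basis_prod_def)

lemma smooth_slice:
  fixes a :: "'a::euclidean_space \<times> 'b::euclidean_space \<Rightarrow> complex"
  assumes "smooth a"
  shows "smooth (\<lambda>\<xi>. a (x, \<xi>))"
  unfolding smooth_def
proof (intro allI impI)
  fix bs :: "'b list" assume "set bs \<subseteq> Basis"
  then have sm: "smooth (iter_partial (map (Pair 0) bs) a)"
    by (intro smooth_iter_partial assms set_map_Pair_Basis)
  have "(\<lambda>\<xi>. iter_partial (map (Pair 0) bs) a (x, \<xi>)) differentiable (at \<xi>)" for \<xi>
  proof -
    have "(iter_partial (map (Pair 0) bs) a \<circ> (\<lambda>\<xi>. (x, \<xi>))) differentiable (at \<xi>)"
      by (rule differentiable_chain_at) (auto intro: smooth_differentiable[OF sm] derivative_intros)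
    then show ?thesis by (simp add: o_def)
  qed
  then show "iter_partial bs (\<lambda>\<xi>. a (x, \<xi>)) differentiable_on UNIV"
    unfolding differentiable_on_def iter_partial_slice[abs_def] by simp
qed

lemma iter_partial_diff:
  fixes f g :: "'v::euclidean_space \<Rightarrow> complex"
  assumes "smooth f" "smooth g" "set bs \<subseteq> Basis"
  shows "iter_partial bs (\<lambda>\<xi>. f \<xi> - g \<xi>) = (\<lambda>\<xi>. iter_partial bs f \<xi> - iter_partial bs g \<xi>)"
  using assms(3)
proof (induction bs)
  case (Cons b bs)
  show ?case
  proof (rule ext)
    fix \<xi>
    have d: "(\<lambda>t. iter_partial bs k (\<xi> + t *\<^sub>R b)) differentiable (at 0)" if "smooth k" for k :: "'v \<Rightarrow> complex"
      using differentiable_line_derivative[of "iter_partial bs k" \<xi> 0 b] smooth_differentiable[OF smooth_iter_partial[OF that]]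
        Cons.prems differentiableI_vector by fastforce
    show "iter_partial (b # bs) (\<lambda>\<xi>. f \<xi> - g \<xi>) \<xi> = iter_partial (b # bs) f \<xi> - iter_partial (b # bs) g \<xi>"
      using Cons by (simp add: iter_partial_Cons partial_deriv_def vector_derivative_diff_at d assms(1,2))
  qed
qed simp

lemma smooth_diff:
  fixes f g :: "'v::euclidean_space \<Rightarrow> complex"
  assumes "smooth f" "smooth g"
  shows "smooth (\<lambda>\<xi>. f \<xi> - g \<xi>)"
  unfolding smooth_def
proof (intro allI impI)
  fix bs :: "'v list" assume bs: "set bs \<subseteq> Basis"
  show "iter_partial bs (\<lambda>\<xi>. f \<xi> - g \<xi>) differentiable_on UNIV"
    unfolding iter_partial_diff[OF assms bs]
    using assms bs by (intro differentiable_on_diff) (auto simp: smooth_def)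
qed

text \<open>The exponents in \<open>symbol_class\<close> depend on the multi-index only through its total orders in
  \<open>x\<close> and in \<open>\<xi>\<close>.\<close>

definition x_order :: "((real^'n) \<times> (real^'n^'m)) list \<Rightarrow> nat" where
  "x_order cs = (\<Sum>i\<in>UNIV. count_list cs (axis i 1, 0))"

definition \<xi>_order :: "((real^'n) \<times> (real^'n^'m)) list \<Rightarrow> nat" where
  "\<xi>_order cs = (\<Sum>j\<in>UNIV. \<Sum>i\<in>UNIV. count_list cs (0, axis j (axis i 1)))"

lemma x_order_plus_\<xi>_order:
  fixes cs :: "((real^'n) \<times> (real^'n^'m)) list"
  assumes "set cs \<subseteq> Basis"
  shows "x_order cs + \<xi>_order cs = length cs"
proof -
  have B1: "bij_betw (\<lambda>i::'n. axis i (1::real)) UNIV Basis"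
    by (auto simp: bij_betw_def inj_on_def axis_eq_axis Basis_vec_def)
  have B2: "bij_betw (\<lambda>(j::'m, b::real^'n). axis j b) (UNIV \<times> Basis) Basis"
    by (auto simp: bij_betw_def inj_on_def axis_eq_axis Basis_vec_def image_def nonzero_Basis)
  have "length cs = (\<Sum>b\<in>Basis. count_list cs b)"
    by (rule sum_count_set[symmetric, OF assms]) simp
  also have "\<dots> = (\<Sum>b\<in>(\<lambda>u. (u, 0)) ` (Basis :: (real^'n) set). count_list cs b)
      + (\<Sum>b\<in>(\<lambda>v. (0, v)) ` (Basis :: (real^'n^'m) set). count_list cs b)"
    unfolding Basis_prod_def by (rule sum.union_disjoint) (auto simp: nonzero_Basis)
  also have "(\<Sum>b\<in>(\<lambda>u. (u, 0)) ` (Basis :: (real^'n) set). count_list cs b) = (\<Sum>u\<in>Basis. count_list cs (u, 0))"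
    by (subst sum.reindex) (auto simp: inj_on_def)
  also have "\<dots> = x_order cs"
    unfolding x_order_def by (rule sum.reindex_bij_betw[OF B1, symmetric])
  also have "(\<Sum>b\<in>(\<lambda>v. (0, v)) ` (Basis :: (real^'n^'m) set). count_list cs b) = (\<Sum>v\<in>Basis. count_list cs (0, v))"
    by (subst sum.reindex) (auto simp: inj_on_def)
  also have "\<dots> = (\<Sum>(j,b)\<in>UNIV \<times> Basis. count_list cs (0, axis j b))"
    using sum.reindex_bij_betw[OF B2, of "\<lambda>v. count_list cs (0, v)", symmetric] by (simp add: case_prod_beta)
  also have "\<dots> = (\<Sum>j\<in>UNIV. \<Sum>b\<in>Basis. count_list cs (0, axis j b))"
    by (rule sum.cartesian_product[symmetric])
  also have "\<dots> = \<xi>_order cs"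
    unfolding \<xi>_order_def by (intro sum.cong refl sum.reindex_bij_betw[OF B1, symmetric])
  finally show ?thesis ..
qed

lemma x_order_map_Pair: "x_order (map (Pair 0) bs) = 0"
  by (auto simp: x_order_def count_list_0_iff axis_eq_0_iff)

lemma x_order_Cons_le:
  fixes b :: "(real^'n) \<times> (real^'n^'m)"
  shows "x_order (b # map (Pair 0) bs) \<le> 1"
proof -
  have z: "count_list (map (Pair (0::real^'n)) bs) (axis i 1, 0) = 0" for i
    by (auto simp: count_list_0_iff axis_eq_0_iff)
  let ?S = "{i. b = (axis i 1, 0)}"
  have "x_order (b # map (Pair 0) bs) = (\<Sum>i\<in>UNIV. if i \<in> ?S then 1 else 0)"
    unfolding x_order_def by (intro sum.cong refl) (simp add: z)
  also have "\<dots> = card ?S"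
    by (subst sum.inter_restrict[symmetric]) simp_all
  also have "card ?S \<le> Suc 0"
  proof (subst card_le_Suc0_iff_eq)
    show "\<forall>i\<in>?S. \<forall>i'\<in>?S. i = i'" by (clarsimp simp: axis_eq_axis)
  qed simp
  finally show ?thesis by simp
qed

text \<open>There are finitely many lists of directions of a given length, so that one constant serves them
  all.\<close>

lemma symbol_class_uniform_bound:
  fixes a :: "(real^'n) \<times> (real^'n^'m) \<Rightarrow> complex"
  assumes a: "a \<in> symbol_class l \<rho> \<delta>"
  shows "\<exists>C\<ge>0. \<forall>cs x \<xi>. set cs \<subseteq> Basis \<longrightarrow> length cs = L \<longrightarrow>
     norm (iter_partial cs a (x, \<xi>)) \<le> C * (1 + (\<Sum>j\<in>UNIV. norm (\<xi> $ j))) powr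
        (l + \<delta> * real (x_order cs) - \<rho> * real (\<xi>_order cs))"
proof -
  let ?w = "\<lambda>cs \<xi>. (1 + (\<Sum>j\<in>UNIV. norm (\<xi> $ j))) powr (l + \<delta> * real (x_order cs) - \<rho> * real (\<xi>_order cs))"
  let ?S = "{cs :: ((real^'n) \<times> (real^'n^'m)) list. set cs \<subseteq> Basis \<and> length cs = L}"
  have fin: "finite ?S" by (rule finite_lists_length_eq) simp
  have "\<forall>cs\<in>?S. \<exists>C. \<forall>x \<xi>. norm (iter_partial cs a (x, \<xi>)) \<le> C * ?w cs \<xi>"
  proof
    fix cs assume "cs \<in> ?S"
    let ?\<alpha> = "\<lambda>i. count_list cs (axis i 1, 0)" and ?\<beta> = "\<lambda>j i. count_list cs (0, axis j (axis i 1))"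
    have r: "realises_multi_index cs ?\<alpha> ?\<beta>" using \<open>cs \<in> ?S\<close> by (simp add: realises_multi_index_def)
    have "\<exists>C. \<forall>bs. realises_multi_index bs ?\<alpha> ?\<beta> \<longrightarrow>
        (\<forall>x \<xi>. norm (iter_partial bs a (x, \<xi>)) \<le>
           C * (1 + (\<Sum>j\<in>UNIV. norm (\<xi> $ j))) powr
             (l + \<delta> * real (\<Sum>i\<in>UNIV. ?\<alpha> i) - \<rho> * real (\<Sum>j\<in>UNIV. \<Sum>i\<in>UNIV. ?\<beta> j i)))"
      using a unfolding symbol_class_def by (elim CollectE conjE allE)
    then obtain C where "\<forall>bs. realises_multi_index bs ?\<alpha> ?\<beta> \<longrightarrow>
        (\<forall>x \<xi>. norm (iter_partial bs a (x, \<xi>)) \<le>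
           C * (1 + (\<Sum>j\<in>UNIV. norm (\<xi> $ j))) powr
             (l + \<delta> * real (\<Sum>i\<in>UNIV. ?\<alpha> i) - \<rho> * real (\<Sum>j\<in>UNIV. \<Sum>i\<in>UNIV. ?\<beta> j i)))" ..
    from this[THEN spec, THEN mp, OF r]
    show "\<exists>C. \<forall>x \<xi>. norm (iter_partial cs a (x, \<xi>)) \<le> C * ?w cs \<xi>"
      unfolding x_order_def \<xi>_order_def by (rule exI)
  qed
  from bchoice[OF this] obtain C where
    C': "\<forall>cs\<in>?S. \<forall>x \<xi>. norm (iter_partial cs a (x, \<xi>)) \<le> C cs * ?w cs \<xi>" ..
  have C: "norm (iter_partial cs a (x, \<xi>)) \<le> C cs * ?w cs \<xi>" if "cs \<in> ?S" for cs x \<xi>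
    using C'[THEN bspec, OF that] by (elim allE)
  show ?thesis
  proof (intro exI[of _ "\<Sum>cs\<in>?S. \<bar>C cs\<bar>"] conjI allI impI)
    show "0 \<le> (\<Sum>cs\<in>?S. \<bar>C cs\<bar>)" by (intro sum_nonneg) auto
    fix cs :: "((real^'n) \<times> (real^'n^'m)) list" and x :: "real^'n" and \<xi> :: "real^'n^'m"
    assume "set cs \<subseteq> Basis" "length cs = L"
    then have cs: "cs \<in> ?S" by simp
    have "C cs \<le> \<bar>C cs\<bar>" by simp
    also have "\<dots> \<le> (\<Sum>cs\<in>?S. \<bar>C cs\<bar>)" by (rule member_le_sum[OF cs _ fin]) simp
    finally have "C cs * ?w cs \<xi> \<le> (\<Sum>cs\<in>?S. \<bar>C cs\<bar>) * ?w cs \<xi>" by (intro mult_right_mono) auto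
    with C[OF cs, of x \<xi>] show "norm (iter_partial cs a (x, \<xi>)) \<le> (\<Sum>cs\<in>?S. \<bar>C cs\<bar>) * ?w cs \<xi>" by linarith
  qed
qed

lemma norm_vec_le_sum: "norm \<xi> \<le> (\<Sum>j\<in>UNIV. norm (\<xi> $ j))" for \<xi> :: "'e::euclidean_space^'m"
  unfolding norm_vec_def by (rule L2_set_le_sum) simp

lemma sum_norm_vec_le: "(\<Sum>j\<in>UNIV. norm (\<xi> $ j)) \<le> real CARD('m) * norm \<xi>" for \<xi> :: "'e::euclidean_space^'m"
  using sum_bounded_above[of UNIV "\<lambda>j. norm (\<xi> $ j)" "norm \<xi>"] Finite_Cartesian_Product.norm_nth_le[of \<xi>] by simp

lemma powr_minus_le_inverse_power:
  fixes s t :: real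
  assumes "1 \<le> t" "t \<le> s" "e \<le> - real q"
  shows "s powr e \<le> 1 / t ^ q"
proof -
  have "s powr e \<le> s powr (- real q)" using assms by (intro powr_mono) auto
  also have "\<dots> = 1 / s ^ q" using assms by (simp add: powr_minus powr_realpow divide_inverse)
  also have "\<dots> \<le> 1 / t ^ q" using assms by (intro divide_left_mono power_mono) auto
  finally show ?thesis .
qed

lemma symbol_slice_bound:
  fixes a :: "(real^'n) \<times> (real^'n^'m) \<Rightarrow> complex"
  assumes a: "a \<in> symbol_class 0 1 \<delta>"
  shows "\<exists>A. \<forall>x. symbol_bound A 0 q (\<lambda>\<xi>. a (x, \<xi>))"
proof -
  have sm: "smooth a" using a by (simp add: symbol_class_def)
  obtain C0 where C0: "C0 \<ge> 0" and E0: "\<And>cs x \<xi>. set cs \<subseteq> Basis \<Longrightarrow> length cs = 0 \<Longrightarrow>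
     norm (iter_partial cs a (x, \<xi>)) \<le> C0 * (1 + (\<Sum>j\<in>UNIV. norm (\<xi> $ j))) powr (0 + \<delta> * real (x_order cs) - 1 * real (\<xi>_order cs))"
    using symbol_class_uniform_bound[OF a, of 0] by blast
  obtain C1 where C1: "C1 \<ge> 0" and E1: "\<And>cs x \<xi>. set cs \<subseteq> Basis \<Longrightarrow> length cs = q \<Longrightarrow>
     norm (iter_partial cs a (x, \<xi>)) \<le> C1 * (1 + (\<Sum>j\<in>UNIV. norm (\<xi> $ j))) powr (0 + \<delta> * real (x_order cs) - 1 * real (\<xi>_order cs))"
    using symbol_class_uniform_bound[OF a, of q] by blast
  show ?thesis
  proof (intro exI[of _ "C0 + C1"] allI)
    fix x
    show "symbol_bound (C0 + C1) 0 q (\<lambda>\<xi>. a (x, \<xi>))"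
      unfolding symbol_bound_def
    proof (intro conjI allI impI)
      show "smooth (\<lambda>\<xi>. a (x, \<xi>))" by (rule smooth_slice[OF sm])
      fix \<xi> :: "real^'n^'m"
      have pos: "0 < 1 + (\<Sum>j\<in>UNIV. norm (\<xi> $ j))" by (intro add_pos_nonneg sum_nonneg) auto
      have le: "1 + norm \<xi> \<le> 1 + (\<Sum>j\<in>UNIV. norm (\<xi> $ j))" using norm_vec_le_sum[of \<xi>] by simp
      have "norm (a (x, \<xi>)) \<le> C0"
        using E0[of "[]" x \<xi>] pos by (simp add: x_order_def \<xi>_order_def)
      then show "norm (a (x, \<xi>)) \<le> (C0 + C1) * (1 + norm \<xi>) ^ 0" using C1 by simp
      fix bs :: "(real^'n^'m) list"
      assume bs: "set bs \<subseteq> Basis" "length bs = q + 0"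
      let ?cs = "map (Pair (0::real^'n)) bs"
      have cs: "set ?cs \<subseteq> Basis" "length ?cs = q" using bs set_map_Pair_Basis[OF bs(1)] by auto
      have o: "x_order ?cs = 0" "\<xi>_order ?cs = q"
        using x_order_map_Pair[of bs] x_order_plus_\<xi>_order[OF cs(1)] cs(2) by simp_all
      have "norm (iter_partial bs (\<lambda>\<xi>. a (x, \<xi>)) \<xi>) \<le> C1 * (1 + (\<Sum>j\<in>UNIV. norm (\<xi> $ j))) powr (- real q)"
        using E1[OF cs, of x \<xi>] unfolding iter_partial_slice o by simp
      also have "\<dots> \<le> C1 * (1 / (1 + norm \<xi>) ^ q)"
        by (intro mult_left_mono powr_minus_le_inverse_power le C1) auto
      also have "\<dots> \<le> (C0 + C1) * (1 / (1 + norm \<xi>) ^ q)"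
        using C0 by (intro mult_right_mono) auto
      finally show "norm (iter_partial bs (\<lambda>\<xi>. a (x, \<xi>)) \<xi>) \<le> (C0 + C1) / (1 + norm \<xi>) ^ q" by simp
    qed
  qed
qed

text \<open>By the mean value theorem in \<open>x\<close>, the increment is controlled by one derivative more.  In the worst
  case that derivative is in \<open>x\<close> and raises the order by \<open>\<delta> \<le> 1\<close>.\<close>

lemma symbol_slice_difference_bound:
  fixes a :: "(real^'n) \<times> (real^'n^'m) \<Rightarrow> complex"
  assumes a: "a \<in> symbol_class 0 1 \<delta>" and \<delta>: "\<delta> \<le> 1"
  shows "\<exists>A\<ge>0. \<forall>x x'. symbol_bound (A * norm (x - x')) 1 q (\<lambda>\<xi>. a (x, \<xi>) - a (x', \<xi>))"
proof -
  let ?s = "\<lambda>\<xi>::real^'n^'m. 1 + (\<Sum>j\<in>UNIV. norm (\<xi> $ j))"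
  let ?D = "real DIM((real^'n) \<times> (real^'n^'m))"
  have sm: "smooth a" using a by (simp add: symbol_class_def)
  have s1: "1 \<le> ?s \<xi>" for \<xi> by (simp add: sum_nonneg)
  have key: "\<exists>C\<ge>0. \<forall>bs x x' \<xi>. set bs \<subseteq> Basis \<longrightarrow> length bs = k \<longrightarrow>
      norm (iter_partial bs (\<lambda>\<xi>. a (x, \<xi>) - a (x', \<xi>)) \<xi>) \<le> C * norm (x - x') * ?s \<xi> powr (1 - real k)" for k
  proof -
    obtain C where C: "C \<ge> 0" and E: "\<And>cs x \<xi>. set cs \<subseteq> Basis \<Longrightarrow> length cs = Suc k \<Longrightarrow>
       norm (iter_partial cs a (x, \<xi>)) \<le> C * ?s \<xi> powr (0 + \<delta> * real (x_order cs) - 1 * real (\<xi>_order cs))"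
      using symbol_class_uniform_bound[OF a, of "Suc k"] by blast
    have "norm (iter_partial bs (\<lambda>\<xi>. a (x, \<xi>) - a (x', \<xi>)) \<xi>) \<le> (C * ?D) * norm (x - x') * ?s \<xi> powr (1 - real k)"
      if bs: "set bs \<subseteq> Basis" "length bs = k" for bs x x' \<xi>
    proof -
      let ?cs = "map (Pair (0::real^'n)) bs"
      let ?g = "iter_partial ?cs a"
      let ?h = "(x - x', 0) :: (real^'n) \<times> (real^'n^'m)"
      have cs: "set ?cs \<subseteq> Basis" by (rule set_map_Pair_Basis[OF bs(1)])
      have "norm ((shift_diff ?h ^^ 1) ?g (x', \<xi>)) \<le> (C * ?s \<xi> powr (1 - real k)) * (?D * norm ?h) ^ 1"
      proof (rule norm_shift_diff_pow_le_derivs[OF smooth_iter_partial[OF sm cs]])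
        fix ds :: "((real^'n) \<times> (real^'n^'m)) list" and t :: real
        assume ds: "set ds \<subseteq> Basis" "length ds = 1"
        then obtain b where b: "ds = [b]" "b \<in> Basis" by (cases ds) auto
        let ?ds = "b # ?cs"
        have d: "set ?ds \<subseteq> Basis" "length ?ds = Suc k" using b cs bs by auto
        have "x_order ?ds \<le> 1" "x_order ?ds + \<xi>_order ?ds = Suc k"
          using x_order_Cons_le[of b bs] x_order_plus_\<xi>_order[OF d(1)] d(2) by simp_all
        then have "(x_order ?ds = 0 \<and> \<xi>_order ?ds = Suc k) \<or> (x_order ?ds = 1 \<and> \<xi>_order ?ds = k)" by linarith
        then have e: "0 + \<delta> * real (x_order ?ds) - 1 * real (\<xi>_order ?ds) \<le> 1 - real k"
          using \<delta> by auto
        have "(x', \<xi>) + t *\<^sub>R ?h = (x' + t *\<^sub>R (x - x'), \<xi>)" by simp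
        moreover have "iter_partial ds ?g = iter_partial ?ds a" by (simp add: b iter_partial_Cons)
        ultimately have "norm (iter_partial ds ?g ((x', \<xi>) + t *\<^sub>R ?h))
            \<le> C * ?s \<xi> powr (0 + \<delta> * real (x_order ?ds) - 1 * real (\<xi>_order ?ds))"
          using E[OF d, of "x' + t *\<^sub>R (x - x')" \<xi>] by (simp only:)
        also have "\<dots> \<le> C * ?s \<xi> powr (1 - real k)"
          by (intro mult_left_mono powr_mono e s1 C)
        finally show "norm (iter_partial ds ?g ((x', \<xi>) + t *\<^sub>R ?h)) \<le> C * ?s \<xi> powr (1 - real k)" .
      qed
      moreover have "(shift_diff ?h ^^ 1) ?g (x', \<xi>) = ?g (x, \<xi>) - ?g (x', \<xi>)"
        by (simp add: shift_diff_def)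
      moreover have "iter_partial bs (\<lambda>\<xi>. a (x, \<xi>) - a (x', \<xi>)) \<xi> = ?g (x, \<xi>) - ?g (x', \<xi>)"
        by (subst iter_partial_diff[OF smooth_slice[OF sm] smooth_slice[OF sm] bs(1)]) (simp only: iter_partial_slice)
      ultimately show ?thesis by (simp add: norm_Pair mult_ac)
    qed
    then show ?thesis using C by (intro exI[of _ "C * ?D"]) auto
  qed
  obtain C0 where C0: "C0 \<ge> 0" and E0: "\<And>bs x x' \<xi>. set bs \<subseteq> Basis \<Longrightarrow> length bs = 0 \<Longrightarrow>
      norm (iter_partial bs (\<lambda>\<xi>. a (x, \<xi>) - a (x', \<xi>)) \<xi>) \<le> C0 * norm (x - x') * ?s \<xi> powr (1 - real 0)"
    using key[of 0] by blast
  obtain C1 where C1: "C1 \<ge> 0" and E1: "\<And>bs x x' \<xi>. set bs \<subseteq> Basis \<Longrightarrow> length bs = q + 1 \<Longrightarrow>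
      norm (iter_partial bs (\<lambda>\<xi>. a (x, \<xi>) - a (x', \<xi>)) \<xi>) \<le> C1 * norm (x - x') * ?s \<xi> powr (1 - real (q + 1))"
    using key[of "q + 1"] by blast
  let ?m = "real CARD('m)"
  have m: "1 \<le> ?m" by (simp add: Suc_leI)
  show ?thesis
  proof (intro exI[of _ "C0 * ?m + C1"] conjI[of "_ \<le> _"] allI)
    show "0 \<le> C0 * ?m + C1" using C0 C1 by simp
    fix x x'
    show "symbol_bound ((C0 * ?m + C1) * norm (x - x')) 1 q (\<lambda>\<xi>. a (x, \<xi>) - a (x', \<xi>))"
      unfolding symbol_bound_def
    proof (intro conjI allI impI)
      show "smooth (\<lambda>\<xi>. a (x, \<xi>) - a (x', \<xi>))" by (intro smooth_diff smooth_slice sm)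
      fix \<xi> :: "real^'n^'m"
      have sm': "?s \<xi> \<le> ?m * (1 + norm \<xi>)"
        unfolding distrib_left mult_1_right using m sum_norm_vec_le[of \<xi>] by (rule add_mono)
      have "norm (a (x, \<xi>) - a (x', \<xi>)) \<le> C0 * norm (x - x') * ?s \<xi>"
        using E0[of "[]" x x' \<xi>] s1[of \<xi>] by simp
      also have "\<dots> \<le> C0 * norm (x - x') * (?m * (1 + norm \<xi>))"
        using C0 by (intro mult_left_mono sm') simp
      also have "\<dots> = C0 * ?m * norm (x - x') * (1 + norm \<xi>)" by simp
      also have "\<dots> \<le> (C0 * ?m + C1) * norm (x - x') * (1 + norm \<xi>)"
        using C1 by (intro mult_right_mono) auto
      finally show "norm (a (x, \<xi>) - a (x', \<xi>)) \<le> (C0 * ?m + C1) * norm (x - x') * (1 + norm \<xi>) ^ 1" by simp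
      fix bs :: "(real^'n^'m) list"
      assume bs: "set bs \<subseteq> Basis" "length bs = q + 1"
      have "norm (iter_partial bs (\<lambda>\<xi>. a (x, \<xi>) - a (x', \<xi>)) \<xi>) \<le> C1 * norm (x - x') * ?s \<xi> powr (1 - real (q + 1))"
        by (rule E1[OF bs])
      also have "\<dots> \<le> C1 * norm (x - x') * (1 / (1 + norm \<xi>) ^ q)"
        using norm_vec_le_sum[of \<xi>] C1 by (intro mult_left_mono powr_minus_le_inverse_power) auto
      also have "\<dots> \<le> (C0 * ?m + C1) * norm (x - x') * (1 / (1 + norm \<xi>) ^ q)"
        using C0 by (intro mult_right_mono) auto
      finally show "norm (iter_partial bs (\<lambda>\<xi>. a (x, \<xi>) - a (x', \<xi>)) \<xi>) \<le> (C0 * ?m + C1) * norm (x - x') / (1 + norm \<xi>) ^ q"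
        by simp
    qed
  qed
qed

section \<open>Fourier transforms of Schwartz functions\<close>

text \<open>A Schwartz function is in particular a symbol of order \<open>0\<close>, which makes the bounds for
  oscillatory integrals available for Fourier transforms.\<close>

lemma schwartz_symbol_bound:
  fixes f :: "'v::euclidean_space \<Rightarrow> complex"
  assumes "schwartz f"
  obtains A where "symbol_bound A 0 q f"
proof -
  have sm: "smooth f" using assms by (simp add: schwartz_def)
  let ?S = "{bs :: 'v list. set bs \<subseteq> Basis \<and> length bs = q}"
  have fin: "finite ?S" by (rule finite_lists_length_eq) simp
  have "\<forall>bs\<in>?S. \<exists>C. \<forall>x. (1 + norm x) ^ q * norm (iter_partial bs f x) \<le> C"
    using assms unfolding schwartz_def by blast
  from bchoice[OF this] obtain C where
    C: "\<And>bs x. bs \<in> ?S \<Longrightarrow> (1 + norm x) ^ q * norm (iter_partial bs f x) \<le> C bs" by blast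
  have "set ([] :: 'v list) \<subseteq> Basis" by simp
  then have "\<exists>C. \<forall>x. (1 + norm x) ^ 0 * norm (iter_partial [] f x) \<le> C"
    using assms unfolding schwartz_def by blast
  then obtain C0 where C0: "\<And>x. norm (f x) \<le> C0" by auto
  have C00: "0 \<le> C0" using C0[of 0] norm_ge_zero order_trans by blast
  have "symbol_bound (C0 + (\<Sum>bs\<in>?S. \<bar>C bs\<bar>)) 0 q f"
    unfolding symbol_bound_def
  proof (intro conjI allI impI sm)
    fix \<xi>
    have "0 \<le> (\<Sum>bs\<in>?S. \<bar>C bs\<bar>)" by (intro sum_nonneg) auto
    then show "norm (f \<xi>) \<le> (C0 + (\<Sum>bs\<in>?S. \<bar>C bs\<bar>)) * (1 + norm \<xi>) ^ 0"
      unfolding power_0 mult_1_right using C0[of \<xi>] by linarith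
    fix bs :: "'v list" assume "set bs \<subseteq> Basis" "length bs = q + 0"
    then have bs: "bs \<in> ?S" by simp
    have "(1 + norm \<xi>) ^ q * norm (iter_partial bs f \<xi>) \<le> \<bar>C bs\<bar>" using C[OF bs, of \<xi>] by linarith
    also have "\<dots> \<le> (\<Sum>bs\<in>?S. \<bar>C bs\<bar>)" by (rule member_le_sum[OF bs _ fin]) simp
    finally have "norm (iter_partial bs f \<xi>) * (1 + norm \<xi>) ^ q \<le> C0 + (\<Sum>bs\<in>?S. \<bar>C bs\<bar>)" using C00 by (simp add: mult.commute)
    then show "norm (iter_partial bs f \<xi>) \<le> (C0 + (\<Sum>bs\<in>?S. \<bar>C bs\<bar>)) / (1 + norm \<xi>) ^ q"
      by (subst pos_le_divide_eq) (auto intro!: zero_less_power add_pos_nonneg)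
  qed
  then show ?thesis by (rule that)
qed

lemma schwartz_integrable:
  fixes f :: "'v::euclidean_space \<Rightarrow> complex"
  assumes "schwartz f"
  shows "integrable lborel f"
proof -
  let ?k = "2 * DIM('v)"
  have sm: "smooth f" using assms by (simp add: schwartz_def)
  have "set ([] :: 'v list) \<subseteq> Basis" by simp
  then have "\<exists>C. \<forall>x. (1 + norm x) ^ ?k * norm (iter_partial [] f x) \<le> C"
    using assms unfolding schwartz_def by blast
  then obtain C where C: "\<And>x. (1 + norm x) ^ ?k * norm (f x) \<le> C" by auto
  show ?thesis
  proof (rule Bochner_Integration.integrable_bound)
    show "integrable lborel (\<lambda>x::'v. C * (1 / (1 + norm x) ^ ?k))"
      by (intro integrable_mult_right integrable_weight) auto
    show "f \<in> borel_measurable lborel" using smooth_borel_measurable[OF sm] by simp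
    show "AE x in lborel. norm (f x) \<le> norm (C * (1 / (1 + norm x) ^ ?k))"
    proof (rule AE_I2)
      fix x :: 'v
      have "norm (f x) \<le> C / (1 + norm x) ^ ?k"
        using C[of x] by (subst pos_le_divide_eq) (auto intro!: zero_less_power add_pos_nonneg simp: mult.commute)
      then show "norm (f x) \<le> norm (C * (1 / (1 + norm x) ^ ?k))"
        unfolding real_norm_def by (simp add: abs_if)
    qed
  qed
qed

text \<open>For an integrable function the oscillatory integral is the Fourier integral itself, so its size
  estimate is the rapid decay of the Fourier transform.\<close>

lemma schwartz_fourier_integrable:
  fixes f :: "real^'n \<Rightarrow> complex"
  assumes f: "schwartz f"
  shows "integrable lborel (fourier f)"
proof -
  let ?D = "DIM(real^'n)"
  define q where "q = 2 * ?D + 1"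
  have fi: "integrable lborel f" by (rule schwartz_integrable[OF f])
  have [measurable]: "f \<in> borel_measurable borel" using fi by auto
  obtain A where A: "symbol_bound A 0 q f" by (rule schwartz_symbol_bound[OF f])
  obtain C where C: "C \<ge> 0" and E: "\<And>A (b :: real^'n \<Rightarrow> complex) z. symbol_bound A 0 q b \<Longrightarrow>
       norm (osc_kernel q b z) \<le> C * A * (pi / norm z) ^ q * max 1 (pi / norm z) ^ ?D / max 1 (pi / norm z) ^ q"
    using osc_kernel_size[of q, where 'v = "real^'n"] unfolding q_def by blast
  have CA: "0 \<le> C * A" using C symbol_bound_nonneg[OF A] by simp
  have fou: "fourier f \<xi> = (\<integral>x. f x * cis ((- \<xi>) \<bullet> x) \<partial>lborel)" for \<xi>
    by (simp add: fourier_def inner_commute)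
  let ?I = "\<integral>x. norm (f x) \<partial>lborel"
  have I0: "0 \<le> ?I" by simp
  have bound0: "norm (fourier f \<xi>) \<le> ?I" for \<xi>
    unfolding fou using integral_norm_bound[of lborel "\<lambda>x. f x * cis ((- \<xi>) \<bullet> x)"] by (simp add: norm_mult)
  \<comment> \<open>here the half period has length at most \<open>1\<close>, so the maxima in the size estimate are \<open>1\<close>\<close>
  have bound1: "norm (fourier f \<xi>) \<le> C * A * (pi / norm \<xi>) ^ q" if "pi \<le> norm \<xi>" for \<xi>
  proof -
    have z: "- \<xi> \<noteq> 0" using that pi_gt3 by auto
    have "osc_kernel q f (- \<xi>) = fourier f \<xi>"
      unfolding osc_kernel_def integral_shift_diff_pow_cis[OF fi] cis_half_period[OF z] fou by simp
    moreover have "max 1 (pi / norm (- \<xi>)) = 1" using that pi_gt_zero by (simp add: divide_le_eq)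
    ultimately show ?thesis using E[OF A, of "- \<xi>"] by simp
  qed
  have bound: "norm (fourier f \<xi>) \<le> ((1 + pi) ^ q * ?I + C * A * (2 * pi) ^ q) * (1 / (1 + norm \<xi>) ^ q)" for \<xi>
  proof -
    have pi_pow: "0 \<le> (1 + pi) ^ q" and pi_pow': "0 \<le> (2 * pi) ^ q" by simp_all
    have pos: "0 < (1 + norm \<xi>) ^ q" by (intro zero_less_power add_pos_nonneg) auto
    have "norm (fourier f \<xi>) * (1 + norm \<xi>) ^ q \<le> (1 + pi) ^ q * ?I + C * A * (2 * pi) ^ q"
    proof (cases "pi \<le> norm \<xi>")
      case True
      have n0: "norm \<xi> > 0" using True pi_gt_zero by linarith
      have "norm (fourier f \<xi>) * (1 + norm \<xi>) ^ q \<le> (C * A * (pi / norm \<xi>) ^ q) * (2 * norm \<xi>) ^ q"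
        using True pi_gt3 CA by (intro mult_mono bound1 power_mono) auto
      also have "\<dots> = C * A * (2 * pi) ^ q"
        using n0 by (simp add: power_divide power_mult_distrib)
      also have "\<dots> \<le> (1 + pi) ^ q * ?I + C * A * (2 * pi) ^ q"
        by (rule le_add_same_cancel2[THEN iffD2, OF mult_nonneg_nonneg[OF pi_pow I0]])
      finally show ?thesis .
    next
      case False
      have "norm (fourier f \<xi>) * (1 + norm \<xi>) ^ q \<le> ?I * (1 + pi) ^ q"
        using False by (intro mult_mono bound0 power_mono) auto
      also have "\<dots> = (1 + pi) ^ q * ?I" by (rule mult.commute)
      also have "\<dots> \<le> (1 + pi) ^ q * ?I + C * A * (2 * pi) ^ q"
        by (rule le_add_same_cancel1[THEN iffD2, OF mult_nonneg_nonneg[OF CA pi_pow']])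
      finally show ?thesis .
    qed
    then have "norm (fourier f \<xi>) \<le> ((1 + pi) ^ q * ?I + C * A * (2 * pi) ^ q) / (1 + norm \<xi>) ^ q"
      by (rule pos_le_divide_eq[OF pos, THEN iffD2])
    then show ?thesis by simp
  qed
  show ?thesis
  proof (rule Bochner_Integration.integrable_bound)
    show "integrable lborel (\<lambda>\<xi>::real^'n. ((1 + pi) ^ q * ?I + C * A * (2 * pi) ^ q) * (1 / (1 + norm \<xi>) ^ q))"
      by (intro integrable_mult_right integrable_weight) (auto simp: q_def)
    have "fourier f \<in> borel_measurable borel"
      unfolding fourier_def[abs_def] cis_conv_exp
      by (rule lborel.borel_measurable_lebesgue_integral) measurable
    then show "fourier f \<in> borel_measurable lborel" by simp
    show "AE \<xi> in lborel. norm (fourier f \<xi>) \<le> norm (((1 + pi) ^ q * ?I + C * A * (2 * pi) ^ q) * (1 / (1 + norm \<xi>) ^ q))"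
    proof (rule AE_I2)
      fix \<xi> :: "real^'n"
      show "norm (fourier f \<xi>) \<le> norm (((1 + pi) ^ q * ?I + C * A * (2 * pi) ^ q) * (1 / (1 + norm \<xi>) ^ q))"
        unfolding real_norm_def[of "_ * _"] by (rule order_trans[OF bound abs_ge_self])
    qed
  qed
qed

section \<open>The kernel of a pseudodifferential operator\<close>

text \<open>For \<open>t\<close> comparable with the inverse of the distance to the diagonal: \<open>p\<close> is the order of the
  singularity near the diagonal, and \<open>N\<close> is the additional rate of decay far from it.\<close>

definition decay :: "nat \<Rightarrow> nat \<Rightarrow> real \<Rightarrow> real" where
  "decay p N t = t ^ p * min 1 (t ^ N)"

lemma decay_nonneg: "0 \<le> t \<Longrightarrow> 0 \<le> decay p N t"
  by (simp add: decay_def)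

lemma power_max_le_decay:
  fixes t :: real
  assumes "0 \<le> t" "p + N \<le> q"
  shows "t ^ q * max 1 t ^ p / max 1 t ^ q \<le> decay p N t"
proof (cases "t \<le> 1")
  case True
  have "t ^ q \<le> t ^ (p + N)" using assms True by (intro power_decreasing) auto
  moreover have "t ^ N \<le> 1" using assms True by (intro power_le_one) auto
  moreover have "max 1 t = 1" using True by simp
  ultimately show ?thesis by (simp add: decay_def power_add)
next
  case False
  then have "1 \<le> t ^ N" by (intro one_le_power) auto
  then show ?thesis using False by (simp add: decay_def max_def)
qed

lemma decay_scale_le:
  assumes "0 \<le> t" "t \<le> \<sigma> * s" "1 \<le> \<sigma>" "0 \<le> s"
  shows "decay p N t \<le> \<sigma> ^ (p + N) * decay p N s"
proof -
  have "t ^ N \<le> (\<sigma> * s) ^ N" using assms by (intro power_mono) auto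
  then have 1: "t ^ N \<le> \<sigma> ^ N * s ^ N" by (simp add: power_mult_distrib)
  have 2: "1 \<le> \<sigma> ^ N" using assms by (intro one_le_power) auto
  have "min 1 (t ^ N) \<le> \<sigma> ^ N * min 1 (s ^ N)"
    using 1 2 by (cases "s ^ N \<le> 1") (auto simp: min_def)
  then have "t ^ p * min 1 (t ^ N) \<le> (\<sigma> * s) ^ p * (\<sigma> ^ N * min 1 (s ^ N))"
    using assms by (intro mult_mono power_mono) auto
  then show ?thesis by (simp add: decay_def power_mult_distrib power_add mult_ac)
qed

definition offset :: "('m::finite option \<Rightarrow> real^'n) \<Rightarrow> real^'n^'m" where
  "offset y = (\<chi> j. y None - y (Some j))"

definition symbol_kernel ::
    "((real^'n) \<times> (real^'n^'m) \<Rightarrow> complex) \<Rightarrow> ('m option \<Rightarrow> real^'n) \<Rightarrow> complex" where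
  "symbol_kernel a y = osc_kernel (2 * DIM(real^'n^'m) + 2) (\<lambda>\<xi>. a (y None, \<xi>)) (offset y)"

text \<open>The kernel is defined with the smallest order that the difference estimate allows; an estimate
  with rate of decay \<open>N\<close> needs a larger one.\<close>

lemma symbol_kernel_order_independent:
  fixes a :: "(real^'n) \<times> (real^'n^'m) \<Rightarrow> complex"
  assumes a: "a \<in> symbol_class 0 1 \<delta>" and "2 * DIM(real^'n^'m) + 2 \<le> q" and "offset y \<noteq> 0"
  shows "symbol_kernel a y = osc_kernel q (\<lambda>\<xi>. a (y None, \<xi>)) (offset y)"
proof -
  let ?q = "2 * DIM(real^'n^'m) + 2"
  obtain A where A: "\<And>x. symbol_bound A 0 ?q (\<lambda>\<xi>. a (x, \<xi>))"
    using symbol_slice_bound[OF a, of ?q] by blast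
  have "integrable lborel ((shift_diff h ^^ ?q) (\<lambda>\<xi>. a (y None, \<xi>)))" for h
    using symbol_bound_integrable_shift_diff[OF _ A, where h = h] by simp
  from osc_kernel_order_independent[OF this assms(3,2)] show ?thesis
    unfolding symbol_kernel_def by (rule sym)
qed

lemma symbol_kernel_size:
  fixes a :: "(real^'n) \<times> (real^'n^'m) \<Rightarrow> complex"
  assumes a: "a \<in> symbol_class 0 1 \<delta>"
  shows "\<exists>C\<ge>0. \<forall>y. offset y \<noteq> 0 \<longrightarrow>
     norm (symbol_kernel a y) \<le> C * decay DIM(real^'n^'m) N (pi / norm (offset y))"
proof -
  let ?D = "DIM(real^'n^'m)"
  define q where "q = 2 * ?D + 2 + N"
  have q: "2 * ?D + 1 \<le> q" "2 * ?D + 2 \<le> q" "?D + N \<le> q" by (simp_all add: q_def)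
  obtain A where A: "\<And>x. symbol_bound A 0 q (\<lambda>\<xi>. a (x, \<xi>))"
    using symbol_slice_bound[OF a, of q] by blast
  obtain C where C: "C \<ge> 0" and E: "\<And>A (b :: real^'n^'m \<Rightarrow> complex) z. symbol_bound A 0 q b \<Longrightarrow>
       norm (osc_kernel q b z) \<le> C * A * (pi / norm z) ^ q * max 1 (pi / norm z) ^ ?D / max 1 (pi / norm z) ^ q"
    using osc_kernel_size[OF q(1)] by blast
  have CA: "0 \<le> C * A" using C symbol_bound_nonneg[OF A] by simp
  show ?thesis
  proof (intro exI[of _ "C * A"] conjI CA allI impI)
    fix y :: "'m option \<Rightarrow> real^'n" assume y: "offset y \<noteq> 0"
    let ?t = "pi / norm (offset y)"
    have "norm (symbol_kernel a y) \<le> C * A * ?t ^ q * max 1 ?t ^ ?D / max 1 ?t ^ q"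
      unfolding symbol_kernel_order_independent[OF a q(2) y] by (rule E[OF A])
    also have "\<dots> = C * A * (?t ^ q * max 1 ?t ^ ?D / max 1 ?t ^ q)" by (simp only: mult.assoc times_divide_eq_right)
    also have "\<dots> \<le> C * A * decay ?D N ?t"
      by (intro mult_left_mono power_max_le_decay q(3) CA) simp
    finally show "norm (symbol_kernel a y) \<le> C * A * decay ?D N ?t" .
  qed
qed

lemma symbol_kernel_difference:
  fixes a :: "(real^'n) \<times> (real^'n^'m) \<Rightarrow> complex"
  assumes a: "a \<in> symbol_class 0 1 \<delta>" and \<delta>: "\<delta> \<le> 1"
  shows "\<exists>C\<ge>0. \<forall>y y'. offset y \<noteq> 0 \<longrightarrow> offset y' \<noteq> 0 \<longrightarrow>
     norm (offset y - offset y') * (pi / norm (offset y)) \<le> 1 \<longrightarrow>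
     norm (symbol_kernel a y - symbol_kernel a y')
       \<le> C * (norm (offset y - offset y') + norm (y None - y' None))
           * decay (DIM(real^'n^'m) + 1) N (pi / norm (offset y))"
proof -
  let ?D = "DIM(real^'n^'m)"
  define q where "q = 2 * ?D + 2 + N"
  have q: "2 * ?D + 2 \<le> q" "(?D + 1) + N \<le> q" by (simp_all add: q_def)
  obtain A where A: "\<And>x. symbol_bound A 0 q (\<lambda>\<xi>. a (x, \<xi>))"
    using symbol_slice_bound[OF a, of q] by blast
  obtain A' where A'0: "0 \<le> A'" and A': "\<And>x x'. symbol_bound (A' * norm (x - x')) 1 (q - 1) (\<lambda>\<xi>. a (x, \<xi>) - a (x', \<xi>))"
    using symbol_slice_difference_bound[OF a \<delta>, of "q - 1"] by blast
  obtain C where C: "C \<ge> 0" and E: "\<And>A A' (b :: real^'n^'m \<Rightarrow> complex) b' z z'.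
       symbol_bound A 0 q b \<Longrightarrow> symbol_bound A 0 q b' \<Longrightarrow> symbol_bound A' 1 (q - 1) (\<lambda>\<xi>. b \<xi> - b' \<xi>) \<Longrightarrow>
       z \<noteq> 0 \<Longrightarrow> norm (z - z') * (pi / norm z) \<le> 1 \<Longrightarrow>
       norm (osc_kernel q b z - osc_kernel q b' z')
         \<le> C * (A * norm (z - z') + A') * (pi / norm z) ^ q * max 1 (pi / norm z) ^ (?D + 1) / max 1 (pi / norm z) ^ q"
    using osc_kernel_difference[OF q(1)] by blast
  have A0: "0 \<le> A" by (rule symbol_bound_nonneg[OF A])
  show ?thesis
  proof (intro exI[of _ "C * (A + A')"] conjI allI impI)
    show "0 \<le> C * (A + A')" using C A0 A'0 by simp
    fix y y' :: "'m option \<Rightarrow> real^'n"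
    assume y: "offset y \<noteq> 0" "offset y' \<noteq> 0" and close: "norm (offset y - offset y') * (pi / norm (offset y)) \<le> 1"
    let ?t = "pi / norm (offset y)"
    let ?d = "norm (offset y - offset y')" and ?e = "norm (y None - y' None)"
    have "norm (symbol_kernel a y - symbol_kernel a y') \<le> C * (A * ?d + A' * ?e) * ?t ^ q * max 1 ?t ^ (?D + 1) / max 1 ?t ^ q"
      unfolding symbol_kernel_order_independent[OF a q(1) y(1)] symbol_kernel_order_independent[OF a q(1) y(2)]
      by (rule E[OF A A A' y(1) close])
    also have "\<dots> = C * (A * ?d + A' * ?e) * (?t ^ q * max 1 ?t ^ (?D + 1) / max 1 ?t ^ q)"
      by (simp only: mult.assoc times_divide_eq_right)
    also have "\<dots> \<le> C * ((A + A') * (?d + ?e)) * decay (?D + 1) N ?t"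
    proof (intro mult_mono power_max_le_decay q(2))
      show "A * ?d + A' * ?e \<le> (A + A') * (?d + ?e)"
        using A0 A'0 mult_nonneg_nonneg[of A ?e] mult_nonneg_nonneg[of A' ?d] by (simp add: distrib_left distrib_right)
    qed (use C A0 A'0 in auto)
    finally show "norm (symbol_kernel a y - symbol_kernel a y') \<le> C * (A + A') * (?d + ?e) * decay (?D + 1) N ?t"
      by (simp only: mult.assoc)
  qed
qed

section \<open>Distances to the diagonal\<close>

lemma norm_diff_None_le: "norm (y None - y k) \<le> norm (offset y)"
proof (cases k)
  case (Some j)
  have "norm (offset y $ j) \<le> norm (offset y)" by (rule Finite_Cartesian_Product.norm_nth_le)
  then show ?thesis by (simp add: offset_def Some)
qed simp

lemma norm_diff_le_offset: "norm (y k - y l) \<le> 2 * norm (offset y)"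
proof -
  have "norm (y k - y l) = norm ((y None - y l) - (y None - y k))" by simp
  also have "\<dots> \<le> norm (y None - y l) + norm (y None - y k)" by (rule norm_triangle_ineq4)
  finally show ?thesis using norm_diff_None_le[of y l] norm_diff_None_le[of y k] by linarith
qed

lemma off_diagonal_offset: "off_diagonal y \<Longrightarrow> offset y \<noteq> 0"
  unfolding off_diagonal_def using norm_diff_le_offset[of y] by force

text \<open>The estimates are proved in terms of the norm of \<open>offset y\<close> or of the largest distance from one of
  the points; each of them bounds all pairwise distances up to a factor \<open>2\<close>.\<close>

lemma total_dist_le:
  fixes y :: "'m::finite option \<Rightarrow> real^'n"
  assumes "\<And>k l. norm (y k - y l) \<le> B"
  shows "total_dist y \<le> (real CARD('m) + 1)\<^sup>2 * B"
proof -
  have "total_dist y \<le> (\<Sum>k\<in>(UNIV :: 'm option set). \<Sum>l\<in>(UNIV :: 'm option set). B)"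
    unfolding total_dist_def by (intro sum_mono assms)
  also have "\<dots> = (real CARD('m) + 1)\<^sup>2 * B" by (simp add: power2_eq_square algebra_simps)
  finally show ?thesis .
qed

lemma total_dist_pos:
  fixes y :: "'m::finite option \<Rightarrow> real^'n"
  assumes "off_diagonal y" shows "0 < total_dist y"
proof -
  obtain k l where kl: "y k \<noteq> y l" using assms by (auto simp: off_diagonal_def)
  have "norm (y k - y l) \<le> (\<Sum>l\<in>UNIV. norm (y k - y l))"
    by (rule member_le_sum) auto
  also have "\<dots> \<le> total_dist y"
    unfolding total_dist_def by (rule member_le_sum[of k UNIV "\<lambda>k. \<Sum>l\<in>UNIV. norm (y k - y l)"]) (auto intro: sum_nonneg)
  finally show ?thesis using kl by (metis order_less_le_trans right_minus_eq zero_less_norm_iff)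
qed

lemma norm_offset_update_le:
  fixes y :: "'m::finite option \<Rightarrow> real^'n"
  shows "norm (offset y - offset (y(j := y'))) \<le> real CARD('m) * norm (y j - y')"
proof -
  let ?w = "offset y - offset (y(j := y'))"
  have "norm (?w $ i) \<le> norm (y j - y')" for i
    by (auto simp: offset_def norm_minus_commute)
  then have "(\<Sum>i\<in>UNIV. norm (?w $ i)) \<le> real CARD('m) * norm (y j - y')"
    using sum_bounded_above[of UNIV "\<lambda>i. norm (?w $ i)" "norm (y j - y')"] by simp
  then show ?thesis using norm_vec_le_sum[of ?w] by linarith
qed

section \<open>Size, regularity and association of the kernel\<close>

lemma symbol_kernel_decay:
  fixes a :: "(real^'n) \<times> (real^'n^'m) \<Rightarrow> complex"
  assumes a: "a \<in> symbol_class 0 1 \<delta>" and N: "N \<ge> real (CARD('m) * CARD('n))"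
  shows "\<exists>C>0. \<forall>y. off_diagonal y \<longrightarrow> norm (symbol_kernel a y) \<le> C * total_dist y powr (- N)"
proof -
  let ?D = "DIM(real^'n^'m)"
  have D: "real ?D \<le> N" using N by (simp add: mult.commute)
  define k where "k = nat \<lceil>N\<rceil>"
  have k: "N \<le> real k" by (simp add: k_def real_nat_ceiling_ge)
  obtain C where C: "C \<ge> 0" and E: "\<And>y. offset y \<noteq> 0 \<Longrightarrow>
     norm (symbol_kernel a y) \<le> C * decay ?D k (pi / norm (offset y))"
    using symbol_kernel_size[OF a, of k] by blast
  define c where "c = 2 * (real CARD('m) + 1)\<^sup>2"
  have c: "0 < c" unfolding c_def by (intro mult_pos_pos zero_less_power) (auto intro: add_nonneg_pos)
  have N0: "0 \<le> N" using N by (meson of_nat_0_le_iff order_trans)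
  show ?thesis
  proof (intro exI[of _ "C * (pi * c) powr N + 1"] conjI allI impI)
    show "0 < C * (pi * c) powr N + 1" using C by (simp add: add_nonneg_pos)
    fix y :: "'m option \<Rightarrow> real^'n" assume y: "off_diagonal y"
    let ?t = "pi / norm (offset y)"
    have z: "offset y \<noteq> 0" by (rule off_diagonal_offset[OF y])
    have t: "0 < ?t" using z by simp
    have "decay ?D k ?t \<le> ?t powr N"
    proof (cases "?t \<le> 1")
      case True
      have "decay ?D k ?t \<le> 1 * ?t ^ k"
        unfolding decay_def using t True by (intro mult_mono power_le_one) auto
      also have "\<dots> = ?t powr real k" using t by (simp add: powr_realpow)
      also have "\<dots> \<le> ?t powr N" using t True k by (intro powr_mono') auto
      finally show ?thesis .
    next
      case False
      have "decay ?D k ?t \<le> ?t ^ ?D * 1"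
        unfolding decay_def using t by (intro mult_left_mono) auto
      also have "\<dots> = ?t powr real ?D" using t by (simp add: powr_realpow del: DIM_cart)
      also have "\<dots> \<le> ?t powr N" using False D by (intro powr_mono) auto
      finally show ?thesis .
    qed
    also have "\<dots> \<le> (pi * c / total_dist y) powr N"
    proof (rule powr_mono2[OF N0])
      have "total_dist y \<le> c * norm (offset y)"
        using total_dist_le[of y, OF norm_diff_le_offset] by (simp add: c_def mult_ac)
      then have "pi * total_dist y \<le> (pi * c) * norm (offset y)" by simp
      then show "?t \<le> pi * c / total_dist y"
        using z total_dist_pos[OF y] by (simp add: pos_divide_le_eq pos_le_divide_eq)
    qed (use t in simp)
    also have "\<dots> = (pi * c) powr N * total_dist y powr (- N)"
      using c total_dist_pos[OF y] by (simp add: powr_divide powr_minus_divide)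
    finally have "C * decay ?D k ?t \<le> C * ((pi * c) powr N * total_dist y powr (- N))"
      using C by (rule mult_left_mono)
    with E[OF z] have "norm (symbol_kernel a y) \<le> C * (pi * c) powr N * total_dist y powr (- N)"
      by (simp only: mult.assoc)
    also have "\<dots> \<le> (C * (pi * c) powr N + 1) * total_dist y powr (- N)" by (intro mult_right_mono) auto
    finally show "norm (symbol_kernel a y) \<le> (C * (pi * c) powr N + 1) * total_dist y powr (- N)" .
  qed
qed

text \<open>If the displacement is small compared with the distance \<open>H\<close>, the difference estimate applies.
  Otherwise it is at least a fixed multiple of \<open>H\<close>, and the size estimate at both points suffices,
  as the moved point is still at distance at least \<open>H / 4\<close>.\<close>

lemma symbol_kernel_update:
  fixes a :: "(real^'n) \<times> (real^'n^'m) \<Rightarrow> complex"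
  assumes a: "a \<in> symbol_class 0 1 \<delta>" and \<delta>: "\<delta> \<le> 1"
  shows "\<exists>C\<ge>0. \<forall>j y y' H. H = (MAX k. norm (y j - y k)) \<longrightarrow> off_diagonal y \<longrightarrow> norm (y j - y') \<le> H / 2 \<longrightarrow>
     0 < H \<and> total_dist y \<le> 2 * (real CARD('m) + 1)\<^sup>2 * H \<and>
     norm (symbol_kernel a y - symbol_kernel a (y(j := y')))
       \<le> C * norm (y j - y') * decay (DIM(real^'n^'m) + 1) N (1 / H)"
proof -
  let ?D = "DIM(real^'n^'m)"
  let ?m = "real CARD('m)"
  let ?K = "symbol_kernel a"
  obtain C1 where C1: "C1 \<ge> 0" and E1: "\<And>y. offset y \<noteq> 0 \<Longrightarrow>
     norm (?K y) \<le> C1 * decay ?D N (pi / norm (offset y))"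
    using symbol_kernel_size[OF a, of N] by blast
  obtain C2 where C2: "C2 \<ge> 0" and E2: "\<And>y y'. offset y \<noteq> 0 \<Longrightarrow> offset y' \<noteq> 0 \<Longrightarrow>
     norm (offset y - offset y') * (pi / norm (offset y)) \<le> 1 \<Longrightarrow>
     norm (?K y - ?K y')
       \<le> C2 * (norm (offset y - offset y') + norm (y None - y' None)) * decay (?D + 1) N (pi / norm (offset y))"
    using symbol_kernel_difference[OF a \<delta>, of N] by blast
  have m1: "1 \<le> ?m" by (simp add: Suc_leI)
  define B1 where "B1 = C2 * (?m + 1) * (4 * pi) ^ (?D + 1 + N)"
  define B2 where "B2 = 2 * C1 * (4 * pi) ^ (?D + N) * (2 * ?m * pi)"
  have B: "0 \<le> B1" "0 \<le> B2" unfolding B1_def B2_def using C1 C2 by auto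
  show ?thesis
  proof (intro exI[of _ "B1 + B2"] conjI[of "_ \<le> _"] allI impI)
    show "0 \<le> B1 + B2" using B by simp
    fix j and y :: "'m option \<Rightarrow> real^'n" and y' H
    assume H: "H = (MAX k. norm (y j - y k))" and y: "off_diagonal y" and d: "norm (y j - y') \<le> H / 2"
    let ?d = "norm (y j - y')"
    let ?y = "y(j := y')"
    have le: "norm (y j - y k) \<le> H" for k unfolding H by (rule Max_ge) auto
    have "H \<in> range (\<lambda>k. norm (y j - y k))" unfolding H by (rule Max_in) auto
    then obtain k where k: "H = norm (y j - y k)" by auto
    have le2: "norm (y k - y l) \<le> 2 * H" for k l
    proof -
      have "norm (y k - y l) = norm ((y j - y l) - (y j - y k))" by simp
      also have "\<dots> \<le> norm (y j - y l) + norm (y j - y k)" by (rule norm_triangle_ineq4)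
      finally show ?thesis using le[of k] le[of l] by linarith
    qed
    have H0: "0 < H"
    proof -
      obtain k l where "y k \<noteq> y l" using y by (auto simp: off_diagonal_def)
      then have "0 < norm (y k - y l)" by simp
      then show ?thesis using le2[of k l] by linarith
    qed
    have td: "total_dist y \<le> 2 * (?m + 1)\<^sup>2 * H"
      using total_dist_le[of y, OF le2] by (simp add: mult_ac)
    have z: "H / 4 \<le> norm (offset y)" "H \<le> 2 * norm (offset y)"
      using norm_diff_le_offset[of y j k] k H0 by linarith+
    have z': "H / 4 \<le> norm (offset ?y)"
    proof -
      have "k \<noteq> j" using k H0 by auto
      have "H \<le> ?d + norm (y' - y k)"
        unfolding k using norm_triangle_ineq[of "y j - y'" "y' - y k"] by simp
      then have "H / 2 \<le> norm (?y j - ?y k)" using d \<open>k \<noteq> j\<close> by simp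
      then show ?thesis using norm_diff_le_offset[of ?y j k] by linarith
    qed
    have nz: "offset y \<noteq> 0" "offset ?y \<noteq> 0" using z z' H0 by auto
    have t: "pi / norm w \<le> (4 * pi) * (1 / H)" if "H / 4 \<le> norm w" for w :: "real^'n^'m"
    proof -
      have "pi / norm w \<le> pi / (H / 4)" using that H0 by (intro divide_left_mono mult_pos_pos) auto
      then show ?thesis by (simp add: mult_ac)
    qed
    have p4: "1 \<le> 4 * pi" using pi_gt3 by simp
    have dec: "decay p N (pi / norm w) \<le> (4 * pi) ^ (p + N) * decay p N (1 / H)"
      if "H / 4 \<le> norm w" for p and w :: "real^'n^'m"
      using H0 by (intro decay_scale_le t that p4) auto
    have dec0: "0 \<le> decay p N (1 / H)" for p using H0 by (intro decay_nonneg) simp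
    have "norm (?K y - ?K ?y) \<le> (B1 + B2) * ?d * decay (?D + 1) N (1 / H)"
    proof (cases "?m * ?d * (pi / norm (offset y)) \<le> 1")
      case True
      have o: "norm (offset y - offset ?y) \<le> ?m * ?d" by (rule norm_offset_update_le)
      have "norm (offset y - offset ?y) * (pi / norm (offset y)) \<le> ?m * ?d * (pi / norm (offset y))"
        by (intro mult_right_mono o) simp
      then have "norm (?K y - ?K ?y)
          \<le> C2 * (norm (offset y - offset ?y) + norm (y None - ?y None)) * decay (?D + 1) N (pi / norm (offset y))"
        using True by (intro E2 nz) linarith
      also have "\<dots> \<le> C2 * (?m * ?d + ?d) * ((4 * pi) ^ (?D + 1 + N) * decay (?D + 1) N (1 / H))"
      proof (intro mult_mono add_mono o dec z(1))
        show "norm (y None - ?y None) \<le> ?d" by auto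
      qed (use C2 H0 in \<open>auto intro!: decay_nonneg\<close>)
      also have "\<dots> = B1 * ?d * decay (?D + 1) N (1 / H)" unfolding B1_def by algebra
      also have "\<dots> \<le> (B1 + B2) * ?d * decay (?D + 1) N (1 / H)"
        using B by (intro mult_right_mono dec0) auto
      finally show ?thesis .
    next
      case False
      \<comment> \<open>the missing factor \<open>?d / H\<close> costs only a constant here\<close>
      have far: "1 \<le> (2 * ?m * pi) * ?d * (1 / H)"
      proof -
        have n: "0 < norm (offset y)" using nz by simp
        from False have "norm (offset y) < ?m * ?d * pi"
          using n by (simp add: not_le pos_less_divide_eq)
        then have "H \<le> (2 * ?m * pi) * ?d" using z(2) by (simp add: mult_ac)
        then show ?thesis using H0 by (simp add: pos_le_divide_eq)
      qed
      have s: "norm (?K w) \<le> C1 * ((4 * pi) ^ (?D + N) * decay ?D N (1 / H))"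
        if "offset w \<noteq> 0" "H / 4 \<le> norm (offset w)" for w
        by (rule order_trans[OF E1[OF that(1)] mult_left_mono[OF dec[OF that(2)] C1]])
      have "norm (?K y - ?K ?y) \<le> norm (?K y) + norm (?K ?y)" by (rule norm_triangle_ineq4)
      also have "\<dots> \<le> 2 * C1 * (4 * pi) ^ (?D + N) * decay ?D N (1 / H)"
        using s[OF nz(1) z(1)] s[OF nz(2) z'] by simp
      also have "\<dots> = 2 * C1 * (4 * pi) ^ (?D + N) * decay ?D N (1 / H) * 1" by simp
      also have "\<dots> \<le> 2 * C1 * (4 * pi) ^ (?D + N) * decay ?D N (1 / H) * ((2 * ?m * pi) * ?d * (1 / H))"
        using C1 dec0 by (intro mult_left_mono far) auto
      also have "\<dots> = B2 * ?d * (1 / H * decay ?D N (1 / H))" unfolding B2_def by algebra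
      also have "1 / H * decay ?D N (1 / H) = decay (?D + 1) N (1 / H)" by (simp add: decay_def)
      also have "B2 * ?d * decay (?D + 1) N (1 / H) \<le> (B1 + B2) * ?d * decay (?D + 1) N (1 / H)"
        using B by (intro mult_right_mono dec0) auto
      finally show ?thesis .
    qed
    then show "0 < H \<and> total_dist y \<le> 2 * (?m + 1)\<^sup>2 * H \<and>
      norm (?K y - ?K ?y) \<le> (B1 + B2) * ?d * decay (?D + 1) N (1 / H)"
      using H0 td by blast
  qed
qed

lemma symbol_kernel_regularity:
  fixes a :: "(real^'n) \<times> (real^'n^'m) \<Rightarrow> complex"
  assumes a: "a \<in> symbol_class 0 1 \<delta>" and \<delta>: "\<delta> \<le> 1" and N: "N > 0"
  shows "\<exists>C>0. \<forall>j y y'. off_diagonal y \<longrightarrow>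
        norm (y j - y') \<le> (1/2) * (MAX k. norm (y j - y k)) \<longrightarrow>
        norm (symbol_kernel a y - symbol_kernel a (y(j := y'))) \<le>
          C * norm (y j - y') powr 1 / total_dist y powr (real (CARD('m) * CARD('n)) + 1)
            * min 1 ((MAX k. norm (y j - y k)) powr (- N))"
proof -
  let ?D = "DIM(real^'n^'m)"
  define k where "k = nat \<lceil>N\<rceil>"
  have k: "N \<le> real k" by (simp add: k_def real_nat_ceiling_ge)
  define c where "c = 2 * (real CARD('m) + 1)\<^sup>2"
  have c: "0 < c" unfolding c_def by (intro mult_pos_pos zero_less_power) (auto intro: add_nonneg_pos)
  obtain C where C: "C \<ge> 0" and E: "\<And>j y y' H. H = (MAX k. norm (y j - y k)) \<Longrightarrow> off_diagonal y \<Longrightarrow> norm (y j - y') \<le> H / 2 \<Longrightarrow>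
     0 < H \<and> total_dist y \<le> c * H \<and>
     norm (symbol_kernel a y - symbol_kernel a (y(j := y'))) \<le> C * norm (y j - y') * decay (?D + 1) k (1 / H)"
    using symbol_kernel_update[OF a \<delta>, of k] unfolding c_def[symmetric] by blast
  show ?thesis
  proof (intro exI[of _ "C * c ^ (?D + 1) + 1"] conjI allI impI)
    show "0 < C * c ^ (?D + 1) + 1" using C c by (intro add_nonneg_pos) auto
    fix j and y :: "'m option \<Rightarrow> real^'n" and y'
    assume y: "off_diagonal y" and d: "norm (y j - y') \<le> (1/2) * (MAX k. norm (y j - y k))"
    define H where "H = (MAX k. norm (y j - y k))"
    let ?d = "norm (y j - y')" and ?T = "total_dist y"
    have "?d \<le> H / 2" using d by (simp add: H_def)
    from E[OF H_def y this] have H: "0 < H" and T: "?T \<le> c * H"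
      and bound: "norm (symbol_kernel a y - symbol_kernel a (y(j := y'))) \<le> C * ?d * decay (?D + 1) k (1 / H)"
      by auto
    have T0: "0 < ?T" by (rule total_dist_pos[OF y])
    have min_le: "min 1 ((1 / H) ^ k) \<le> min 1 (H powr (- N))"
    proof (cases "1 \<le> H")
      case True
      have "(1 / H) ^ k = H powr (- real k)" using H by (simp add: powr_minus powr_realpow power_one_over inverse_eq_divide)
      also have "\<dots> \<le> H powr (- N)" using True k by (intro powr_mono) auto
      finally show ?thesis by simp
    next
      case False
      then have "H powr 0 \<le> H powr (- N)" using H N by (intro powr_mono') auto
      then show ?thesis using H by simp
    qed
    have "1 / H \<le> c / ?T" using T T0 H by (simp add: pos_le_divide_eq pos_divide_le_eq)
    then have "decay (?D + 1) k (1 / H) \<le> (c / ?T) ^ (?D + 1) * min 1 (H powr (- N))"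
      unfolding decay_def using H c T0 by (intro mult_mono power_mono min_le) auto
    also have "(c / ?T) ^ (?D + 1) = c ^ (?D + 1) / ?T powr (real (CARD('m) * CARD('n)) + 1)"
    proof -
      have "real (CARD('m) * CARD('n)) + 1 = real (?D + 1)" by simp
      then show ?thesis using T0 by (simp only: power_divide powr_realpow)
    qed
    finally have "C * ?d * decay (?D + 1) k (1 / H)
        \<le> C * ?d * (c ^ (?D + 1) / ?T powr (real (CARD('m) * CARD('n)) + 1) * min 1 (H powr (- N)))"
      using C by (intro mult_left_mono) auto
    also have "\<dots> = (C * c ^ (?D + 1)) * (?d / ?T powr (real (CARD('m) * CARD('n)) + 1) * min 1 (H powr (- N)))"
      by (simp only: mult_ac times_divide_eq_left times_divide_eq_right)
    also have "\<dots> \<le> (C * c ^ (?D + 1) + 1) * (?d / ?T powr (real (CARD('m) * CARD('n)) + 1) * min 1 (H powr (- N)))"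
      by (intro mult_right_mono) auto
    finally have "norm (symbol_kernel a y - symbol_kernel a (y(j := y')))
      \<le> (C * c ^ (?D + 1) + 1) * (?d / ?T powr (real (CARD('m) * CARD('n)) + 1) * min 1 (H powr (- N)))"
      using bound by linarith
    moreover have "?d powr 1 = ?d" by simp
    ultimately show "norm (symbol_kernel a y - symbol_kernel a (y(j := y'))) \<le>
          (C * c ^ (?D + 1) + 1) * ?d powr 1 / ?T powr (real (CARD('m) * CARD('n)) + 1)
            * min 1 ((MAX k. norm (y j - y k)) powr (- N))"
      unfolding H_def[symmetric] by (simp only: mult.assoc times_divide_eq_left times_divide_eq_right)
  qed
qed

lemma symbol_bound_slowly_varying:
  fixes b :: "'v::euclidean_space \<Rightarrow> complex"
  assumes "symbol_bound A 0 1 b"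
  shows "((\<lambda>\<eta>. b (\<eta> + \<xi>) - b \<eta>) \<longlongrightarrow> 0) at_infinity"
proof -
  obtain C where C: "C \<ge> 0" and E: "\<And>A (b :: 'v \<Rightarrow> complex) h \<xi>. symbol_bound A 0 1 b \<Longrightarrow>
       norm ((shift_diff h ^^ (1 + 0)) b \<xi>) \<le> C * A * norm h ^ (1 + 0) / (max 1 (norm h) + norm \<xi>) ^ 1"
    using shift_diff_symbol_bound[of 1 0, where 'v='v] by auto
  have lim: "((\<lambda>\<eta>::'v. C * A * norm \<xi> / (max 1 (norm \<xi>) + norm \<eta>)) \<longlongrightarrow> 0) at_infinity"
    by (intro real_tendsto_divide_at_top[OF tendsto_const] filterlim_tendsto_add_at_top[OF tendsto_const]
        filterlim_norm_at_top)
  show ?thesis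
  proof (rule Lim_null_comparison[OF always_eventually lim], rule allI)
    fix \<eta>
    show "norm (b (\<eta> + \<xi>) - b \<eta>) \<le> C * A * norm \<xi> / (max 1 (norm \<xi>) + norm \<eta>)"
      using E[OF assms, of \<xi> \<eta>] by (simp add: shift_diff_def)
  qed
qed

lemma tensor_fourier:
  fixes f :: "'m::finite \<Rightarrow> real^'n \<Rightarrow> complex"
  assumes f: "\<And>j. integrable lborel (f j)"
  shows "(\<Prod>j\<in>UNIV. fourier (f j) (\<xi> $ j)) * cis (x \<bullet> (\<Sum>j\<in>UNIV. \<xi> $ j))
       = (\<integral>y. (\<Prod>j\<in>UNIV. f j (y $ j)) * cis (((\<chi> j. x) - y) \<bullet> \<xi>) \<partial>lborel)"
proof -
  let ?c = "cis (x \<bullet> (\<Sum>j\<in>UNIV. \<xi> $ j))"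
  have "(\<Prod>j\<in>UNIV. fourier (f j) (\<xi> $ j)) = (\<integral>y. (\<Prod>j\<in>UNIV. f j (y $ j) * cis (- (y $ j \<bullet> \<xi> $ j))) \<partial>lborel)"
    unfolding fourier_def
    by (rule integral_prod_components[symmetric]) (intro integrable_mult_cis f, measurable)
  also have "\<dots> * ?c = (\<integral>y. (\<Prod>j\<in>UNIV. f j (y $ j) * cis (- (y $ j \<bullet> \<xi> $ j))) * ?c \<partial>lborel)"
    by simp
  also have "\<dots> = (\<integral>y. (\<Prod>j\<in>UNIV. f j (y $ j)) * cis (((\<chi> j. x) - y) \<bullet> \<xi>) \<partial>lborel)"
  proof (rule Bochner_Integration.integral_cong[OF refl])
    fix y :: "real^'n^'m"
    have "((\<chi> j. x) - y) \<bullet> \<xi> = (\<Sum>j\<in>UNIV. - (y $ j \<bullet> \<xi> $ j)) + x \<bullet> (\<Sum>j\<in>UNIV. \<xi> $ j)"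
    proof -
      have "((\<chi> j. x) - y) \<bullet> \<xi> = (\<Sum>j\<in>UNIV. (x - y $ j) \<bullet> \<xi> $ j)"
        by (simp only: inner_vec_def[of "(\<chi> j. x) - y" \<xi>] vector_minus_component vec_lambda_beta)
      then show ?thesis by (simp add: inner_diff_left sum_subtractf inner_sum_right sum_negf)
    qed
    then have "cis (((\<chi> j. x) - y) \<bullet> \<xi>) = (\<Prod>j\<in>UNIV. cis (- (y $ j \<bullet> \<xi> $ j))) * ?c"
      by (simp only: cis_mult[symmetric] cis_sum[OF finite])
    then show "(\<Prod>j\<in>UNIV. f j (y $ j) * cis (- (y $ j \<bullet> \<xi> $ j))) * ?c
        = (\<Prod>j\<in>UNIV. f j (y $ j)) * cis (((\<chi> j. x) - y) \<bullet> \<xi>)"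
      by (simp add: prod.distrib mult.assoc)
  qed
  finally show ?thesis .
qed

text \<open>A point \<open>x\<close> outside the support of one factor has a neighbourhood in which that factor vanishes.
  So the tensor product of the factors vanishes near \<open>(x, \<dots>, x)\<close>, which is the hypothesis of the
  pairing identity.\<close>

lemma symbol_kernel_associated:
  fixes a :: "(real^'n) \<times> (real^'n^'m) \<Rightarrow> complex"
  assumes a: "a \<in> symbol_class 0 1 \<delta>"
  shows "associated_kernel (pseudo_op a) (symbol_kernel a)"
  unfolding associated_kernel_def
proof (intro allI impI)
  fix f :: "'m \<Rightarrow> real^'n \<Rightarrow> complex" and x :: "real^'n"
  assume sf: "\<forall>j. schwartz (f j)" and x: "x \<notin> (\<Inter>j. supp (f j))"
  let ?D = "DIM(real^'n^'m)"
  let ?q = "2 * ?D + 2"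
  define c :: "real^'n^'m" where "c = (\<chi> j. x)"
  define F where "F y = (\<Prod>j\<in>UNIV. f j (y $ j))" for y :: "real^'n^'m"
  define \<Phi> where "\<Phi> \<xi> = (\<Prod>j\<in>UNIV. fourier (f j) (\<xi> $ j)) * cis (x \<bullet> (\<Sum>j\<in>UNIV. \<xi> $ j))" for \<xi> :: "real^'n^'m"
  let ?b = "\<lambda>\<xi>. a (x, \<xi>)"
  have fi: "integrable lborel (f j)" for j using sf schwartz_integrable by blast
  have off: "offset (kernel_point x y) = c - y" for y
    by (simp add: offset_def kernel_point_def c_def vec_eq_iff)
  have k0: "kernel_point x y None = x" for y by (simp add: kernel_point_def)
  have Keq: "symbol_kernel a (kernel_point x y) = osc_kernel ?q ?b (c - y)" for y
    unfolding symbol_kernel_def off k0 ..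
  have F: "integrable lborel F"
    unfolding F_def[abs_def] by (rule integrable_prod_components[OF fi])
  have \<Phi>: "\<Phi> \<xi> = (\<integral>y. F y * cis ((c - y) \<bullet> \<xi>) \<partial>lborel)" for \<xi>
    unfolding \<Phi>_def F_def c_def by (rule tensor_fourier[OF fi])
  have \<Phi>i: "integrable lborel \<Phi>"
    unfolding \<Phi>_def[abs_def]
  proof (rule integrable_mult_cis)
    show "integrable lborel (\<lambda>\<xi>::real^'n^'m. \<Prod>j\<in>UNIV. fourier (f j) (\<xi> $ j))"
      using sf by (intro integrable_prod_components schwartz_fourier_integrable) blast
    show "(\<lambda>\<xi>::real^'n^'m. x \<bullet> (\<Sum>j\<in>UNIV. \<xi> $ j)) \<in> borel_measurable borel"
      by (intro borel_measurable_continuous_onI continuous_intros)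
  qed
  obtain A where A: "symbol_bound A 0 ?q ?b"
    using symbol_slice_bound[OF a, of ?q] by blast
  obtain A1 where A1: "symbol_bound A1 0 1 ?b"
    using symbol_slice_bound[OF a, of 1] by blast
  have bm: "?b \<in> borel_measurable borel" using A by (intro smooth_borel_measurable) (simp add: symbol_bound_def)
  have bB: "norm (?b \<xi>) \<le> A" for \<xi> using A by (simp add: symbol_bound_def)
  have int: "integrable lborel ((shift_diff h ^^ ?q) ?b)" for h
    using symbol_bound_integrable_shift_diff[OF _ A, where h = h] by simp
  obtain j0 where j0: "x \<notin> supp (f j0)" using x by blast
  have "open (- supp (f j0))" by (simp add: supp_def open_Compl)
  then obtain r where r: "r > 0" and ball: "ball x r \<subseteq> - supp (f j0)"
    using j0 unfolding open_contains_ball by blast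
  have van: "F y = 0" if "norm (c - y) < r" for y
  proof -
    have "norm ((c - y) $ j0) \<le> norm (c - y)" by (rule Finite_Cartesian_Product.norm_nth_le)
    then have "dist x (y $ j0) < r" using that by (simp add: c_def dist_norm)
    then have "y $ j0 \<notin> supp (f j0)" using ball by auto
    then have "y $ j0 \<notin> {w. f j0 w \<noteq> 0}"
      unfolding supp_def by (rule contra_subsetD[OF closure_subset])
    then have "f j0 (y $ j0) = 0" by simp
    then show ?thesis unfolding F_def by (intro prod_zero) auto
  qed
  obtain C where C: "C \<ge> 0" and E: "\<And>y. offset y \<noteq> 0 \<Longrightarrow>
     norm (symbol_kernel a y) \<le> C * decay ?D 0 (pi / norm (offset y))"
    using symbol_kernel_size[OF a, of 0] by blast
  have KF: "integrable lborel (\<lambda>y. osc_kernel ?q ?b (c - y) * F y)"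
  proof (rule Bochner_Integration.integrable_bound)
    show "integrable lborel (\<lambda>y. of_real (C * (pi / r) ^ ?D) * F y)" using F by (rule integrable_mult_right)
    have [measurable]: "osc_kernel ?q ?b \<in> borel_measurable borel" by (rule osc_kernel_borel_measurable[OF bm])
    have [measurable]: "F \<in> borel_measurable borel" using F by auto
    show "(\<lambda>y. osc_kernel ?q ?b (c - y) * F y) \<in> borel_measurable lborel" by measurable
    show "AE y in lborel. norm (osc_kernel ?q ?b (c - y) * F y) \<le> norm (of_real (C * (pi / r) ^ ?D) * F y)"
    proof (rule AE_I2)
      fix y
      show "norm (osc_kernel ?q ?b (c - y) * F y) \<le> norm (of_real (C * (pi / r) ^ ?D) * F y)"
      proof (cases "norm (c - y) < r")
        case True
        then show ?thesis by (simp add: van)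
      next
        case False
        then have nr: "r \<le> norm (c - y)" by simp
        have nz: "offset (kernel_point x y) \<noteq> 0" unfolding off using nr r by auto
        have "norm (osc_kernel ?q ?b (c - y)) \<le> C * decay ?D 0 (pi / norm (c - y))"
          using E[OF nz] unfolding Keq off .
        also have "\<dots> \<le> C * (pi / r) ^ ?D"
        proof (rule mult_left_mono[OF _ C])
          have "pi / norm (c - y) \<le> pi / r" using r nr by (intro divide_left_mono mult_pos_pos) auto
          then have "(pi / norm (c - y)) ^ ?D \<le> (pi / r) ^ ?D" by (rule power_mono) simp
          then show "decay ?D 0 (pi / norm (c - y)) \<le> (pi / r) ^ ?D"
            unfolding decay_def power_0 min.idem mult_1_right .
        qed
        finally have "norm (osc_kernel ?q ?b (c - y)) \<le> \<bar>C * (pi / r) ^ ?D\<bar>" by linarith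
        then show ?thesis unfolding norm_mult norm_of_real by (intro mult_right_mono) auto
      qed
    qed
  qed
  have "(\<integral>\<xi>. ?b \<xi> * \<Phi> \<xi> \<partial>lborel) = (\<integral>y. osc_kernel ?q ?b (c - y) * F y \<partial>lborel)"
    by (rule fourier_pairing_eq_osc_kernel[OF bm bB symbol_bound_slowly_varying[OF A1] int F van r \<Phi> \<Phi>i KF])
  moreover have "pseudo_op a f x = (\<integral>\<xi>. ?b \<xi> * \<Phi> \<xi> \<partial>lborel)"
    by (simp only: pseudo_op_def \<Phi>_def mult.assoc)
  ultimately show "integrable lborel (\<lambda>y. symbol_kernel a (kernel_point x y) * (\<Prod>j\<in>UNIV. f j (y $ j))) \<and>
        pseudo_op a f x = (\<integral>y. symbol_kernel a (kernel_point x y) * (\<Prod>j\<in>UNIV. f j (y $ j)) \<partial>lborel)"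
    using KF unfolding Keq F_def[abs_def] by (intro conjI) (assumption, rule trans)
qed

theorem proposition4p1:
  fixes a :: "(real^'n) \<times> (real^'n^'m) \<Rightarrow> complex"
    and \<delta> :: real
  assumes "0 \<le> \<delta>" and "\<delta> < 1"
    and "a \<in> symbol_class 0 1 \<delta>"
  shows "\<exists>K :: ('m option \<Rightarrow> real^'n) \<Rightarrow> complex.
    associated_kernel (pseudo_op a) K \<and>
    (\<forall>N::real. N \<ge> real (CARD('m) * CARD('n)) \<longrightarrow>
      (\<exists>C>0. \<forall>y. off_diagonal y \<longrightarrow> norm (K y) \<le> C * total_dist y powr (- N))) \<and>
    (\<exists>\<epsilon>>0. \<forall>N::real. N > 0 \<longrightarrow>
      (\<exists>C>0. \<forall>j y y'. off_diagonal y \<longrightarrow>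
        norm (y j - y') \<le> (1/2) * (MAX k. norm (y j - y k)) \<longrightarrow>
        norm (K y - K (y(j := y'))) \<le>
          C * norm (y j - y') powr \<epsilon>
            / total_dist y powr (real (CARD('m) * CARD('n)) + \<epsilon>)
            * min 1 ((MAX k. norm (y j - y k)) powr (- N))))"
proof (intro exI[of _ "symbol_kernel a"] conjI)
  show "associated_kernel (pseudo_op a) (symbol_kernel a)"
    by (rule symbol_kernel_associated[OF assms(3)])
  show "\<forall>N::real. N \<ge> real (CARD('m) * CARD('n)) \<longrightarrow>
      (\<exists>C>0. \<forall>y. off_diagonal y \<longrightarrow> norm (symbol_kernel a y) \<le> C * total_dist y powr (- N))"
    by (intro allI impI symbol_kernel_decay[OF assms(3)])
  show "\<exists>\<epsilon>>0. \<forall>N::real. N > 0 \<longrightarrow>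
      (\<exists>C>0. \<forall>j y y'. off_diagonal y \<longrightarrow>
        norm (y j - y') \<le> (1/2) * (MAX k. norm (y j - y k)) \<longrightarrow>
        norm (symbol_kernel a y - symbol_kernel a (y(j := y'))) \<le>
          C * norm (y j - y') powr \<epsilon>
            / total_dist y powr (real (CARD('m) * CARD('n)) + \<epsilon>)
            * min 1 ((MAX k. norm (y j - y k)) powr (- N)))"
    by (rule exI[of _ "1::real"], rule conjI[OF zero_less_one], intro allI impI,
        rule symbol_kernel_regularity[OF assms(3) less_imp_le[OF assms(2)]])
qed

end
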